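(* The singular octonionic Hopf foliation $\mathcal{F}_{OH}$ on $\mathbb{O}^2$ is generated by all (smooth) vector fields tangent to the leaves of the singular octonionic Hopf leaf decomposition $\mathcal{L}_{OH}$; that is, $\mathcal{F}_{OH}$ is the $C_c^\infty(\mathbb{O}^2)$-span of all smooth vector fields on $\mathbb{O}^2$ tangent to the leaves of $\mathcal{L}_{OH}$.
   Context: $\mathbb{O}\cong\mathbb{R}^8$ denotes the octonions: the real unital non-associative algebra with orthonormal basis $e_0=1,e_1,\dots,e_7$ and $e_i\cdot e_j=-\delta_{ij}1+\sum_k\epsilon_{ijk}e_k$ for $1\le i,j\le 7$, where $\epsilon_{ijk}$ is completely antisymmetric, equal to $1$ for $ijk\in\{123,145,176,246,257,347,365\}$, and $0$ for all triples that are not permutations of these; $\langle\cdot,\cdot\rangle$, $\|\cdot\|$ are the Euclidean inner product and norm and $\overline{a}=2\langle a,1\rangle 1-a$ is conjugation. $(x,y)$ denotes the point of $\mathbb{O}^2\cong\mathbb{R}^{16}$, and vector fields on $\mathbb{O}^2$ are identified with pairs of $\mathbb{O}$-valued functions. $\mathcal{L}_{OH}$: for $m\in\mathbb{O}$ let $l_m=\{(x,m\cdot x):x\in\mathbb{O}\}$ and let $l_\infty=\{(0,x):x\in\mathbb{O}\}$. For $r>0$ let $\mathrm{S}(r)=\{(x,y)\in\mathbb{O}^2:\|x\|^2+\|y\|^2=r^2\}$. The leaves of $\mathcal{L}_{OH}$ are $l_m\cap \mathrm{S}(r)$, $l_\infty\cap \mathrm{S}(r)$ ($m\in\mathbb{O}$,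 $r>0$), and the origin. A vector field is tangent to the leaves if at each point it lies in the tangent space of the leaf through that point. $\mathcal{F}_{OH}$: let $E_0=\mathbb{O}^2\times\mathbb{O}^2\to\mathbb{O}^2$ be the trivial bundle with fiber $\mathbb{O}^2$ and $\rho:E_0\to T\mathbb{O}^2$ the vector bundle morphism $$\rho\begin{pmatrix}u \\ v\end{pmatrix}=\begin{pmatrix}\|x\|^2u+(x\cdot\overline{y})\cdot v-(\langle x,u\rangle+\langle y,v\rangle)x \\ \|y\|^2v+(y\cdot\overline{x})\cdot u-(\langle x,u\rangle+\langle y,v\rangle)y\end{pmatrix}.$$ Then $\mathcal{F}_{OH}=\langle\{\rho(a):a\in\Gamma(E_0)\}\rangle_{C_c^\infty(\mathbb{O}^2)}\subset\mathfrak{X}_c(\mathbb{O}^2)$. *)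

theory Defs
  imports "HOL-Analysis.Analysis"
begin

section \<open>Octonions\<close>

text \<open>
  The octonions are the Euclidean space \<open>real ^ 8\<close>; the index type \<open>8\<close> is the integers
  modulo 8, so its elements are \<open>0, 1, ..., 7\<close> and \<open>e\<^sub>i\<close> is the standard basis vector with index
  \<open>i\<close>. Pitfall: the constants \<open>1\<close> and \<open>*\<close> on \<open>real ^ 8\<close> are componentwise, hence the unit
  octonion is \<open>oct_basis 0\<close> and the octonion product has its own symbol.
\<close>

type_synonym octonion = "real ^ 8"

type_synonym octonion2 = "octonion \<times> octonion"

definition oct_basis :: "8 \<Rightarrow> octonion" where
  "oct_basis i = axis i 1"

definition oct_triples :: "(8 \<times> 8 \<times> 8) set" where
  "oct_triples = {(1,2,3), (1,4,5), (1,7,6), (2,4,6), (2,5,7), (3,4,7), (3,6,5)}"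

text \<open>
  The completely antisymmetric symbol that is \<open>1\<close> on the triples above: \<open>1\<close> on their even (cyclic)
  permutations, \<open>-1\<close> on their odd permutations, and \<open>0\<close> elsewhere (in particular as soon as one
  index is \<open>0\<close>).
\<close>

definition oct_eps :: "8 \<Rightarrow> 8 \<Rightarrow> 8 \<Rightarrow> real" where
  "oct_eps i j k =
     (if (i,j,k) \<in> oct_triples \<or> (j,k,i) \<in> oct_triples \<or> (k,i,j) \<in> oct_triples then 1
      else if (j,i,k) \<in> oct_triples \<or> (i,k,j) \<in> oct_triples \<or> (k,j,i) \<in> oct_triples then -1
      else 0)"

definition oct_basis_mult :: "8 \<Rightarrow> 8 \<Rightarrow> octonion" where
  "oct_basis_mult i j =
     (if i = 0 then oct_basis j
      else if j = 0 then oct_basis i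
      else (if i = j then - oct_basis 0 else 0) + (\<Sum>k\<in>UNIV. oct_eps i j k *\<^sub>R oct_basis k))"

definition oct_mult :: "octonion \<Rightarrow> octonion \<Rightarrow> octonion" (infixl \<open>\<cdot>\<close> 70) where
  "x \<cdot> y = (\<Sum>i\<in>UNIV. \<Sum>j\<in>UNIV. (x $ i * y $ j) *\<^sub>R oct_basis_mult i j)"

definition oct_cnj :: "octonion \<Rightarrow> octonion" where
  "oct_cnj a = (2 * (a \<bullet> oct_basis 0)) *\<^sub>R oct_basis 0 - a"


section \<open>Smooth maps and tangent vectors\<close>

text \<open>
  \<open>C\<^sup>n\<close> on an open set: all iterated directional derivatives up to order \<open>n\<close> exist in the Frechet
  sense and are continuous.
\<close>

fun Ck_on :: "nat \<Rightarrow> 'a::real_normed_vector set \<Rightarrow> ('a \<Rightarrow> 'b::real_normed_vector) \<Rightarrow> bool" where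
  "Ck_on 0 S f \<longleftrightarrow> continuous_on S f"
| "Ck_on (Suc n) S f \<longleftrightarrow>
     (\<forall>x\<in>S. f differentiable (at x)) \<and> (\<forall>v. Ck_on n S (\<lambda>x. frechet_derivative f (at x) v))"

definition smooth_on :: "'a::real_normed_vector set \<Rightarrow> ('a \<Rightarrow> 'b::real_normed_vector) \<Rightarrow> bool" where
  "smooth_on S f \<longleftrightarrow> (\<forall>n. Ck_on n S f)"

text \<open>
  The tangent space at \<open>p\<close> of an embedded submanifold \<open>L\<close>: the velocities at \<open>p\<close> of the smooth
  curves that run inside \<open>L\<close>.
\<close>

definition tangent_space :: "'a::real_normed_vector set \<Rightarrow> 'a \<Rightarrow> 'a set" where
  "tangent_space L p =
     {w. \<exists>\<epsilon>>0. \<exists>c::real \<Rightarrow> 'a. smooth_on {-\<epsilon><..<\<epsilon>} c \<and> (\<forall>t\<in>{-\<epsilon><..<\<epsilon>}. c t \<in> L) \<and>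
         c 0 = p \<and> (c has_vector_derivative w) (at 0)}"

definition tangent_to_leaves :: "'a::real_normed_vector set set \<Rightarrow> ('a \<Rightarrow> 'a) \<Rightarrow> bool" where
  "tangent_to_leaves \<L> X \<longleftrightarrow> (\<forall>L\<in>\<L>. \<forall>p\<in>L. X p \<in> tangent_space L p)"

definition Cc_smooth :: "('a::real_normed_vector \<Rightarrow> real) set" where
  "Cc_smooth = {f. smooth_on UNIV f \<and> compact (closure {p. f p \<noteq> 0})}"

text \<open>
  The span \<open>\<langle>\<X>\<rangle>\<close> over the (non-unital) ring of compactly supported smooth functions: all finite
  sums \<open>\<Sum>i<n. f\<^sub>i X\<^sub>i\<close>.
\<close>

definition Cc_span :: "('a::real_normed_vector \<Rightarrow> 'a) set \<Rightarrow> ('a \<Rightarrow> 'a) set" where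
  "Cc_span \<X> =
     {Y. \<exists>(n::nat) f X. (\<forall>i<n. f i \<in> Cc_smooth \<and> X i \<in> \<X>) \<and> Y = (\<lambda>p. \<Sum>i<n. f i p *\<^sub>R X i p)}"


section \<open>The singular octonionic Hopf foliation\<close>

definition oct_line :: "octonion \<Rightarrow> octonion2 set" where
  "oct_line m = {(x, m \<cdot> x) | x. True}"

definition oct_line_inf :: "octonion2 set" where
  "oct_line_inf = {(0, x) | x. True}"

definition oct_sphere :: "real \<Rightarrow> octonion2 set" where
  "oct_sphere r = {(x, y). (norm x)\<^sup>2 + (norm y)\<^sup>2 = r\<^sup>2}"

definition L_OH :: "octonion2 set set" where
  "L_OH = {oct_line m \<inter> oct_sphere r | m r. r > 0} \<union> {oct_line_inf \<inter> oct_sphere r | r. r > 0}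
            \<union> {{(0, 0)}}"

fun rho_OH :: "octonion2 \<Rightarrow> octonion2 \<Rightarrow> octonion2" where
  "rho_OH (x, y) (u, v) =
     ((norm x)\<^sup>2 *\<^sub>R u + (x \<cdot> oct_cnj y) \<cdot> v - (x \<bullet> u + y \<bullet> v) *\<^sub>R x,
      (norm y)\<^sup>2 *\<^sub>R v + (y \<cdot> oct_cnj x) \<cdot> u - (x \<bullet> u + y \<bullet> v) *\<^sub>R y)"

text \<open>Sections of the trivial bundle with fibre \<open>octonion2\<close> are smooth maps into \<open>octonion2\<close>.\<close>

definition F_OH :: "(octonion2 \<Rightarrow> octonion2) set" where
  "F_OH = Cc_span {\<lambda>p. rho_OH p (a p) | a. smooth_on UNIV a}"

end

theory Submission
  imports Defs
begin

text \<open>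
  A field \<open>X = (A, B)\<close> is tangent to the leaves iff \<open>x \<bullet> A = 0\<close>, \<open>y \<bullet> B = 0\<close> and \<open>B \<cdot> x\<^sup>* + y \<cdot> A\<^sup>* = 0\<close>;
  on such fields \<open>\<rho> X = \<bar>p\<bar>\<^sup>2 X\<close>, so the only problem is to solve \<open>X = \<rho> a\<close> smoothly near the origin.

  For homogeneous polynomial fields, consider the Fischer-orthogonal complement \<open>H\<close> of the image of \<open>\<rho>\<close>
  among the tangent fields. It is stable under the nilpotent symmetries \<open>(x, y) \<mapsto> (x, y + m \<cdot> x)\<close>,
  whose generators lower the degree in \<open>y\<close>, since their adjoints are again symmetries of \<open>\<rho>\<close>. A field in \<open>H\<close>
  killed by all of them has \<open>A\<close> independent of \<open>y\<close>; then \<open>\<bar>x\<bar>\<^sup>2\<close> divides \<open>(h \<cdot> x\<^sup>*) \<cdot> A\<close> for every \<open>h\<close>, by a trace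
  identity it divides \<open>x \<and> A\<close>, and Koszul exactness puts the field into the image. Hence \<open>H = 0\<close>.

  Borel summation of these solutions gives a smooth \<open>a\<close> such that \<open>X - \<rho> a\<close> is tangent and flat at the
  origin, and a flat tangent field \<open>Y\<close> is \<open>\<rho> (Y / \<bar>p\<bar>\<^sup>2)\<close>.
\<close>

section \<open>Smooth maps on a normed space\<close>

text \<open>Dividing \<open>X\<close> by \<open>p \<bullet> p\<close> solves
  \<open>X = rho_OH p a\<close> away from the origin, but for a polynomial field the quotient is in
  general not smooth there. As \<open>rho_OH\<close> is quadratic in \<open>p\<close>, the
  homogeneous claim is that a tangent field of degree \<open>n\<close> comes from one of degree
  \<open>n - 2\<close>; for \<open>n < 2\<close> it says that only the zero field is tangent. The
  Fischer product is used because under it the adjoint of differentiation along a linear field is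
  differentiation along the transposed field. The equivariance of \<open>rho_OH\<close> has the form
  rho(g p) = g rho(p) g^T, so the transposed symmetry, moved to the other side of the product, sends
  the image to itself. Once \<open>A\<close> is independent of \<open>y\<close>, divisibility comes
  from the part of \<open>B\<close> that is linear in \<open>y\<close>: in the direction
  \<open>h\<close> it is a polynomial \<open>\<beta>\<close> with (x \<bullet> x) \<beta> = (h
  \<cdot> \<open>oct_cnj x\<close>) \<cdot> A. Summing over \<open>h\<close> against (h \<cdot>
  \<open>oct_cnj i\<close>) \<cdot> j isolates the coordinates of x \<wedge> A. Solving degree by
  degree determines only a Taylor series, which is why a Borel sum and a flat remainder
  follow.\<close>

abbreviation smooth :: "('a::real_normed_vector \<Rightarrow> 'b::real_normed_vector) \<Rightarrow> bool" where
  "smooth f \<equiv> smooth_on UNIV f"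

text \<open>The direction comes first, so that a derivative in a fixed direction is again a map of
  the same type and can be iterated.\<close>

definition dd :: "'a::real_normed_vector \<Rightarrow> ('a \<Rightarrow> 'b::real_normed_vector) \<Rightarrow> 'a \<Rightarrow> 'b" where
  "dd v f = (\<lambda>x. frechet_derivative f (at x) v)"

lemma dd_eq: "(f has_derivative f') (at x) \<Longrightarrow> dd v f x = f' v"
  unfolding dd_def using frechet_derivative_at by metis

lemma smooth_differentiable: "smooth f \<Longrightarrow> f differentiable (at x)"
  unfolding smooth_on_def using Ck_on.simps(2) by blast

lemma smooth_dd: "smooth f \<Longrightarrow> smooth (dd v f)"
  unfolding smooth_on_def dd_def using Ck_on.simps(2) by blast

lemma has_derivative_dd: "smooth f \<Longrightarrow> (f has_derivative (\<lambda>v. dd v f x)) (at x)"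
  using smooth_differentiable[of f x] unfolding dd_def
  by (simp add: frechet_derivative_works)

lemma smooth_continuous_on: "smooth f \<Longrightarrow> continuous_on S f"
  unfolding smooth_on_def using Ck_on.simps(1) continuous_on_subset by blast

lemma smooth_isCont: "smooth f \<Longrightarrow> isCont f x"
  using smooth_differentiable differentiable_imp_continuous_within by blast

lemma linear_dd: "smooth f \<Longrightarrow> linear (\<lambda>v. dd v f x)"
  using has_derivative_dd has_derivative_linear by blast

lemma Ck_on_UNIV_add:
  "Ck_on n UNIV f \<Longrightarrow> Ck_on n UNIV g \<Longrightarrow> Ck_on n UNIV (\<lambda>x. f x + g x)"
proof (induction n arbitrary: f g)
  case 0
  then show ?case by (simp add: continuous_on_add)
next
  case (Suc n)
  have d: "f differentiable at x" "g differentiable at x" for x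
    using Suc.prems by auto
  have fd: "frechet_derivative (\<lambda>x. f x + g x) (at x) v
      = frechet_derivative f (at x) v + frechet_derivative g (at x) v" for x v
    using dd_eq[OF has_derivative_add[OF d(1)[unfolded frechet_derivative_works] d(2)[unfolded frechet_derivative_works]], of v x]
    by (simp add: dd_def)
  have "Ck_on n UNIV (\<lambda>x. frechet_derivative f (at x) v + frechet_derivative g (at x) v)" for v
    by (rule Suc.IH) (use Suc.prems in auto)
  then show ?case
    using d by (simp add: fd differentiable_add)
qed

text \<open>The Leibniz rule takes a product to a sum of two products, which need not be a product.
  The induction on the order closes this gap because \<open>Ck_on\<close> is additive.\<close>

lemma smooth_coinduct_sum:
  assumes "P f"
    and diff: "\<And>f x. P f \<Longrightarrow> f differentiable (at x)"
    and dd: "\<And>f v. P f \<Longrightarrow> \<exists>g h. P g \<and> P h \<and> dd v f = (\<lambda>x. g x + h x)"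
  shows "smooth f"
proof -
  have "P f \<Longrightarrow> Ck_on n UNIV f" for n f
  proof (induction n arbitrary: f)
    case 0
    then show ?case
      using diff by (simp add: continuous_at_imp_continuous_on differentiable_imp_continuous_within)
  next
    case (Suc n)
    have "Ck_on n UNIV (dd v f)" for v
      using dd[OF Suc.prems, of v] Suc.IH Ck_on_UNIV_add by metis
    then show ?case
      using Suc.prems diff by (simp add: dd_def)
  qed
  then show ?thesis
    using \<open>P f\<close> by (simp add: smooth_on_def)
qed

lemma smooth_coinduct:
  assumes "P f"
    and diff: "\<And>f x. P f \<Longrightarrow> f differentiable (at x)"
    and dd: "\<And>f v. P f \<Longrightarrow> P (dd v f)"
  shows "smooth f"
\<comment> \<open>The zero map is adjoined so that a single derivative can be written as a sum of
  two members.\<close>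
proof (rule smooth_coinduct_sum[where P="\<lambda>f. P f \<or> f = (\<lambda>x. 0)"])
  fix f :: "'a \<Rightarrow> 'b" and v assume *: "P f \<or> f = (\<lambda>x. 0)"
  show "\<exists>g h. (P g \<or> g = (\<lambda>x. 0)) \<and> (P h \<or> h = (\<lambda>x. 0)) \<and> dd v f = (\<lambda>x. g x + h x)"
    using * dd[of f v] by (intro exI[of _ "dd v f"] exI[of _ "\<lambda>x. 0"]) (auto simp: dd_def)
qed (use \<open>P f\<close> diff in auto)

lemma smoothI:
  assumes "\<And>x. f differentiable (at x)" "\<And>v. smooth (dd v f)"
  shows "smooth f"
  by (rule smooth_coinduct[where P="\<lambda>f. (\<forall>x. f differentiable (at x)) \<and> (\<forall>v. smooth (dd v f))"])
    (use assms in \<open>auto intro: smooth_differentiable smooth_dd\<close>)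

lemma dd_const [simp]: "dd v (\<lambda>x. c) = (\<lambda>x. 0)"
  by (simp add: dd_def)

lemma smooth_const [simp, intro]: "smooth (\<lambda>x. c)"
  by (rule smooth_coinduct[where P="\<lambda>f. \<exists>c. f = (\<lambda>x. c)"]) auto

lemma dd_bounded_linear: "bounded_linear L \<Longrightarrow> dd v L = (\<lambda>x. L v)"
  using dd_eq bounded_linear_imp_has_derivative by fastforce

lemma smooth_bounded_linear: "bounded_linear L \<Longrightarrow> smooth L"
  by (rule smoothI)
    (auto simp: dd_bounded_linear bounded_linear_imp_differentiable)

lemma smooth_ident [simp, intro]: "smooth (\<lambda>x. x)"
  by (simp add: smooth_bounded_linear bounded_linear_ident)

lemma dd_ident [simp]: "dd v (\<lambda>x. x) = (\<lambda>x. v)"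
  by (simp add: dd_bounded_linear bounded_linear_ident)

lemma dd_add:
  "smooth f \<Longrightarrow> smooth g \<Longrightarrow> dd v (\<lambda>x. f x + g x) = (\<lambda>x. dd v f x + dd v g x)"
  by (rule ext, rule dd_eq, rule has_derivative_add) (auto intro: has_derivative_dd)

lemma smooth_add: "smooth f \<Longrightarrow> smooth g \<Longrightarrow> smooth (\<lambda>x. f x + g x)"
  by (simp add: smooth_on_def Ck_on_UNIV_add)

lemma dd_linear_comp:
  assumes "bounded_linear L" "smooth f"
  shows "dd v (\<lambda>x. L (f x)) = (\<lambda>x. L (dd v f x))"
  by (rule ext, rule dd_eq, rule bounded_linear.has_derivative) (auto intro: has_derivative_dd assms)

lemma smooth_linear_comp:
  assumes "bounded_linear L" "smooth f"
  shows "smooth (\<lambda>x. L (f x))"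
proof (rule smooth_coinduct[where P="\<lambda>h. \<exists>f. smooth f \<and> h = (\<lambda>x. L (f x))"])
  fix h x assume "\<exists>f. smooth f \<and> h = (\<lambda>x. L (f x))"
  then show "h differentiable at x"
    using bounded_linear.has_derivative[OF assms(1)] has_derivative_dd
    by (auto simp: differentiable_def) blast
qed (use assms dd_linear_comp smooth_dd in blast)+

lemma dd_comp_linear:
  assumes "smooth f" "bounded_linear L"
  shows "dd v (\<lambda>x. f (L x)) = (\<lambda>x. dd (L v) f (L x))"
proof
  fix x
  have "((\<lambda>x. f (L x)) has_derivative (\<lambda>v. dd (L v) f (L x))) (at x)"
    by (rule has_derivative_compose[where g=f])
      (auto intro: bounded_linear_imp_has_derivative assms has_derivative_dd)
  then show "dd v (\<lambda>x. f (L x)) x = dd (L v) f (L x)"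
    by (rule dd_eq)
qed

lemma smooth_comp_linear:
  assumes "smooth f" "bounded_linear L"
  shows "smooth (\<lambda>x. f (L x))"
proof (rule smooth_coinduct[where P="\<lambda>h. \<exists>f. smooth f \<and> h = (\<lambda>x. f (L x))"])
  fix h x assume "\<exists>f. smooth f \<and> h = (\<lambda>x. f (L x))"
  then obtain f where f: "smooth f" "h = (\<lambda>x. f (L x))" by auto
  have "((\<lambda>x. f (L x)) has_derivative (\<lambda>v. dd (L v) f (L x))) (at x)"
    by (rule has_derivative_compose[where g=f])
      (auto intro: bounded_linear_imp_has_derivative assms f has_derivative_dd)
  then show "h differentiable at x"
    using f(2) differentiable_def by blast
qed (use assms dd_comp_linear smooth_dd in blast)+

lemma dd_bilinear:
  assumes "bounded_bilinear B" "smooth f" "smooth g"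
  shows "dd v (\<lambda>x. B (f x) (g x)) = (\<lambda>x. B (f x) (dd v g x) + B (dd v f x) (g x))"
  by (rule ext, rule dd_eq, rule bounded_bilinear.FDERIV) (auto intro: has_derivative_dd assms)

lemma smooth_bilinear:
  assumes "bounded_bilinear B" "smooth f" "smooth g"
  shows "smooth (\<lambda>x. B (f x) (g x))"
proof (rule smooth_coinduct_sum[where P="\<lambda>h. \<exists>f g. smooth f \<and> smooth g \<and> h = (\<lambda>x. B (f x) (g x))"])
  fix h x assume "\<exists>f g. smooth f \<and> smooth g \<and> h = (\<lambda>x. B (f x) (g x))"
  then obtain f g where *: "smooth f" "smooth g" "h = (\<lambda>x. B (f x) (g x))" by auto
  show "h differentiable at x"
    unfolding *(3) differentiable_def
    using bounded_bilinear.FDERIV[OF assms(1) has_derivative_dd[OF *(1)] has_derivative_dd[OF *(2)]]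
    by blast
next
  fix h v assume "\<exists>f g. smooth f \<and> smooth g \<and> h = (\<lambda>x. B (f x) (g x))"
  then obtain f g where *: "smooth f" "smooth g" "h = (\<lambda>x. B (f x) (g x))" by auto
  show "\<exists>a b. (\<exists>f g. smooth f \<and> smooth g \<and> a = (\<lambda>x. B (f x) (g x))) \<and>
      (\<exists>f g. smooth f \<and> smooth g \<and> b = (\<lambda>x. B (f x) (g x))) \<and> dd v h = (\<lambda>x. a x + b x)"
    unfolding *(3) dd_bilinear[OF assms(1) *(1,2)]
    by (rule exI[of _ "\<lambda>x. B (f x) (dd v g x)"], rule exI[of _ "\<lambda>x. B (dd v f x) (g x)"])
      (blast intro: * smooth_dd)
qed (use assms in blast)

lemmas smooth_scaleR = smooth_bilinear[OF bounded_bilinear_scaleR]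
  and dd_scaleR = dd_bilinear[OF bounded_bilinear_scaleR]
  and smooth_inner = smooth_bilinear[OF bounded_bilinear_inner]
  and dd_inner = dd_bilinear[OF bounded_bilinear_inner]
  and smooth_scaleR_const = smooth_linear_comp[OF bounded_linear_scaleR_right]
  and dd_scaleR_const = dd_linear_comp[OF bounded_linear_scaleR_right]
  and smooth_inner_const = smooth_linear_comp[OF bounded_linear_inner_left]
  and dd_inner_const = dd_linear_comp[OF bounded_linear_inner_left]
  and smooth_minus = smooth_linear_comp[OF bounded_linear_minus[OF bounded_linear_ident]]
  and dd_minus = dd_linear_comp[OF bounded_linear_minus[OF bounded_linear_ident]]
  and smooth_fst = smooth_linear_comp[OF bounded_linear_fst]
  and smooth_snd = smooth_linear_comp[OF bounded_linear_snd]
  and dd_fst = dd_linear_comp[OF bounded_linear_fst]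
  and dd_snd = dd_linear_comp[OF bounded_linear_snd]

lemma smooth_diff: "smooth f \<Longrightarrow> smooth g \<Longrightarrow> smooth (\<lambda>x. f x - g x)"
  using smooth_add[OF _ smooth_minus, of f g] by simp

lemma dd_diff:
  "smooth f \<Longrightarrow> smooth g \<Longrightarrow> dd v (\<lambda>x. f x - g x) = (\<lambda>x. dd v f x - dd v g x)"
  using dd_add[OF _ smooth_minus, of f g] by (simp add: dd_minus)

lemma smooth_sum: "(\<And>i. i \<in> I \<Longrightarrow> smooth (f i)) \<Longrightarrow> smooth (\<lambda>x. \<Sum>i\<in>I. f i x)"
  by (induction I rule: infinite_finite_induct) (auto intro: smooth_add)

lemma dd_sum:
  "(\<And>i. i \<in> I \<Longrightarrow> smooth (f i)) \<Longrightarrow> dd v (\<lambda>x. \<Sum>i\<in>I. f i x) = (\<lambda>x. \<Sum>i\<in>I. dd v (f i) x)"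
  by (induction I rule: infinite_finite_induct) (auto simp: dd_add smooth_sum)

lemma smooth_Pair: "smooth f \<Longrightarrow> smooth g \<Longrightarrow> smooth (\<lambda>x. (f x, g x))"
proof -
  assume "smooth f" "smooth g"
  then have "smooth (\<lambda>x. (f x, 0) + (0, g x))"
    using smooth_linear_comp[OF bounded_linear_Pair[OF bounded_linear_ident bounded_linear_zero], of f]
      smooth_linear_comp[OF bounded_linear_Pair[OF bounded_linear_zero bounded_linear_ident], of g]
    by (intro smooth_add) auto
  then show ?thesis by simp
qed

lemma dd_Pair:
  "smooth f \<Longrightarrow> smooth g \<Longrightarrow> dd v (\<lambda>x. (f x, g x)) = (\<lambda>x. (dd v f x, dd v g x))"
  by (rule ext, rule dd_eq, rule has_derivative_Pair) (auto intro: has_derivative_dd)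

lemma dd_eq_sum_Basis:
  fixes f :: "'a::euclidean_space \<Rightarrow> 'b::real_normed_vector"
  assumes "smooth f"
  shows "dd v f x = (\<Sum>i\<in>Basis. (v \<bullet> i) *\<^sub>R dd i f x)"
proof -
  interpret linear "\<lambda>v. dd v f x" using linear_dd[OF assms] .
  have "dd v f x = dd (\<Sum>i\<in>Basis. (v \<bullet> i) *\<^sub>R i) f x"
    by (simp add: euclidean_representation)
  then show ?thesis by (simp add: sum scale)
qed

lemma smooth_dd_var:
  fixes f :: "'a::euclidean_space \<Rightarrow> 'b::real_normed_vector"
  assumes "smooth f" "smooth w"
  shows "smooth (\<lambda>x. dd (w x) f x)"
  by (subst dd_eq_sum_Basis[OF assms(1)])
    (intro smooth_sum smooth_scaleR smooth_inner_const smooth_dd assms)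

text \<open>Products \<open>exp (q x) * g x\<close> with \<open>g\<close> smooth are closed under
  differentiation; the claim is the case \<open>g = 1\<close>.\<close>

lemma smooth_exp_comp:
  assumes "smooth (q :: 'a::real_normed_vector \<Rightarrow> real)"
  shows "smooth (\<lambda>x. exp (q x))"
proof (rule smooth_coinduct[where P="\<lambda>h. \<exists>g. smooth g \<and> h = (\<lambda>x. exp (q x) * g x)"])
  have D: "((\<lambda>x. exp (q x) * g x) has_derivative
      (\<lambda>v. exp (q x) * (dd v q x * g x + dd v g x))) (at x)" if "smooth g" for g x
    by (auto intro!: derivative_eq_intros has_derivative_dd assms that simp: algebra_simps)
  fix h x assume "\<exists>g. smooth g \<and> h = (\<lambda>x. exp (q x) * g x)"
  then show "h differentiable at x"
    using D differentiable_def by blast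
  fix v
  obtain g where g: "smooth g" "h = (\<lambda>x. exp (q x) * g x)"
    using \<open>\<exists>g. smooth g \<and> h = (\<lambda>x. exp (q x) * g x)\<close> by blast
  have "dd v h = (\<lambda>x. exp (q x) * (dd v q x * g x + dd v g x))"
    unfolding g(2) by (rule ext, rule dd_eq[OF D[OF g(1)]])
  moreover have "smooth (\<lambda>x. dd v q x * g x + dd v g x)"
    by (intro smooth_add smooth_bilinear[OF bounded_bilinear_mult] smooth_dd g assms)
  ultimately show "\<exists>g. smooth g \<and> dd v h = (\<lambda>x. exp (q x) * g x)" by blast
qed (rule exI[of _ "\<lambda>x. 1"], simp)

lemma dd_exp_comp:
  assumes "smooth (q :: 'a::real_normed_vector \<Rightarrow> real)"
  shows "dd v (\<lambda>x. exp (q x)) = (\<lambda>x. exp (q x) * dd v q x)"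
proof
  fix x
  have "((\<lambda>x. exp (q x)) has_derivative (\<lambda>v. exp (q x) * dd v q x)) (at x)"
    by (auto intro!: derivative_eq_intros has_derivative_dd assms)
  then show "dd v (\<lambda>x. exp (q x)) x = exp (q x) * dd v q x" by (rule dd_eq)
qed

section \<open>Symmetry of mixed directional derivatives\<close>

lemma dd_line:
  assumes "smooth f"
  shows "((\<lambda>t. f (a + t *\<^sub>R v)) has_derivative (\<lambda>s. s *\<^sub>R dd v f (a + t *\<^sub>R v))) (at t)"
proof -
  have "((\<lambda>t. f (a + t *\<^sub>R v)) has_derivative (\<lambda>s. dd (s *\<^sub>R v) f (a + t *\<^sub>R v))) (at t)"
    by (rule has_derivative_compose[where g=f, OF _ has_derivative_dd[OF assms]])
      (auto intro!: derivative_eq_intros)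
  then show ?thesis
    using linear_scale[OF linear_dd[OF assms]] by simp
qed

text \<open>The second difference does not change when \<open>u\<close> and \<open>v\<close> are
  exchanged. Divided by \<open>h\<^sup>2\<close> it is a value of either mixed derivative near
  \<open>p\<close>, so continuity gives the claim as \<open>h\<close> tends to 0.\<close>

lemma dd_commute_real:
  fixes f :: "'a::real_normed_vector \<Rightarrow> real"
  assumes f: "smooth f"
  shows "dd u (dd v f) p = dd v (dd u f) p"
proof -
  \<comment> \<open>two applications of the mean value theorem to the second difference\<close>
  have MVT2: "\<exists>s\<in>{0<..<h}. \<exists>t\<in>{0<..<h}.
      f (p + h *\<^sub>R u + h *\<^sub>R v) - f (p + h *\<^sub>R u) - f (p + h *\<^sub>R v) + f p
        = h\<^sup>2 * dd v (dd u f) (p + s *\<^sub>R u + t *\<^sub>R v)" if hpos: "h > 0" for h :: real and u v :: 'a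
  proof -
    let ?F = "\<lambda>s. f ((p + h *\<^sub>R v) + s *\<^sub>R u) - f (p + s *\<^sub>R u)"
    have "(?F has_real_derivative (dd u f ((p + h *\<^sub>R v) + s *\<^sub>R u) - dd u f (p + s *\<^sub>R u))) (at s)" for s
      unfolding has_field_derivative_def
      by (rule has_derivative_eq_rhs[OF has_derivative_diff[OF dd_line[OF f] dd_line[OF f]]])
        (auto simp: algebra_simps)
    then obtain s where s: "0 < s" "s < h"
      "?F h - ?F 0 = h * (dd u f ((p + h *\<^sub>R v) + s *\<^sub>R u) - dd u f (p + s *\<^sub>R u))"
      using MVT2[of 0 h ?F "\<lambda>s. dd u f ((p + h *\<^sub>R v) + s *\<^sub>R u) - dd u f (p + s *\<^sub>R u)"] hpos
      by auto
    let ?G = "\<lambda>t. dd u f ((p + s *\<^sub>R u) + t *\<^sub>R v)"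
    have "(?G has_real_derivative dd v (dd u f) ((p + s *\<^sub>R u) + t *\<^sub>R v)) (at t)" for t
      unfolding has_field_derivative_def
      by (rule has_derivative_eq_rhs[OF dd_line[OF smooth_dd[OF f]]]) (auto simp: algebra_simps)
    then obtain t where t: "0 < t" "t < h"
      "?G h - ?G 0 = h * dd v (dd u f) ((p + s *\<^sub>R u) + t *\<^sub>R v)"
      using MVT2[of 0 h ?G "\<lambda>t. dd v (dd u f) ((p + s *\<^sub>R u) + t *\<^sub>R v)"] hpos by auto
    show ?thesis
      using s t by (intro bexI[of _ s] bexI[of _ t]) (auto simp: algebra_simps power2_eq_square)
  qed
  have ex: "\<exists>q q'. dist q p \<le> h * (norm u + norm v) \<and> dist q' p \<le> h * (norm u + norm v) \<and>
      dd v (dd u f) q = dd u (dd v f) q'" if "h > 0" for h :: real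
  proof -
    from MVT2[OF that, of u v] obtain s t where 1: "s \<in> {0<..<h}" "t \<in> {0<..<h}"
      "f (p + h *\<^sub>R u + h *\<^sub>R v) - f (p + h *\<^sub>R u) - f (p + h *\<^sub>R v) + f p
        = h\<^sup>2 * dd v (dd u f) (p + s *\<^sub>R u + t *\<^sub>R v)" by blast
    from MVT2[OF that, of v u] obtain s' t' where 2: "s' \<in> {0<..<h}" "t' \<in> {0<..<h}"
      "f (p + h *\<^sub>R v + h *\<^sub>R u) - f (p + h *\<^sub>R v) - f (p + h *\<^sub>R u) + f p
        = h\<^sup>2 * dd u (dd v f) (p + s' *\<^sub>R v + t' *\<^sub>R u)" by blast
    have "h\<^sup>2 * dd v (dd u f) (p + s *\<^sub>R u + t *\<^sub>R v) = h\<^sup>2 * dd u (dd v f) (p + s' *\<^sub>R v + t' *\<^sub>R u)"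
      unfolding 1(3)[symmetric] 2(3)[symmetric] by (simp add: algebra_simps)
    then have "dd v (dd u f) (p + s *\<^sub>R u + t *\<^sub>R v) = dd u (dd v f) (p + s' *\<^sub>R v + t' *\<^sub>R u)"
      using that by simp
    moreover have d: "dist (p + a *\<^sub>R u' + b *\<^sub>R v') p \<le> h * (norm u' + norm v')"
      if "a \<in> {0<..<h}" "b \<in> {0<..<h}" for a b u' v'
    proof -
      have "dist (p + a *\<^sub>R u' + b *\<^sub>R v') p \<le> norm (a *\<^sub>R u') + norm (b *\<^sub>R v')"
        using norm_triangle_ineq[of "a *\<^sub>R u'" "b *\<^sub>R v'"] by (simp add: dist_norm add.assoc)
      also have "\<dots> \<le> h * norm u' + h * norm v'"
        using that by (auto intro!: add_mono mult_right_mono)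
      finally show ?thesis by (simp add: algebra_simps)
    qed
    moreover have "dist (p + s' *\<^sub>R v + t' *\<^sub>R u) p \<le> h * (norm u + norm v)"
      using d[OF 2(1,2), of v u] by (simp add: add.commute)
    ultimately show ?thesis
      using d[OF 1(1,2), of u v] by blast
  qed
  define h where "h n = 1 / real (Suc n)" for n
  have h: "h n > 0" for n by (simp add: h_def)
  obtain q q' where q: "\<And>n. dist (q n) p \<le> h n * (norm u + norm v)"
    "\<And>n. dist (q' n) p \<le> h n * (norm u + norm v)"
    "\<And>n. dd v (dd u f) (q n) = dd u (dd v f) (q' n)"
  proof -
    have "\<forall>n. \<exists>q. dist (fst q) p \<le> h n * (norm u + norm v) \<and> dist (snd q) p \<le> h n * (norm u + norm v) \<and>
      dd v (dd u f) (fst q) = dd u (dd v f) (snd q)"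
      using ex[OF h] by simp
    then obtain q where "\<forall>n. dist (fst (q n)) p \<le> h n * (norm u + norm v) \<and>
      dist (snd (q n)) p \<le> h n * (norm u + norm v) \<and> dd v (dd u f) (fst (q n)) = dd u (dd v f) (snd (q n))"
      by (rule choice[THEN exE])
    then show thesis
      by (intro that[of "\<lambda>n. fst (q n)" "\<lambda>n. snd (q n)"]) auto
  qed
  have h0: "(\<lambda>n. h n * (norm u + norm v)) \<longlonglongrightarrow> 0"
    unfolding h_def by (rule tendsto_mult_left_zero) (rule lim_1_over_n[THEN LIMSEQ_Suc])
  have q1: "q \<longlonglongrightarrow> p"
    by (rule metric_tendsto_imp_tendsto[OF h0], rule always_eventually)
      (use q(1) h in \<open>simp add: dist_norm less_imp_le abs_mult\<close>)
  have q2: "q' \<longlonglongrightarrow> p"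
    by (rule metric_tendsto_imp_tendsto[OF h0], rule always_eventually)
      (use q(2) h in \<open>simp add: dist_norm less_imp_le abs_mult\<close>)
  note L = isCont_tendsto_compose[OF smooth_isCont[OF smooth_dd[OF smooth_dd[OF f]]]]
  show ?thesis
    by (rule LIMSEQ_unique[OF L[OF q2]], subst q(3)[symmetric], rule L[OF q1])
qed

lemma dd_commute:
  fixes f :: "'a::real_normed_vector \<Rightarrow> 'b::euclidean_space"
  assumes f: "smooth f"
  shows "dd u (dd v f) = dd v (dd u f)"
proof
  fix p
  show "dd u (dd v f) p = dd v (dd u f) p"
  proof (rule euclidean_eqI)
    fix b :: 'b
    show "dd u (dd v f) p \<bullet> b = dd v (dd u f) p \<bullet> b"
      using dd_commute_real[OF smooth_inner_const[OF f, of b], of u v p]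
      unfolding dd_inner_const[OF f] dd_inner_const[OF smooth_dd[OF f]] .
  qed
qed

section \<open>Octonion algebra\<close>

lemma exhaust_8:
  fixes x :: 8
  shows "x = 0 \<or> x = 1 \<or> x = 2 \<or> x = 3 \<or> x = 4 \<or> x = 5 \<or> x = 6 \<or> x = 7"
proof (induct x)
  case (of_int z)
  then have "z = 0 \<or> z = 1 \<or> z = 2 \<or> z = 3 \<or> z = 4 \<or> z = 5 \<or> z = 6 \<or> z = 7" by fastforce
  then show ?case by auto
qed

lemma forall_8: "(\<forall>i::8. P i) \<longleftrightarrow> P 0 \<and> P 1 \<and> P 2 \<and> P 3 \<and> P 4 \<and> P 5 \<and> P 6 \<and> P 7"
  by (metis exhaust_8)

lemma UNIV_8: "UNIV = {0, 1, 2, 3, 4, 5, 6, 7::8}"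
  using exhaust_8 by auto

lemma sum_8: "sum f (UNIV::8 set) = f 0 + f 1 + f 2 + f 3 + f 4 + f 5 + f 6 + f 7"
  unfolding UNIV_8 by (simp add: ac_simps)

lemma oct_basis_mult_table:
  shows "oct_basis_mult 0 0 = oct_basis 0"
    and "oct_basis_mult 0 1 = oct_basis 1"
    and "oct_basis_mult 0 2 = oct_basis 2"
    and "oct_basis_mult 0 3 = oct_basis 3"
    and "oct_basis_mult 0 4 = oct_basis 4"
    and "oct_basis_mult 0 5 = oct_basis 5"
    and "oct_basis_mult 0 6 = oct_basis 6"
    and "oct_basis_mult 0 7 = oct_basis 7"
    and "oct_basis_mult 1 0 = oct_basis 1"
    and "oct_basis_mult 1 1 = - oct_basis 0"
    and "oct_basis_mult 1 2 = oct_basis 3"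
    and "oct_basis_mult 1 3 = - oct_basis 2"
    and "oct_basis_mult 1 4 = oct_basis 5"
    and "oct_basis_mult 1 5 = - oct_basis 4"
    and "oct_basis_mult 1 6 = - oct_basis 7"
    and "oct_basis_mult 1 7 = oct_basis 6"
    and "oct_basis_mult 2 0 = oct_basis 2"
    and "oct_basis_mult 2 1 = - oct_basis 3"
    and "oct_basis_mult 2 2 = - oct_basis 0"
    and "oct_basis_mult 2 3 = oct_basis 1"
    and "oct_basis_mult 2 4 = oct_basis 6"
    and "oct_basis_mult 2 5 = oct_basis 7"
    and "oct_basis_mult 2 6 = - oct_basis 4"
    and "oct_basis_mult 2 7 = - oct_basis 5"
    and "oct_basis_mult 3 0 = oct_basis 3"
    and "oct_basis_mult 3 1 = oct_basis 2"
    and "oct_basis_mult 3 2 = - oct_basis 1"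
    and "oct_basis_mult 3 3 = - oct_basis 0"
    and "oct_basis_mult 3 4 = oct_basis 7"
    and "oct_basis_mult 3 5 = - oct_basis 6"
    and "oct_basis_mult 3 6 = oct_basis 5"
    and "oct_basis_mult 3 7 = - oct_basis 4"
    and "oct_basis_mult 4 0 = oct_basis 4"
    and "oct_basis_mult 4 1 = - oct_basis 5"
    and "oct_basis_mult 4 2 = - oct_basis 6"
    and "oct_basis_mult 4 3 = - oct_basis 7"
    and "oct_basis_mult 4 4 = - oct_basis 0"
    and "oct_basis_mult 4 5 = oct_basis 1"
    and "oct_basis_mult 4 6 = oct_basis 2"
    and "oct_basis_mult 4 7 = oct_basis 3"
    and "oct_basis_mult 5 0 = oct_basis 5"
    and "oct_basis_mult 5 1 = oct_basis 4"
    and "oct_basis_mult 5 2 = - oct_basis 7"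
    and "oct_basis_mult 5 3 = oct_basis 6"
    and "oct_basis_mult 5 4 = - oct_basis 1"
    and "oct_basis_mult 5 5 = - oct_basis 0"
    and "oct_basis_mult 5 6 = - oct_basis 3"
    and "oct_basis_mult 5 7 = oct_basis 2"
    and "oct_basis_mult 6 0 = oct_basis 6"
    and "oct_basis_mult 6 1 = oct_basis 7"
    and "oct_basis_mult 6 2 = oct_basis 4"
    and "oct_basis_mult 6 3 = - oct_basis 5"
    and "oct_basis_mult 6 4 = - oct_basis 2"
    and "oct_basis_mult 6 5 = oct_basis 3"
    and "oct_basis_mult 6 6 = - oct_basis 0"
    and "oct_basis_mult 6 7 = - oct_basis 1"
    and "oct_basis_mult 7 0 = oct_basis 7"
    and "oct_basis_mult 7 1 = - oct_basis 6"
    and "oct_basis_mult 7 2 = oct_basis 5"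
    and "oct_basis_mult 7 3 = oct_basis 4"
    and "oct_basis_mult 7 4 = - oct_basis 3"
    and "oct_basis_mult 7 5 = - oct_basis 2"
    and "oct_basis_mult 7 6 = oct_basis 1"
    and "oct_basis_mult 7 7 = - oct_basis 0"
  by (simp_all add: oct_basis_mult_def sum_8 oct_eps_def oct_triples_def)

text \<open>In coordinates the basic octonion identities below become real polynomial identities,
  which \<open>algebra_simps\<close> decides.\<close>

lemma oct_mult_nth:
  shows "(x \<cdot> y) $ 0 = x $ 0 * y $ 0 - x $ 1 * y $ 1 - x $ 2 * y $ 2 - x $ 3 * y $ 3 - x $ 4 * y $ 4 - x $ 5 * y $ 5 - x $ 6 * y $ 6 - x $ 7 * y $ 7"
    and "(x \<cdot> y) $ 1 = x $ 0 * y $ 1 + x $ 1 * y $ 0 + x $ 2 * y $ 3 - x $ 3 * y $ 2 + x $ 4 * y $ 5 - x $ 5 * y $ 4 - x $ 6 * y $ 7 + x $ 7 * y $ 6"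
    and "(x \<cdot> y) $ 2 = x $ 0 * y $ 2 - x $ 1 * y $ 3 + x $ 2 * y $ 0 + x $ 3 * y $ 1 + x $ 4 * y $ 6 + x $ 5 * y $ 7 - x $ 6 * y $ 4 - x $ 7 * y $ 5"
    and "(x \<cdot> y) $ 3 = x $ 0 * y $ 3 + x $ 1 * y $ 2 - x $ 2 * y $ 1 + x $ 3 * y $ 0 + x $ 4 * y $ 7 - x $ 5 * y $ 6 + x $ 6 * y $ 5 - x $ 7 * y $ 4"
    and "(x \<cdot> y) $ 4 = x $ 0 * y $ 4 - x $ 1 * y $ 5 - x $ 2 * y $ 6 - x $ 3 * y $ 7 + x $ 4 * y $ 0 + x $ 5 * y $ 1 + x $ 6 * y $ 2 + x $ 7 * y $ 3"
    and "(x \<cdot> y) $ 5 = x $ 0 * y $ 5 + x $ 1 * y $ 4 - x $ 2 * y $ 7 + x $ 3 * y $ 6 - x $ 4 * y $ 1 + x $ 5 * y $ 0 - x $ 6 * y $ 3 + x $ 7 * y $ 2"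
    and "(x \<cdot> y) $ 6 = x $ 0 * y $ 6 + x $ 1 * y $ 7 + x $ 2 * y $ 4 - x $ 3 * y $ 5 - x $ 4 * y $ 2 + x $ 5 * y $ 3 + x $ 6 * y $ 0 - x $ 7 * y $ 1"
    and "(x \<cdot> y) $ 7 = x $ 0 * y $ 7 - x $ 1 * y $ 6 + x $ 2 * y $ 5 + x $ 3 * y $ 4 - x $ 4 * y $ 3 - x $ 5 * y $ 2 + x $ 6 * y $ 1 + x $ 7 * y $ 0"
  by (simp_all add: oct_mult_def sum_8 oct_basis_mult_table oct_basis_def axis_def)

lemma oct_cnj_nth: "oct_cnj x $ k = (if k = 0 then x $ 0 else - x $ k)"
  by (simp add: oct_cnj_def oct_basis_def inner_axis) (simp add: axis_def)

lemma inner_oct: "(x::octonion) \<bullet> y = x $ 0 * y $ 0 + x $ 1 * y $ 1 + x $ 2 * y $ 2 + x $ 3 * y $ 3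
    + x $ 4 * y $ 4 + x $ 5 * y $ 5 + x $ 6 * y $ 6 + x $ 7 * y $ 7"
  by (simp add: inner_vec_def sum_8)

lemma bilinear_oct_mult: "bilinear (\<cdot>)"
  unfolding bilinear_def
  by (auto intro!: linearI simp: vec_eq_iff forall_8 oct_mult_nth algebra_simps)

lemma bounded_bilinear_oct_mult: "bounded_bilinear (\<cdot>)"
  using bilinear_conv_bounded_bilinear bilinear_oct_mult by blast

interpretation oct_mult: bounded_bilinear "(\<cdot>)"
  by (rule bounded_bilinear_oct_mult)

lemma linear_oct_cnj: "linear oct_cnj"
  by (auto intro!: linearI simp: oct_cnj_def algebra_simps)

lemma bounded_linear_oct_cnj: "bounded_linear oct_cnj"
  using linear_conv_bounded_linear linear_oct_cnj by blast

lemmas oct_cnj_add = linear_add[OF linear_oct_cnj]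
  and oct_cnj_diff = linear_diff[OF linear_oct_cnj]
  and oct_cnj_scaleR = linear_scale[OF linear_oct_cnj]
  and oct_cnj_0 [simp] = linear_0[OF linear_oct_cnj]

lemma oct_cnj_cnj [simp]: "oct_cnj (oct_cnj x) = x"
  by (simp add: vec_eq_iff oct_cnj_nth)

lemma oct_cnj_mult: "oct_cnj (x \<cdot> y) = oct_cnj y \<cdot> oct_cnj x"
  by (simp add: vec_eq_iff forall_8 oct_cnj_nth oct_mult_nth algebra_simps)

lemma inner_oct_cnj_cnj [simp]: "oct_cnj x \<bullet> oct_cnj y = x \<bullet> y"
  by (simp add: inner_oct oct_cnj_nth)

lemma inner_mult_left: "(x \<cdot> y) \<bullet> z = y \<bullet> (oct_cnj x \<cdot> z)"
  by (simp add: inner_oct oct_cnj_nth oct_mult_nth algebra_simps)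

lemma inner_mult_right: "(x \<cdot> y) \<bullet> z = x \<bullet> (z \<cdot> oct_cnj y)"
  by (simp add: inner_oct oct_cnj_nth oct_mult_nth algebra_simps)

text \<open>This law and the three after it are what alternativity leaves of associativity: a
  product may be re-bracketed when a factor stands next to its conjugate.\<close>

lemma cnj_mult_mult: "oct_cnj x \<cdot> (x \<cdot> y) = (x \<bullet> x) *\<^sub>R y"
  by (simp add: vec_eq_iff forall_8 inner_oct oct_cnj_nth oct_mult_nth algebra_simps)

lemma mult_mult_cnj: "(y \<cdot> x) \<cdot> oct_cnj x = (x \<bullet> x) *\<^sub>R y"
  by (simp add: vec_eq_iff forall_8 inner_oct oct_cnj_nth oct_mult_nth algebra_simps)

lemma mult_cnj_mult: "x \<cdot> (oct_cnj x \<cdot> y) = (x \<bullet> x) *\<^sub>R y"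
  using cnj_mult_mult[of "oct_cnj x" y] by simp

lemma mult_cnj_mult_right: "(y \<cdot> oct_cnj x) \<cdot> x = (x \<bullet> x) *\<^sub>R y"
  using mult_mult_cnj[of y "oct_cnj x"] by simp

text \<open>The polarized law is a Clifford relation. It exchanges two factors at the cost of an
  inner product, and so brings a factor next to its conjugate.\<close>

lemma mult_cnj_mult_polar: "m \<cdot> (oct_cnj n \<cdot> v) + n \<cdot> (oct_cnj m \<cdot> v) = (2 * (m \<bullet> n)) *\<^sub>R v"
  using mult_cnj_mult[of "m + n" v] mult_cnj_mult[of m v] mult_cnj_mult[of n v]
  by (simp add: oct_mult.add_left oct_mult.add_right oct_cnj_add inner_commute algebra_simps
      scaleR_2[symmetric])

lemma mult_mult_cnj_polar: "(v \<cdot> oct_cnj m) \<cdot> n + (v \<cdot> oct_cnj n) \<cdot> m = (2 * (m \<bullet> n)) *\<^sub>R v"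
  using mult_cnj_mult_right[of v "m + n"] mult_cnj_mult_right[of v m] mult_cnj_mult_right[of v n]
  by (simp add: oct_mult.add_left oct_mult.add_right oct_cnj_add inner_commute algebra_simps
      scaleR_2[symmetric])

lemma inner_mult_mult_left: "(x \<cdot> y) \<bullet> (x \<cdot> z) = (x \<bullet> x) * (y \<bullet> z)"
  by (simp add: inner_mult_left cnj_mult_mult)

section \<open>The bundle map and its kernel description\<close>

text \<open>With p = (x, y), the third expression is the derivative of y \<cdot>
  \<open>oct_cnj x\<close> along \<open>w\<close>. For x \<noteq> 0 this product is x \<bullet> x
  times the slope of the line through \<open>p\<close>, so with the norms of x and y held fixed the
  equation says that the slope is fixed. At the origin every \<open>w\<close> passes.\<close>

definition hopf_tangent :: "octonion2 \<Rightarrow> octonion2 \<Rightarrow> bool" where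
  "hopf_tangent p w \<longleftrightarrow> fst p \<bullet> fst w = 0 \<and> snd p \<bullet> snd w = 0 \<and>
     snd w \<cdot> oct_cnj (fst p) + snd p \<cdot> oct_cnj (fst w) = 0"

lemma hopf_tangent_add: "hopf_tangent p w \<Longrightarrow> hopf_tangent p w' \<Longrightarrow> hopf_tangent p (w + w')"
  unfolding hopf_tangent_def
  by (simp add: inner_add_right oct_cnj_add oct_mult.add_left oct_mult.add_right add_ac)

lemma hopf_tangent_scaleR: "hopf_tangent p w \<Longrightarrow> hopf_tangent p (c *\<^sub>R w)"
  unfolding hopf_tangent_def
  by (simp add: oct_cnj_scaleR oct_mult.scaleR_left oct_mult.scaleR_right scaleR_add_right[symmetric])

lemma hopf_tangent_diff: "hopf_tangent p w \<Longrightarrow> hopf_tangent p w' \<Longrightarrow> hopf_tangent p (w - w')"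
  using hopf_tangent_add[of p w "(-1) *\<^sub>R w'"] hopf_tangent_scaleR[of p w' "-1"] by simp

lemma rho_OH_eq:
  "rho_OH p a =
     ((fst p \<bullet> fst p) *\<^sub>R fst a + (fst p \<cdot> oct_cnj (snd p)) \<cdot> snd a - (p \<bullet> a) *\<^sub>R fst p,
      (snd p \<bullet> snd p) *\<^sub>R snd a + (snd p \<cdot> oct_cnj (fst p)) \<cdot> fst a - (p \<bullet> a) *\<^sub>R snd p)"
  by (cases p, cases a) (simp add: power2_norm_eq_inner inner_prod_def)

lemma rho_OH_add: "rho_OH p (a + b) = rho_OH p a + rho_OH p b"
  by (simp add: rho_OH_eq oct_mult.add_right algebra_simps inner_add_right)

lemma rho_OH_scaleR: "rho_OH p (c *\<^sub>R a) = c *\<^sub>R rho_OH p a"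
  by (simp add: rho_OH_eq oct_mult.scaleR_right algebra_simps)

lemma linear_rho_OH: "linear (rho_OH p)"
  by (rule linearI) (simp_all add: rho_OH_add rho_OH_scaleR)

text \<open>\<open>rho_OH p\<close> is \<open>p \<bullet> p\<close> times the orthogonal projection
  onto the tangent vectors; here the image is located, and \<open>rho_OH_hopf_tangent\<close> gives
  the factor.\<close>

lemma hopf_tangent_rho_OH: "hopf_tangent p (rho_OH p a)"
proof -
  obtain x y where p: "p = (x, y)" by (cases p)
  obtain u v where a: "a = (u, v)" by (cases a)
  have 1: "x \<bullet> ((x \<cdot> oct_cnj y) \<cdot> v) = (x \<bullet> x) * (y \<bullet> v)"
    by (subst inner_commute, subst inner_mult_left)
      (simp add: oct_cnj_mult mult_cnj_mult_right inner_commute)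
  have 2: "y \<bullet> ((y \<cdot> oct_cnj x) \<cdot> u) = (y \<bullet> y) * (x \<bullet> u)"
    by (subst inner_commute, subst inner_mult_left)
      (simp add: oct_cnj_mult mult_cnj_mult_right inner_commute)
  \<comment> \<open>Exchanging \<open>x\<close> and \<open>u\<close> puts \<open>x\<close> next to
    \<open>oct_cnj x\<close>, where they combine to a norm; the same is done for \<open>y\<close>
    and \<open>v\<close> below.\<close>
  have "(y \<cdot> oct_cnj x) \<cdot> u = (2 * (x \<bullet> u)) *\<^sub>R y - (y \<cdot> oct_cnj u) \<cdot> x"
    using mult_mult_cnj_polar[of y x u] by (simp add: algebra_simps)
  then have 3: "((y \<cdot> oct_cnj x) \<cdot> u) \<cdot> oct_cnj x
      = (2 * (x \<bullet> u)) *\<^sub>R (y \<cdot> oct_cnj x) - (x \<bullet> x) *\<^sub>R (y \<cdot> oct_cnj u)"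
    by (simp add: oct_mult.diff_left oct_mult.scaleR_left mult_mult_cnj)
  have "oct_cnj v \<cdot> (y \<cdot> oct_cnj x) = (2 * (y \<bullet> v)) *\<^sub>R oct_cnj x - oct_cnj y \<cdot> (v \<cdot> oct_cnj x)"
    using mult_cnj_mult_polar[of "oct_cnj v" "oct_cnj y" "oct_cnj x"]
    by (simp add: algebra_simps inner_commute)
  then have 4: "y \<cdot> (oct_cnj v \<cdot> (y \<cdot> oct_cnj x))
      = (2 * (y \<bullet> v)) *\<^sub>R (y \<cdot> oct_cnj x) - (y \<bullet> y) *\<^sub>R (v \<cdot> oct_cnj x)"
    by (simp add: oct_mult.diff_right oct_mult.scaleR_right mult_cnj_mult)
  show ?thesis
    unfolding hopf_tangent_def rho_OH_eq p a
    by (simp add: inner_add_right inner_diff_right 1 2 oct_cnj_add oct_cnj_diff oct_cnj_scaleR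
        oct_mult.add_left oct_mult.diff_left oct_mult.scaleR_left oct_mult.add_right
        oct_mult.diff_right oct_mult.scaleR_right oct_cnj_mult 3 4 inner_prod_def algebra_simps)
      (simp add: vec_eq_iff algebra_simps)
qed

text \<open>Multiply the third tangency equation by \<open>x\<close>, or its conjugate by
  \<open>y\<close>: one term re-brackets to a norm, and the polar term of the other carries the
  vanishing factor \<open>x \<bullet> A\<close> or \<open>y \<bullet> B\<close>.\<close>

lemma hopf_tangent_imp_mult:
  assumes "hopf_tangent (x, y) (A, B)"
  shows "(x \<bullet> x) *\<^sub>R B = (y \<cdot> oct_cnj x) \<cdot> A" and "(y \<bullet> y) *\<^sub>R A = (x \<cdot> oct_cnj y) \<cdot> B"
proof -
  have h: "x \<bullet> A = 0" "y \<bullet> B = 0" "B \<cdot> oct_cnj x = - (y \<cdot> oct_cnj A)"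
    using assms unfolding hopf_tangent_def by (auto simp: add_eq_0_iff2)
  have "(x \<bullet> x) *\<^sub>R B = (B \<cdot> oct_cnj x) \<cdot> x" by (simp add: mult_cnj_mult_right)
  also have "\<dots> = - ((y \<cdot> oct_cnj A) \<cdot> x)" by (simp add: h oct_mult.minus_left)
  also have "\<dots> = (y \<cdot> oct_cnj x) \<cdot> A"
    using mult_mult_cnj_polar[of y x A] h(1) by (simp add: add_eq_0_iff2)
  finally show "(x \<bullet> x) *\<^sub>R B = (y \<cdot> oct_cnj x) \<cdot> A" .
  have h': "A \<cdot> oct_cnj y = - (x \<cdot> oct_cnj B)"
    using arg_cong[OF h(3), of oct_cnj] by (simp add: oct_cnj_mult linear_neg[OF linear_oct_cnj])
  have "(y \<bullet> y) *\<^sub>R A = (A \<cdot> oct_cnj y) \<cdot> y" by (simp add: mult_cnj_mult_right)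
  also have "\<dots> = - ((x \<cdot> oct_cnj B) \<cdot> y)" by (simp add: h' oct_mult.minus_left)
  also have "\<dots> = (x \<cdot> oct_cnj y) \<cdot> B"
    using mult_mult_cnj_polar[of x y B] h(2) by (simp add: add_eq_0_iff2)
  finally show "(y \<bullet> y) *\<^sub>R A = (x \<cdot> oct_cnj y) \<cdot> B" .
qed

lemma rho_OH_hopf_tangent:
  assumes "hopf_tangent p w"
  shows "rho_OH p w = (p \<bullet> p) *\<^sub>R w"
proof -
  obtain x y where p: "p = (x, y)" by (cases p)
  obtain A B where w: "w = (A, B)" by (cases w)
  have "x \<bullet> A = 0" "y \<bullet> B = 0"
    using assms by (auto simp: hopf_tangent_def p w)
  then show ?thesis
    using hopf_tangent_imp_mult[of x y A B] assms
    by (simp add: rho_OH_eq p w inner_prod_def algebra_simps)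
qed

lemma hopf_tangent_line:
  assumes "x \<bullet> w = 0"
  shows "hopf_tangent (x, m \<cdot> x) (w, m \<cdot> w)"
proof -
  have "(m \<cdot> w) \<cdot> oct_cnj x + (m \<cdot> x) \<cdot> oct_cnj w = 0"
    using mult_mult_cnj_polar[of m "oct_cnj w" "oct_cnj x"] assms by (simp add: inner_commute)
  then show ?thesis
    using assms by (simp add: hopf_tangent_def inner_mult_mult_left)
qed

lemma hopf_tangent_imp_line:
  assumes "hopf_tangent (x, m \<cdot> x) w" "x \<noteq> 0"
  shows "snd w = m \<cdot> fst w"
proof -
  have "(x \<bullet> x) *\<^sub>R snd w = ((m \<cdot> x) \<cdot> oct_cnj x) \<cdot> fst w"
    using hopf_tangent_imp_mult(1)[of x "m \<cdot> x" "fst w" "snd w"] assms by simp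
  then have "(x \<bullet> x) *\<^sub>R snd w = (x \<bullet> x) *\<^sub>R (m \<cdot> fst w)"
    by (simp add: mult_mult_cnj oct_mult.scaleR_left)
  then show ?thesis using assms(2) by simp
qed

section \<open>Tangent spaces of the leaves\<close>

text \<open>Differentiation only replaces \<open>a\<close> and \<open>b\<close> by multiples of
  \<open>b\<close> and \<open>a\<close>, so the induction runs over all coefficient vectors.\<close>

lemma smooth_on_cos_sin:
  fixes a b :: "'a::real_normed_vector"
  shows "smooth_on S (\<lambda>t::real. cos (k * t) *\<^sub>R a + sin (k * t) *\<^sub>R b)"
proof -
  have "Ck_on n S (\<lambda>t::real. cos (k * t) *\<^sub>R a + sin (k * t) *\<^sub>R b)" for n
  proof (induction n arbitrary: a b)
    case 0
    then show ?case by (simp, intro continuous_intros)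
  next
    case (Suc n)
    have D: "((\<lambda>t::real. cos (k * t) *\<^sub>R a + sin (k * t) *\<^sub>R b) has_derivative
        (\<lambda>v. cos (k * t) *\<^sub>R ((v * k) *\<^sub>R b) + sin (k * t) *\<^sub>R (- (v * k) *\<^sub>R a))) (at t)" for t
      by (auto intro!: derivative_eq_intros simp: algebra_simps)
    have "frechet_derivative (\<lambda>t::real. cos (k * t) *\<^sub>R a + sin (k * t) *\<^sub>R b) (at t) v
        = cos (k * t) *\<^sub>R ((v * k) *\<^sub>R b) + sin (k * t) *\<^sub>R (- (v * k) *\<^sub>R a)" for t v
      unfolding frechet_derivative_at[OF D[of t], symmetric] by (rule refl)
    moreover have "(\<lambda>t::real. cos (k * t) *\<^sub>R a + sin (k * t) *\<^sub>R b) differentiable at t" for t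
      using D differentiable_def by blast
    ultimately show ?case
      unfolding Ck_on.simps using Suc.IH by presburger
  qed
  then show ?thesis unfolding smooth_on_def by blast
qed

text \<open>Great circles provide every direction of a sphere in a linear subspace.\<close>

lemma tangent_space_sphere:
  fixes p w :: "'a::real_inner"
  assumes V: "subspace V" "p \<in> V" "w \<in> V" "p \<bullet> w = 0" "p \<noteq> 0"
  shows "w \<in> tangent_space (V \<inter> {q. norm q = norm p}) p"
proof -
  \<comment> \<open>\<open>k\<close> is the angular speed and \<open>b\<close> has the length of
    \<open>p\<close>, so the great circle has velocity \<open>k *\<^sub>R b = w\<close>. For
    \<open>w = 0\<close> both \<open>k\<close> and \<open>b\<close> are 0 and the curve is
    constant.\<close>
  define k where "k = norm w / norm p"
  define b where "b = (1 / k) *\<^sub>R w"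
  let ?c = "\<lambda>t::real. cos (k * t) *\<^sub>R p + sin (k * t) *\<^sub>R b"
  have kb: "k *\<^sub>R b = w"
    using \<open>p \<noteq> 0\<close> by (simp add: k_def b_def)
  have nb: "w = 0 \<or> b \<bullet> b = p \<bullet> p"
    by (auto simp: b_def k_def dot_square_norm power2_eq_square field_simps)
  have pb: "p \<bullet> b = 0" using V(4) by (simp add: b_def)
  have b0: "w = 0 \<Longrightarrow> k = 0" by (simp add: k_def)
  have "?c t \<in> V" for t
    using V(1-3) by (auto simp: b_def intro!: subspace_add subspace_scale)
  moreover have "norm (?c t) = norm p" for t
  proof (cases "w = 0")
    case True then show ?thesis using b0 by simp
  next
    case False
    have "?c t \<bullet> ?c t = (cos (k * t))\<^sup>2 * (p \<bullet> p) + (sin (k * t))\<^sup>2 * (b \<bullet> b)"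
      using pb by (simp add: inner_add_left inner_add_right inner_commute power2_eq_square)
    also have "\<dots> = p \<bullet> p"
      using nb False by (simp add: distrib_right[symmetric])
    finally show ?thesis by (simp add: norm_eq_sqrt_inner)
  qed
  moreover have "(?c has_vector_derivative w) (at 0)"
    unfolding has_vector_derivative_def
    by (auto intro!: derivative_eq_intros simp: kb[symmetric])
  ultimately show ?thesis
    unfolding tangent_space_def
    by (auto intro!: exI[of _ "1::real"] exI[of _ ?c] smooth_on_cos_sin)
qed

text \<open>Along a curve in the leaf both \<open>L\<close> and the squared norm are constant, so
  their derivatives at time 0 vanish. \<open>L\<close> stands for any linear equation that holds on
  \<open>V\<close>.\<close>

lemma tangent_space_sphere_D:
  fixes p w :: "'a::real_inner"
  assumes w: "w \<in> tangent_space (V \<inter> {q. norm q = r}) p"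
    and L: "bounded_linear L" "\<And>q. q \<in> V \<Longrightarrow> L q = 0"
  shows "p \<bullet> w = 0" and "L w = 0"
proof -
  from w obtain \<epsilon> c where e: "\<epsilon> > 0" "\<forall>t\<in>{-\<epsilon><..<\<epsilon>}. c t \<in> V \<inter> {q. norm q = r}"
    "c 0 = p" "(c has_vector_derivative w) (at 0)"
    unfolding tangent_space_def mem_Collect_eq by blast
  have ev: "eventually (\<lambda>t. t \<in> {-\<epsilon><..<\<epsilon>}) (at 0)"
    using e(1) by (intro eventually_at_topological[THEN iffD2] exI[of _ "{-\<epsilon><..<\<epsilon>}"]) auto
  have c': "(c has_derivative (\<lambda>s. s *\<^sub>R w)) (at 0)"
    using e(4) by (simp add: has_vector_derivative_def)
  have "((\<lambda>t. L (c t)) has_derivative (\<lambda>s. L (s *\<^sub>R w))) (at 0)"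
    by (rule bounded_linear.has_derivative[OF L(1) c'])
  moreover have "((\<lambda>t. L (c t)) has_derivative (\<lambda>s. 0)) (at 0)"
    by (rule has_derivative_transform_eventually[OF has_derivative_const[of 0]])
      (use ev e L(2) in \<open>auto elim!: eventually_mono\<close>)
  ultimately have "(\<lambda>s. L (s *\<^sub>R w)) = (\<lambda>s. 0)"
    by (rule has_derivative_unique)
  from fun_cong[OF this, of 1] show "L w = 0" by simp
  have "((\<lambda>t. c t \<bullet> c t) has_derivative (\<lambda>s. c 0 \<bullet> (s *\<^sub>R w) + (s *\<^sub>R w) \<bullet> c 0)) (at 0)"
    by (rule has_derivative_inner[OF c' c'])
  moreover have "((\<lambda>t. c t \<bullet> c t) has_derivative (\<lambda>s. 0)) (at 0)"
    by (rule has_derivative_transform_eventually[OF has_derivative_const[of "r\<^sup>2"]])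
      (use ev e in \<open>auto elim!: eventually_mono simp: dot_square_norm\<close>)
  ultimately have "(\<lambda>s. c 0 \<bullet> (s *\<^sub>R w) + (s *\<^sub>R w) \<bullet> c 0) = (\<lambda>s. 0)"
    by (rule has_derivative_unique)
  from fun_cong[OF this, of 1] show "p \<bullet> w = 0" by (simp add: e(3) inner_commute)
qed

lemma oct_sphere_eq: "r > 0 \<Longrightarrow> oct_sphere r = {q. norm q = r}"
proof -
  assume "r > 0"
  have "norm q = r \<longleftrightarrow> (norm q)\<^sup>2 = r\<^sup>2" for q :: octonion2
    using \<open>r > 0\<close> by (simp add: power2_eq_iff_nonneg)
  then have "norm q = r \<longleftrightarrow> (norm (fst q))\<^sup>2 + (norm (snd q))\<^sup>2 = r\<^sup>2" for q :: octonion2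
    by (simp add: norm_prod_def)
  then show ?thesis by (auto simp: oct_sphere_def)
qed

lemma subspace_oct_line: "subspace (oct_line m)"
  unfolding oct_line_def subspace_def
  by (auto simp: oct_mult.add_right oct_mult.scaleR_right oct_mult.zero_right zero_prod_def
      intro!: exI[of _ 0])

lemma subspace_oct_line_inf: "subspace oct_line_inf"
  unfolding oct_line_inf_def subspace_def by (auto simp: zero_prod_def)

lemma zero_in_tangent_space: "p \<in> L \<Longrightarrow> 0 \<in> tangent_space L p"
  unfolding tangent_space_def
  by (auto intro!: exI[of _ "1::real"] exI[of _ "\<lambda>t. p"] simp: smooth_on_cos_sin[where k=0 and a=p and b=0, simplified])

text \<open>The value at the origin is a separate hypothesis: \<open>hopf_tangent 0\<close> admits
  every vector, whereas the leaf there is a point.\<close>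

lemma hopf_tangent_imp_tangent_to_leaves:
  assumes X: "\<And>p. hopf_tangent p (X p)" and X0: "X 0 = 0"
  shows "tangent_to_leaves L_OH X"
  unfolding tangent_to_leaves_def
proof (intro ballI)
  fix L p assume "L \<in> L_OH" "p \<in> L"
  then consider m r where "L = oct_line m \<inter> oct_sphere r" "r > 0"
    | r where "L = oct_line_inf \<inter> oct_sphere r" "r > 0" | "L = {(0, 0)}"
    unfolding L_OH_def by blast
  then show "X p \<in> tangent_space L p"
  proof cases
    case (1 m r)
    then have r: "norm p = r" "L = oct_line m \<inter> {q. norm q = norm p}" "p \<noteq> 0"
      using \<open>p \<in> L\<close> by (auto simp: oct_sphere_eq)
    obtain x where x: "p = (x, m \<cdot> x)"
      using 1 \<open>p \<in> L\<close> by (auto simp: oct_line_def)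
    have "x \<noteq> 0" using r(3) x by (auto simp: oct_mult.zero_right zero_prod_def)
    have "X p = (fst (X p), m \<cdot> fst (X p))"
      using hopf_tangent_imp_line[of x m "X p"] X[of p] \<open>x \<noteq> 0\<close> x by (metis prod.collapse)
    then have "X p \<in> oct_line m" unfolding oct_line_def by blast
    moreover have "p \<bullet> X p = 0"
      using X[of p] by (simp add: hopf_tangent_def inner_prod_def)
    ultimately show ?thesis
      unfolding r(2) using r \<open>p \<in> L\<close> by (intro tangent_space_sphere subspace_oct_line) auto
  next
    case (2 r)
    then have r: "norm p = r" "L = oct_line_inf \<inter> {q. norm q = norm p}" "p \<noteq> 0"
      using \<open>p \<in> L\<close> by (auto simp: oct_sphere_eq)
    obtain y where y: "p = (0, y)"
      using 2 \<open>p \<in> L\<close> by (auto simp: oct_line_inf_def)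
    have "y \<noteq> 0" using r(3) y by (auto simp: zero_prod_def)
    have "(y \<bullet> y) *\<^sub>R fst (X p) = 0"
      using hopf_tangent_imp_mult(2)[of 0 y "fst (X p)" "snd (X p)"] X[of p] y
      by (simp add: oct_mult.zero_left)
    then have "X p = (0, snd (X p))"
      using \<open>y \<noteq> 0\<close> by (simp add: prod_eq_iff)
    then have "X p \<in> oct_line_inf" unfolding oct_line_inf_def by blast
    moreover have "p \<bullet> X p = 0"
      using X[of p] by (simp add: hopf_tangent_def inner_prod_def)
    ultimately show ?thesis
      unfolding r(2) using r \<open>p \<in> L\<close> by (intro tangent_space_sphere subspace_oct_line_inf) auto
  next
    case 3
    then have "p = 0" using \<open>p \<in> L\<close> by (simp add: zero_prod_def)
    then have "X p = 0" using X0 by simp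
    then show ?thesis using zero_in_tangent_space[OF \<open>p \<in> L\<close>] by simp
  qed
qed

lemma tangent_to_leaves_imp_hopf_tangent:
  assumes X: "tangent_to_leaves L_OH X"
  shows "hopf_tangent p (X p)"
proof -
  obtain x y where p: "p = (x, y)" by (cases p)
  consider "x \<noteq> 0" | "x = 0" "y \<noteq> 0" | "x = 0" "y = 0" by blast
  then show ?thesis
  proof cases
    case 1
    \<comment> \<open>The slope y \<cdot> x^(-1), with the inverse of \<open>x\<close> written as
      its conjugate over its squared norm.\<close>
    define m where "m = (1 / (x \<bullet> x)) *\<^sub>R (y \<cdot> oct_cnj x)"
    have y: "y = m \<cdot> x"
      using 1 by (simp add: m_def oct_mult.scaleR_left mult_cnj_mult_right)
    have "norm p > 0" using 1 p by (simp add: prod_eq_iff)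
    then have "oct_line m \<inter> oct_sphere (norm p) \<in> L_OH"
      unfolding L_OH_def by blast
    moreover have "p \<in> oct_line m \<inter> oct_sphere (norm p)"
      unfolding oct_sphere_eq[OF \<open>norm p > 0\<close>] by (simp add: oct_line_def p y)
    ultimately have "X p \<in> tangent_space (oct_line m \<inter> oct_sphere (norm p)) p"
      using X unfolding tangent_to_leaves_def by blast
    then have *: "X p \<in> tangent_space (oct_line m \<inter> {q. norm q = norm p}) p"
      unfolding oct_sphere_eq[OF \<open>norm p > 0\<close>] .
    have L: "bounded_linear (\<lambda>q. snd q - m \<cdot> fst q)"
      by (intro bounded_linear_sub bounded_linear_snd
          bounded_linear_compose[OF oct_mult.bounded_linear_right bounded_linear_fst])
    have "p \<bullet> X p = 0"
      by (rule tangent_space_sphere_D(1)[OF * L]) (auto simp: oct_line_def)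
    moreover have sX: "snd (X p) = m \<cdot> fst (X p)"
      using tangent_space_sphere_D(2)[OF * L] by (auto simp: oct_line_def)
    \<comment> \<open>On a line of slope \<open>m\<close> the inner product with \<open>p\<close> is
      \<open>1 + m \<bullet> m\<close> times that of the first components, so the sphere condition
      alone makes both component inner products vanish.\<close>
    ultimately have "(1 + m \<bullet> m) * (x \<bullet> fst (X p)) = 0"
      by (simp add: inner_prod_def p y inner_mult_mult_left algebra_simps)
    moreover have "1 + m \<bullet> m \<noteq> 0" using inner_ge_zero[of m] by linarith
    ultimately show ?thesis
      using hopf_tangent_line[of x "fst (X p)" m] sX by (simp add: hopf_tangent_def p y)
  next
    case 2
    have "norm p > 0" using 2 p by (simp add: prod_eq_iff)
    then have "oct_line_inf \<inter> oct_sphere (norm p) \<in> L_OH"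
      unfolding L_OH_def by blast
    moreover have "p \<in> oct_line_inf \<inter> oct_sphere (norm p)"
      unfolding oct_sphere_eq[OF \<open>norm p > 0\<close>] by (simp add: oct_line_inf_def p 2)
    ultimately have "X p \<in> tangent_space (oct_line_inf \<inter> oct_sphere (norm p)) p"
      using X unfolding tangent_to_leaves_def by blast
    then have *: "X p \<in> tangent_space (oct_line_inf \<inter> {q. norm q = norm p}) p"
      unfolding oct_sphere_eq[OF \<open>norm p > 0\<close>] .
    have "p \<bullet> X p = 0"
      by (rule tangent_space_sphere_D(1)[OF * bounded_linear_fst]) (auto simp: oct_line_inf_def)
    moreover have "fst (X p) = 0"
      by (rule tangent_space_sphere_D(2)[OF * bounded_linear_fst]) (auto simp: oct_line_inf_def)
    ultimately show ?thesis
      by (simp add: hopf_tangent_def p 2 inner_prod_def oct_mult.zero_right)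
  next
    case 3
    then show ?thesis by (simp add: hopf_tangent_def p oct_mult.zero_right oct_mult.zero_left)
  qed
qed

section \<open>Homogeneous maps\<close>

lemma isCont_eq_at_0:
  fixes g h :: "real \<Rightarrow> 'a::t2_space"
  assumes "isCont g 0" "isCont h 0" "\<And>t. t \<noteq> 0 \<Longrightarrow> g t = h t"
  shows "g 0 = h 0"
proof -
  have "(g \<longlongrightarrow> g 0) (at 0)" "(h \<longlongrightarrow> h 0) (at 0)"
    using assms by (auto simp: isCont_def)
  moreover have "(g \<longlongrightarrow> h 0) (at 0)"
    using assms(3) by (intro Lim_transform_eventually[OF \<open>(h \<longlongrightarrow> h 0) (at 0)\<close>])
      (auto simp: eventually_at_filter)
  ultimately show ?thesis
    using tendsto_unique[of "at (0::real)"] by auto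
qed

text \<open>Smoothness at the origin makes such a map a homogeneous polynomial map (compare
  \<open>Hom_finitely_generated\<close>). The scalar \<open>t\<close> may be negative or
  zero.\<close>

definition Hom :: "nat \<Rightarrow> ('a::real_normed_vector \<Rightarrow> 'b::real_normed_vector) \<Rightarrow> bool" where
  "Hom n f \<longleftrightarrow> smooth f \<and> (\<forall>t p. f (t *\<^sub>R p) = t ^ n *\<^sub>R f p)"

lemma Hom_smooth: "Hom n f \<Longrightarrow> smooth f"
  by (simp add: Hom_def)

lemma Hom_scaled: "Hom n f \<Longrightarrow> f (t *\<^sub>R p) = t ^ n *\<^sub>R f p"
  by (simp add: Hom_def)

lemma Hom_0 [simp]: "Hom n (\<lambda>p. 0)"
  by (simp add: Hom_def)

lemma Hom_add: "Hom n f \<Longrightarrow> Hom n g \<Longrightarrow> Hom n (\<lambda>p. f p + g p)"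
  by (simp add: Hom_def smooth_add scaleR_add_right)

lemma Hom_scaleR: "Hom n f \<Longrightarrow> Hom n (\<lambda>p. c *\<^sub>R f p)"
  by (simp add: Hom_def smooth_scaleR_const)

lemma Hom_diff: "Hom n f \<Longrightarrow> Hom n g \<Longrightarrow> Hom n (\<lambda>p. f p - g p)"
  by (simp add: Hom_def smooth_diff scaleR_diff_right)

lemma Hom_sum: "(\<And>i. i \<in> I \<Longrightarrow> Hom n (f i)) \<Longrightarrow> Hom n (\<lambda>p. \<Sum>i\<in>I. f i p)"
  by (induction I rule: infinite_finite_induct) (auto intro: Hom_add)

lemma Hom_zero_const: "Hom 0 f \<Longrightarrow> f p = f 0"
  using Hom_scaled[of 0 f 0 p] by simp

text \<open>Differentiate the homogeneity relation and cancel one factor \<open>t\<close>; the value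
  at \<open>t = 0\<close> follows by continuity.\<close>

lemma Hom_dd:
  assumes "Hom (Suc n) f"
  shows "Hom n (dd v f)"
proof -
  have f: "smooth f" using assms by (rule Hom_smooth)
  have bl: "bounded_linear (\<lambda>p. t *\<^sub>R p)" for t :: real
    by (rule bounded_linear_scaleR_right)
  have eq: "dd v f (t *\<^sub>R p) = t ^ n *\<^sub>R dd v f p" if "t \<noteq> 0" for t :: real and p
  proof -
    have "dd v (\<lambda>p. f (t *\<^sub>R p)) p = t *\<^sub>R dd v f (t *\<^sub>R p)"
      unfolding dd_comp_linear[OF f bl] using linear_scale[OF linear_dd[OF f]] by metis
    moreover have "(\<lambda>p. f (t *\<^sub>R p)) = (\<lambda>p. t ^ Suc n *\<^sub>R f p)"
      using Hom_scaled[OF assms] by blast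
    then have "dd v (\<lambda>p. f (t *\<^sub>R p)) p = t ^ Suc n *\<^sub>R dd v f p"
      by (simp add: dd_scaleR_const[OF f])
    ultimately have "t *\<^sub>R dd v f (t *\<^sub>R p) = t *\<^sub>R (t ^ n *\<^sub>R dd v f p)" by simp
    then show ?thesis using that scaleR_left_imp_eq by blast
  qed
  have "dd v f (0 *\<^sub>R p) = 0 ^ n *\<^sub>R dd v f p" for p
  proof (rule isCont_eq_at_0[where g="\<lambda>t. dd v f (t *\<^sub>R p)" and h="\<lambda>t. t ^ n *\<^sub>R dd v f p"])
    show "isCont (\<lambda>t. dd v f (t *\<^sub>R p)) 0"
      by (rule isCont_o2[where g="dd v f"]) (auto intro!: continuous_intros smooth_isCont smooth_dd f)
  qed (auto intro!: continuous_intros eq)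
  then show ?thesis
    unfolding Hom_def using eq smooth_dd[OF f] by metis
qed

lemma Hom_zero_dd: "Hom 0 f \<Longrightarrow> dd v f = (\<lambda>p. 0)"
proof -
  assume "Hom 0 f"
  then have "f = (\<lambda>p. f 0)" using Hom_zero_const by blast
  then show ?thesis by (metis dd_const)
qed

lemma Euler_homogeneous:
  assumes "Hom n f"
  shows "dd p f p = real n *\<^sub>R f p"
proof -
  have "((\<lambda>t. f (0 + t *\<^sub>R p)) has_derivative (\<lambda>s. s *\<^sub>R dd p f (0 + 1 *\<^sub>R p))) (at 1)"
    by (rule dd_line[OF Hom_smooth[OF assms]])
  moreover have "((\<lambda>t. t ^ n *\<^sub>R f p) has_derivative (\<lambda>s. (real n * s) *\<^sub>R f p)) (at 1)"
    by (auto intro!: derivative_eq_intros)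
  moreover have "(\<lambda>t. f (0 + t *\<^sub>R p)) = (\<lambda>t. t ^ n *\<^sub>R f p)"
    using Hom_scaled[OF assms] by simp
  ultimately have "(\<lambda>s. s *\<^sub>R dd p f (0 + 1 *\<^sub>R p)) = (\<lambda>s. (real n * s) *\<^sub>R f p)"
    using has_derivative_unique by metis
  from fun_cong[OF this, of 1] show ?thesis by simp
qed

lemma Euler_homogeneous_Basis:
  fixes f :: "'a::euclidean_space \<Rightarrow> 'b::real_normed_vector"
  assumes "Hom n f"
  shows "(\<Sum>i\<in>Basis. (p \<bullet> i) *\<^sub>R dd i f p) = real n *\<^sub>R f p"
  using Euler_homogeneous[OF assms, of p] dd_eq_sum_Basis[OF Hom_smooth[OF assms], of p p] by simp

text \<open>The bound at \<open>t *\<^sub>R p\<close>, divided by \<open>t ^ n\<close>, makes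
  \<open>norm (f p)\<close> at most a fixed multiple of \<open>t\<close>, for arbitrarily small
  \<open>t\<close>.\<close>

lemma Hom_eq_0:
  assumes "Hom n f" and C: "\<And>p. norm p \<le> 1 \<Longrightarrow> norm (f p) \<le> C * norm p ^ Suc n"
  shows "f p = 0"
proof (rule ccontr)
  assume "f p \<noteq> 0"
  then have np: "norm (f p) > 0" by simp
  have le: "norm (f p) \<le> t * (C * norm p ^ Suc n)" if t: "0 < t" "t * norm p \<le> 1" for t
  proof -
    have "t ^ n * norm (f p) = norm (f (t *\<^sub>R p))"
      using t by (simp add: Hom_scaled[OF assms(1)])
    also have "\<dots> \<le> C * norm (t *\<^sub>R p) ^ Suc n"
      using t by (intro C) simp
    also have "\<dots> = t ^ n * (t * (C * norm p ^ Suc n))"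
      using t by (simp add: power_mult_distrib)
    finally show ?thesis using t by simp
  qed
  \<comment> \<open>One constant dominates both the bound and \<open>norm p\<close>, so that
    \<open>t\<close> keeps \<open>t *\<^sub>R p\<close> in the unit ball and makes the bound at most
    half of \<open>norm (f p)\<close>.\<close>
  define K where "K = \<bar>C\<bar> * norm p ^ Suc n + norm p + norm (f p)"
  have K: "K > 0" unfolding K_def using np by (auto intro!: add_nonneg_pos)
  define t where "t = min (1 / K) (norm (f p) / (2 * K))"
  have t: "0 < t" "t \<le> 1 / K" "t \<le> norm (f p) / (2 * K)"
    using K np by (auto simp: t_def)
  have "t * norm p \<le> (1 / K) * K"
    using t K by (intro mult_mono) (auto simp: K_def)
  then have "norm (f p) \<le> t * (C * norm p ^ Suc n)"
    using K t by (intro le) auto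
  also have "\<dots> \<le> t * K"
    using t by (intro mult_left_mono) (auto simp: K_def intro!: mult_right_mono add_increasing2)
  also have "\<dots> \<le> norm (f p) / (2 * K) * K"
    using t K by (intro mult_right_mono) auto
  also have "\<dots> = norm (f p) / 2" using K by simp
  finally show False using np by simp
qed

section \<open>The Fischer inner product\<close>

text \<open>On homogeneous maps of degree \<open>k\<close> this is \<open>k!\<close> times the
  Fischer product, which applies one polynomial as a differential operator to the other,
  componentwise in the values. Definiteness there rests on Euler's identity
  (\<open>IP_eq_0\<close>).\<close>

fun IP :: "nat \<Rightarrow> ('a::euclidean_space \<Rightarrow> 'b::euclidean_space) \<Rightarrow> ('a \<Rightarrow> 'b) \<Rightarrow> real" where
  "IP 0 f g = f 0 \<bullet> g 0"
| "IP (Suc k) f g = (\<Sum>i\<in>Basis. IP k (dd i f) (dd i g))"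

lemma IP_commute: "IP k f g = IP k g f"
  by (induction k arbitrary: f g) (auto simp: inner_commute)

lemma IP_zero_left [simp]: "IP k (\<lambda>p. 0) g = 0"
  by (induction k arbitrary: g) auto

lemma IP_add_left:
  "smooth f \<Longrightarrow> smooth f' \<Longrightarrow> IP k (\<lambda>p. f p + f' p) g = IP k f g + IP k f' g"
  by (induction k arbitrary: f f' g) (auto simp: inner_add_left dd_add smooth_dd sum.distrib)

lemma IP_scaleR_left: "smooth f \<Longrightarrow> IP k (\<lambda>p. c *\<^sub>R f p) g = c * IP k f g"
  by (induction k arbitrary: f g) (auto simp: dd_scaleR_const smooth_dd sum_distrib_left)

lemma IP_diff_left:
  "smooth f \<Longrightarrow> smooth f' \<Longrightarrow> IP k (\<lambda>p. f p - f' p) g = IP k f g - IP k f' g"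
  by (induction k arbitrary: f f' g) (auto simp: inner_diff_left dd_diff smooth_dd sum_subtractf)

lemma IP_sum_left:
  "(\<And>i. i \<in> I \<Longrightarrow> smooth (f i)) \<Longrightarrow> IP k (\<lambda>p. \<Sum>i\<in>I. f i p) g = (\<Sum>i\<in>I. IP k (f i) g)"
  by (induction I rule: infinite_finite_induct) (auto simp: IP_add_left smooth_sum)

lemma IP_add_right:
  "smooth f \<Longrightarrow> smooth f' \<Longrightarrow> IP k g (\<lambda>p. f p + f' p) = IP k g f + IP k g f'"
  using IP_add_left[of f f' k g] by (simp add: IP_commute)

lemma IP_nonneg: "IP k f f \<ge> 0"
  by (induction k arbitrary: f) (auto intro: sum_nonneg)

lemma IP_eq_0:
  "Hom n f \<Longrightarrow> IP n f f = 0 \<Longrightarrow> f = (\<lambda>p. 0)"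
proof (induction n arbitrary: f)
  case 0
  then have "f 0 = 0" by simp
  then show ?case using Hom_zero_const[OF 0(1)] by (intro ext) (metis)
next
  case (Suc n)
  have IP0: "IP n (dd i f) (dd i f) = 0" if "i \<in> Basis" for i
    using Suc.prems(2) that by (simp add: sum_nonneg_eq_0_iff IP_nonneg)
  have "dd i f = (\<lambda>p. 0)" if "i \<in> Basis" for i
    by (rule Suc.IH[OF Hom_dd[OF Suc.prems(1)] IP0[OF that]])
  then have "real (Suc n) *\<^sub>R f p = 0" for p
    using Euler_homogeneous_Basis[OF Suc.prems(1), of p] by simp
  then show ?case by (auto simp del: of_nat_Suc)
qed

lemma IP_linear_comp:
  assumes "bounded_linear L" "bounded_linear L'" "\<And>x y. L x \<bullet> y = x \<bullet> L' y"
  shows "smooth f \<Longrightarrow> smooth g \<Longrightarrow> IP k (\<lambda>p. L (f p)) g = IP k f (\<lambda>p. L' (g p))"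
proof (induction k arbitrary: f g)
  case 0
  then show ?case by (simp add: assms(3))
next
  case (Suc k)
  then show ?case
    by (simp add: dd_linear_comp[OF assms(1)] dd_linear_comp[OF assms(2)] smooth_dd)
qed

lemma dd_linear_field:
  fixes f :: "'a::euclidean_space \<Rightarrow> 'b::euclidean_space"
  assumes M: "bounded_linear M" and f: "smooth f"
  shows "dd j (\<lambda>p. dd (M p) f p) = (\<lambda>p. dd (M j) f p + dd (M p) (dd j f) p)"
proof
  fix p
  have sm: "smooth (\<lambda>p. M p \<bullet> i)" for i
    by (intro smooth_inner_const smooth_bounded_linear M)
  have "dd j (\<lambda>p. dd (M p) f p) p = dd j (\<lambda>p. \<Sum>i\<in>Basis. (M p \<bullet> i) *\<^sub>R dd i f p) p"
    by (subst dd_eq_sum_Basis[OF f]) simp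
  also have "\<dots> = (\<Sum>i\<in>Basis. (M p \<bullet> i) *\<^sub>R dd j (dd i f) p + (M j \<bullet> i) *\<^sub>R dd i f p)"
    by (simp add: dd_sum smooth_scaleR sm smooth_dd f dd_scaleR
        dd_inner_const[OF smooth_bounded_linear[OF M]] dd_bounded_linear[OF M])
  also have "\<dots> = (\<Sum>i\<in>Basis. (M p \<bullet> i) *\<^sub>R dd i (dd j f) p) + (\<Sum>i\<in>Basis. (M j \<bullet> i) *\<^sub>R dd i f p)"
    by (subst dd_commute[OF f]) (simp add: sum.distrib)
  also have "\<dots> = dd (M j) f p + dd (M p) (dd j f) p"
    using dd_eq_sum_Basis[OF f, of "M j" p] dd_eq_sum_Basis[OF smooth_dd[OF f, of j], of "M p" p]
    by simp
  finally show "dd j (\<lambda>p. dd (M p) f p) p = dd (M j) f p + dd (M p) (dd j f) p" .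
qed

text \<open>Differentiating along the basis direction \<open>j\<close> produces, besides the term
  for the induction hypothesis, the commutator \<open>dd (M j) f\<close>. Its coefficients are the
  matrix entries of \<open>M\<close>, and exchanging the two sums transposes the matrix. In degree 0
  both sides vanish because linear fields vanish at the origin.\<close>

lemma IP_linear_field:
  fixes f g :: "'a::euclidean_space \<Rightarrow> 'b::euclidean_space"
  assumes M: "bounded_linear M" "bounded_linear M'" "\<And>x y. M x \<bullet> y = x \<bullet> M' y"
  shows "smooth f \<Longrightarrow> smooth g \<Longrightarrow>
    IP k (\<lambda>p. dd (M p) f p) g = IP k f (\<lambda>p. dd (M' p) g p)"
proof (induction k arbitrary: f g)
  case 0
  then show ?case
    using linear_0[OF linear_dd[OF 0(1), of 0]] linear_0[OF linear_dd[OF 0(2), of 0]]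
    by (simp add: linear_simps(3)[OF M(1)] linear_simps(3)[OF M(2)])
next
  case (Suc k)
  note sm = smooth_dd_var[OF _ smooth_bounded_linear[OF M(1)]] smooth_dd_var[OF _ smooth_bounded_linear[OF M(2)]]
  have dd_fun: "dd v h = (\<lambda>p. \<Sum>i\<in>Basis. (v \<bullet> i) *\<^sub>R dd i h p)" if "smooth h" for v and h :: "'a \<Rightarrow> 'b"
    by (rule ext, rule dd_eq_sum_Basis[OF that])
  have L: "IP k (dd v h) h' = (\<Sum>i\<in>Basis. (v \<bullet> i) * IP k (dd i h) h')" if "smooth h" for v and h h' :: "'a \<Rightarrow> 'b"
    by (subst dd_fun[OF that]) (simp add: IP_sum_left IP_scaleR_left smooth_scaleR_const smooth_dd that)
  have "(\<Sum>j\<in>Basis. IP k (dd (M j) f) (dd j g)) = (\<Sum>j\<in>Basis. \<Sum>i\<in>Basis. (M j \<bullet> i) * IP k (dd i f) (dd j g))"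
    by (intro sum.cong refl L Suc.prems)
  also have "\<dots> = (\<Sum>i\<in>Basis. \<Sum>j\<in>Basis. (M' i \<bullet> j) * IP k (dd j g) (dd i f))"
  proof -
    have "(M j \<bullet> i) * IP k (dd i f) (dd j g) = (M' i \<bullet> j) * IP k (dd j g) (dd i f)" for i j
      using M(3)[of j i] by (simp add: inner_commute[of j] IP_commute[of k "dd i f"])
    then show ?thesis
      by (subst sum.swap) (intro sum.cong refl)
  qed
  also have "\<dots> = (\<Sum>i\<in>Basis. IP k (dd (M' i) g) (dd i f))"
    by (intro sum.cong refl L[symmetric] Suc.prems)
  also have "\<dots> = (\<Sum>i\<in>Basis. IP k (dd i f) (dd (M' i) g))"
    by (intro sum.cong refl IP_commute)
  finally show ?case
    using Suc
    by (simp add: dd_linear_field[OF M(1)] dd_linear_field[OF M(2)] IP_add_left IP_add_right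
        smooth_dd sm sum.distrib)
qed

section \<open>Finite real spans of maps and orthogonal projection onto them\<close>

inductive fspan :: "('a \<Rightarrow> 'b::real_vector) set \<Rightarrow> ('a \<Rightarrow> 'b) \<Rightarrow> bool" for G where
  fspan_zero: "fspan G (\<lambda>p. 0)"
| fspan_step: "g \<in> G \<Longrightarrow> fspan G h \<Longrightarrow> fspan G (\<lambda>p. c *\<^sub>R g p + h p)"

lemma fspan_base: "g \<in> G \<Longrightarrow> fspan G g"
  using fspan_step[OF _ fspan_zero, of g G 1] by simp

lemma fspan_add: "fspan G f \<Longrightarrow> fspan G h \<Longrightarrow> fspan G (\<lambda>p. f p + h p)"
  by (induction rule: fspan.induct) (auto simp: add.assoc intro: fspan_step)

lemma fspan_scaleR: "fspan G f \<Longrightarrow> fspan G (\<lambda>p. c *\<^sub>R f p)"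
  by (induction rule: fspan.induct) (auto simp: scaleR_add_right intro: fspan_zero fspan_step)

lemma fspan_mono: "fspan G f \<Longrightarrow> G \<subseteq> G' \<Longrightarrow> fspan G' f"
  by (induction rule: fspan.induct) (auto intro: fspan_zero fspan_step)

lemma fspan_sum: "(\<And>i. i \<in> I \<Longrightarrow> fspan G (f i)) \<Longrightarrow> fspan G (\<lambda>p. \<Sum>i\<in>I. f i p)"
  by (induction I rule: infinite_finite_induct) (auto intro: fspan_zero fspan_add)

lemma fspan_Hom: "fspan G f \<Longrightarrow> (\<And>g. g \<in> G \<Longrightarrow> Hom n g) \<Longrightarrow> Hom n f"
  by (induction rule: fspan.induct) (auto intro!: Hom_add Hom_scaleR)

lemma IP_fspan:
  assumes "fspan G h" "smooth f" "\<And>g. g \<in> G \<Longrightarrow> Hom n g" "\<And>g. g \<in> G \<Longrightarrow> IP n f g = 0"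
  shows "IP n f h = 0"
  using assms(1)
proof (induction rule: fspan.induct)
  case fspan_zero
  then show ?case using IP_commute[of n f "\<lambda>p. 0"] by simp
next
  case (fspan_step g h c)
  have "smooth g" "smooth h"
    using fspan_step assms(3) fspan_Hom Hom_smooth by blast+
  moreover have "IP n f (\<lambda>p. c *\<^sub>R g p) = 0"
    using assms(4)[OF fspan_step(1)] IP_scaleR_left[OF \<open>smooth g\<close>] by (simp add: IP_commute[of n f])
  ultimately show ?case
    using fspan_step by (simp add: IP_add_right smooth_scaleR_const)
qed

text \<open>Gram-Schmidt, one generator at a time: \<open>e\<close> is the part of \<open>g\<close>
  orthogonal to the old generators, and \<open>c\<close> removes its component from the remainder.
  If \<open>IP n e e = 0\<close>, definiteness gives \<open>e = 0\<close>, so the value 0 of the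
  quotient \<open>c\<close> does no harm.\<close>

lemma IP_projection:
  assumes "finite G" "\<And>g. g \<in> G \<Longrightarrow> Hom n g" "Hom n f"
  shows "\<exists>h. fspan G h \<and> (\<forall>g\<in>G. IP n (\<lambda>p. f p - h p) g = 0)"
  using assms
proof (induction G arbitrary: f rule: finite_induct)
  case empty
  then show ?case using fspan_zero by blast
next
  case (insert g G)
  obtain hf where hf: "fspan G hf" "\<forall>g\<in>G. IP n (\<lambda>p. f p - hf p) g = 0"
    using insert.IH[of f] insert.prems by blast
  obtain hg where hg: "fspan G hg" "\<forall>g'\<in>G. IP n (\<lambda>p. g p - hg p) g' = 0"
    using insert.IH[of g] insert.prems by blast
  have Hhf: "Hom n hf" and Hhg: "Hom n hg"
    using fspan_Hom hf(1) hg(1) insert.prems(1) by blast+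
  define e where "e = (\<lambda>p. g p - hg p)"
  define f1 where "f1 = (\<lambda>p. f p - hf p)"
  define c where "c = IP n f1 e / IP n e e"
  have He: "Hom n e" and Hf1: "Hom n f1"
    unfolding e_def f1_def using insert.prems Hhf Hhg by (auto intro: Hom_diff)
  have g: "Hom n g" using insert.prems by blast
  have smo: "smooth e" "smooth f1" "smooth hg" "smooth g" "smooth hf" "smooth f"
    using He Hf1 Hhg Hhf insert.prems Hom_smooth by blast+
  let ?h = "\<lambda>p. hf p + c *\<^sub>R e p"
  have "fspan (insert g G) (\<lambda>p. hf p + (c *\<^sub>R g p + (- c) *\<^sub>R hg p))"
    by (intro fspan_add fspan_scaleR fspan_base fspan_mono[OF hf(1)] fspan_mono[OF hg(1)]) auto
  then have "fspan (insert g G) ?h"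
    by (simp add: e_def algebra_simps)
  moreover have eq: "(\<lambda>p. f p - ?h p) = (\<lambda>p. f1 p - c *\<^sub>R e p)"
    by (simp add: f1_def algebra_simps)
  have IPeq: "IP n (\<lambda>p. f p - ?h p) k = IP n f1 k - c * IP n e k" for k
    unfolding eq using smo by (simp add: IP_diff_left IP_scaleR_left smooth_scaleR_const)
  have G0: "IP n (\<lambda>p. f p - ?h p) k = 0" if "k \<in> G" for k
    unfolding IPeq using hf(2) hg(2) that by (simp add: f1_def e_def)
  moreover have "IP n (\<lambda>p. f p - ?h p) e = 0"
  proof (cases "IP n e e = 0")
    case True
    then have "e = (\<lambda>p. 0)" using IP_eq_0[OF He] by blast
    then show ?thesis using IP_commute[of n _ "\<lambda>p. 0"] by simp
  next
    case False
    then show ?thesis using IPeq[of e] by (simp add: c_def)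
  qed
  moreover have "IP n (\<lambda>p. f p - ?h p) hg = 0"
    using G0 insert.prems(1) smo
    by (intro IP_fspan[OF hg(1)] smooth_diff smooth_add smooth_scaleR_const) auto
  moreover have "g = (\<lambda>p. e p + hg p)"
    by (simp add: e_def)
  then have "IP n (\<lambda>p. f p - ?h p) g = IP n (\<lambda>p. f p - ?h p) e + IP n (\<lambda>p. f p - ?h p) hg"
    using IP_add_right[OF smo(1) smo(3)] by metis
  ultimately show ?case by (intro exI[of _ ?h]) auto
qed

text \<open>Euler's identity writes a map of degree \<open>n + 1\<close> through coordinates times
  derivatives of degree \<open>n\<close>, so coordinates times the old generators span. This
  supplies the finite set that the projection needs.\<close>

lemma Hom_finitely_generated:
  "\<exists>G. finite G \<and> (\<forall>g\<in>G. Hom n g) \<and> (\<forall>f::'a::euclidean_space \<Rightarrow> 'b::euclidean_space. Hom n f \<longrightarrow> fspan G f)"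
proof (induction n)
  case 0
  let ?G = "(\<lambda>i (p::'a). i) ` (Basis :: 'b set)"
  have "fspan ?G f" if "Hom 0 f" for f :: "'a \<Rightarrow> 'b"
  proof -
    have "f = (\<lambda>p. \<Sum>i\<in>Basis. (f 0 \<bullet> i) *\<^sub>R i)"
      by (rule ext, subst Hom_zero_const[OF that]) (simp add: euclidean_representation)
    moreover have "fspan ?G (\<lambda>p. \<Sum>i\<in>Basis. (f 0 \<bullet> i) *\<^sub>R (\<lambda>p. i) p)"
      by (intro fspan_sum fspan_scaleR fspan_base) auto
    ultimately show ?thesis by simp
  qed
  then show ?case
    by (intro exI[of _ ?G]) (auto simp: Hom_def)
next
  case (Suc n)
  then obtain G where G: "finite G" "\<forall>g\<in>G. Hom n g"
    "\<forall>f::'a \<Rightarrow> 'b. Hom n f \<longrightarrow> fspan G f" by blast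
  let ?F = "\<lambda>i g (p::'a). (p \<bullet> i) *\<^sub>R (g p :: 'b)"
  let ?G = "(\<lambda>(i, g). ?F i g) ` (Basis \<times> G)"
  have "Hom (Suc n) (?F i g)" if "Hom n g" for i g
    using that by (auto simp: Hom_def intro!: smooth_scaleR smooth_inner_const)
  moreover have step: "fspan ?G (?F i h)" if "i \<in> Basis" "fspan G h" for i h
    using that(2)
  proof (induction rule: fspan.induct)
    case fspan_zero
    then show ?case using fspan.fspan_zero by simp
  next
    case (fspan_step g h c)
    have "fspan ?G (\<lambda>p. c *\<^sub>R ?F i g p + ?F i h p)"
      using that(1) fspan_step by (intro fspan.fspan_step) auto
    then show ?case by (simp add: algebra_simps)
  qed
  have "fspan ?G f" if f: "Hom (Suc n) f" for f :: "'a \<Rightarrow> 'b"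
  proof -
    have "f = (\<lambda>p. (1 / real (Suc n)) *\<^sub>R (\<Sum>i\<in>Basis. ?F i (dd i f) p))"
      unfolding Euler_homogeneous_Basis[OF f] by (simp del: of_nat_Suc)
    moreover have "fspan ?G (\<lambda>p. (1 / real (Suc n)) *\<^sub>R (\<Sum>i\<in>Basis. ?F i (dd i f) p))"
      using G(3) Hom_dd[OF f] by (intro fspan_scaleR fspan_sum step) auto
    ultimately show ?thesis by simp
  qed
  ultimately show ?case
    using G by (intro exI[of _ ?G]) auto
qed

section \<open>Order of vanishing at the origin\<close>

primrec van :: "nat \<Rightarrow> ('a::euclidean_space \<Rightarrow> 'b::real_normed_vector) \<Rightarrow> bool" where
  "van 0 f \<longleftrightarrow> True"
| "van (Suc n) f \<longleftrightarrow> f 0 = 0 \<and> (\<forall>i\<in>Basis. van n (dd i f))"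

lemma van_Suc_D: "van (Suc n) f \<Longrightarrow> van n f"
  by (induction n arbitrary: f) auto

lemma van_mono: "van n f \<Longrightarrow> m \<le> n \<Longrightarrow> van m f"
proof (induction n)
  case (Suc n)
  then show ?case using van_Suc_D le_Suc_eq by metis
qed auto

lemma van_zero [simp]: "van n (\<lambda>p. 0)"
  by (induction n) auto

lemma van_add: "smooth f \<Longrightarrow> smooth g \<Longrightarrow> van n f \<Longrightarrow> van n g \<Longrightarrow> van n (\<lambda>p. f p + g p)"
  by (induction n arbitrary: f g) (auto simp: dd_add smooth_dd)

lemma van_diff: "smooth f \<Longrightarrow> smooth g \<Longrightarrow> van n f \<Longrightarrow> van n g \<Longrightarrow> van n (\<lambda>p. f p - g p)"
  by (induction n arbitrary: f g) (auto simp: dd_diff smooth_dd)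

lemma van_linear_comp:
  assumes "bounded_linear L"
  shows "smooth f \<Longrightarrow> van n f \<Longrightarrow> van n (\<lambda>p. L (f p))"
proof (induction n arbitrary: f)
  case (Suc n)
  then show ?case
    by (simp add: dd_linear_comp[OF assms] smooth_dd linear_simps(3)[OF assms])
qed simp

lemma van_sum:
  "(\<And>i. i \<in> I \<Longrightarrow> smooth (f i)) \<Longrightarrow> (\<And>i. i \<in> I \<Longrightarrow> van n (f i)) \<Longrightarrow> van n (\<lambda>p. \<Sum>i\<in>I. f i p)"
  by (induction I rule: infinite_finite_induct) (auto intro!: van_add smooth_sum)

lemma van_dd:
  assumes "smooth f" "van (Suc n) f"
  shows "van n (dd v f)"
proof -
  have "dd v f = (\<lambda>p. \<Sum>i\<in>Basis. (v \<bullet> i) *\<^sub>R dd i f p)"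
    by (rule ext, rule dd_eq_sum_Basis[OF assms(1)])
  moreover have "van n (\<lambda>p. \<Sum>i\<in>Basis. (v \<bullet> i) *\<^sub>R dd i f p)"
    using assms
    by (intro van_sum van_linear_comp[OF bounded_linear_scaleR_right] smooth_scaleR_const smooth_dd) auto
  ultimately show ?thesis by simp
qed

lemma van_bilinear:
  assumes B: "bounded_bilinear B"
  shows "smooth f \<Longrightarrow> smooth g \<Longrightarrow> van n g \<Longrightarrow> van n (\<lambda>p. B (f p) (g p))"
proof (induction n arbitrary: f g)
  case (Suc n)
  have "van n (dd i (\<lambda>p. B (f p) (g p)))" for i
    unfolding dd_bilinear[OF B Suc.prems(1,2)]
    by (intro van_add smooth_bilinear[OF B] Suc.IH smooth_dd Suc.prems van_dd van_Suc_D[OF Suc.prems(3)])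
  then show ?case
    using Suc.prems bounded_bilinear.zero_right[OF B] by simp
qed simp

lemma norm_dd_le_Basis:
  fixes f :: "'a::euclidean_space \<Rightarrow> 'b::real_normed_vector"
  assumes "smooth f"
  shows "norm (dd v f x) \<le> (\<Sum>i\<in>Basis. norm (dd i f x)) * norm v"
proof -
  have "norm (dd v f x) = norm (\<Sum>i\<in>Basis. (v \<bullet> i) *\<^sub>R dd i f x)"
    by (subst dd_eq_sum_Basis[OF assms]) simp
  also have "\<dots> \<le> (\<Sum>i\<in>Basis. norm v * norm (dd i f x))"
    by (rule sum_norm_le) (simp add: Basis_le_norm mult_right_mono)
  finally show ?thesis by (simp add: sum_distrib_left mult.commute)
qed

text \<open>The mean value inequality on the ball of radius \<open>norm p\<close>, where the
  induction hypothesis bounds the partial derivatives, gains one power of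
  \<open>norm p\<close>.\<close>

lemma van_bound:
  fixes f :: "'a::euclidean_space \<Rightarrow> 'b::real_normed_vector"
  assumes "smooth f" "van n f"
  shows "\<exists>C. \<forall>p. norm p \<le> 1 \<longrightarrow> norm (f p) \<le> C * norm p ^ n"
  using assms
proof (induction n arbitrary: f)
  case 0
  have "compact (f ` cball 0 1)"
    by (intro compact_continuous_image smooth_continuous_on 0) simp
  then obtain C where "\<forall>x\<in>f ` cball 0 1. norm x \<le> C"
    using compact_imp_bounded bounded_iff by metis
  then show ?case by (intro exI[of _ C]) (auto simp: dist_norm)
next
  case (Suc n)
  have "\<forall>i\<in>Basis. \<exists>C. \<forall>p. norm p \<le> 1 \<longrightarrow> norm (dd i f p) \<le> C * norm p ^ n"
    using Suc.prems by (auto intro!: Suc.IH smooth_dd)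
  then obtain C where C: "\<forall>i\<in>Basis. \<forall>p. norm p \<le> 1 \<longrightarrow> norm (dd i f p) \<le> C i * norm p ^ n"
    by (rule bchoice[THEN exE])
  define K where "K = (\<Sum>i\<in>Basis. \<bar>C i\<bar>)"
  have "norm (f p) \<le> K * norm p ^ Suc n" if p: "norm p \<le> 1" for p
  proof -
    have "norm (f p - f 0) \<le> (K * norm p ^ n) * norm (p - 0)"
    proof (rule differentiable_bound[of "cball 0 (norm p)"])
      fix x :: 'a assume x: "x \<in> cball 0 (norm p)"
      then have nx: "norm x \<le> norm p" by simp
      show "(f has_derivative (\<lambda>v. dd v f x)) (at x within cball 0 (norm p))"
        using has_derivative_dd[OF Suc.prems(1)] has_derivative_at_withinI by blast
      have "(\<Sum>i\<in>Basis. norm (dd i f x)) \<le> K * norm p ^ n"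
        unfolding K_def sum_distrib_right
      proof (rule sum_mono)
        fix i :: 'a assume i: "i \<in> Basis"
        have "norm (dd i f x) \<le> C i * norm x ^ n"
          using C i nx p by (meson order_trans)
        also have "\<dots> \<le> \<bar>C i\<bar> * norm p ^ n"
          using nx by (intro mult_mono power_mono) auto
        finally show "norm (dd i f x) \<le> \<bar>C i\<bar> * norm p ^ n" .
      qed
      then have "norm (dd v f x) \<le> (K * norm p ^ n) * norm v" for v
        using order_trans[OF norm_dd_le_Basis[OF Suc.prems(1), of v x] mult_right_mono] by simp
      then show "onorm (\<lambda>v. dd v f x) \<le> K * norm p ^ n"
        by (rule onorm_le)
    qed auto
    then show ?thesis using Suc.prems(2) by (simp add: mult_ac)
  qed
  then show ?case by blast
qed

section \<open>Homogeneous components\<close>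

text \<open>The degree-\<open>n\<close> part of the Taylor expansion at the origin. The recursion is
  Euler's identity read as a definition, so factorials and multi-indices do not appear.\<close>

primrec hc :: "nat \<Rightarrow> ('a::euclidean_space \<Rightarrow> 'b::euclidean_space) \<Rightarrow> 'a \<Rightarrow> 'b" where
  "hc 0 f = (\<lambda>p. f 0)"
| "hc (Suc n) f = (\<lambda>p. (1 / real (Suc n)) *\<^sub>R (\<Sum>i\<in>Basis. (p \<bullet> i) *\<^sub>R hc n (dd i f) p))"

lemma hc_Hom: "Hom n (hc n f)"
proof (induction n arbitrary: f)
  case (Suc n)
  have "Hom (Suc n) (\<lambda>p. (p \<bullet> i) *\<^sub>R hc n (dd i f) p)" for i
    using Suc[of "dd i f"] by (auto simp: Hom_def intro!: smooth_scaleR smooth_inner_const)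
  then show ?case
    unfolding hc.simps by (intro Hom_scaleR Hom_sum)
qed (simp add: Hom_def)

lemmas smooth_hc = Hom_smooth[OF hc_Hom]

lemma hc_sum_scaleR:
  "(\<And>i. i \<in> I \<Longrightarrow> smooth (g i)) \<Longrightarrow>
    hc n (\<lambda>p. \<Sum>i\<in>I. c i *\<^sub>R g i p) q = (\<Sum>i\<in>I. c i *\<^sub>R hc n (g i) q)"
proof (induction n arbitrary: g)
  case (Suc n)
  have "dd j (\<lambda>p. \<Sum>i\<in>I. c i *\<^sub>R g i p) = (\<lambda>p. \<Sum>i\<in>I. c i *\<^sub>R dd j (g i) p)" for j
    using Suc.prems by (simp add: dd_sum dd_scaleR_const smooth_scaleR_const)
  moreover have "hc n (\<lambda>p. \<Sum>i\<in>I. c i *\<^sub>R dd j (g i) p) q = (\<Sum>i\<in>I. c i *\<^sub>R hc n (dd j (g i)) q)" for j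
    by (rule Suc.IH) (simp add: Suc.prems smooth_dd)
  ultimately have "hc (Suc n) (\<lambda>p. \<Sum>i\<in>I. c i *\<^sub>R g i p) q
      = (1 / real (Suc n)) *\<^sub>R (\<Sum>j\<in>Basis. \<Sum>i\<in>I. (q \<bullet> j) *\<^sub>R c i *\<^sub>R hc n (dd j (g i)) q)"
    by (simp add: scaleR_sum_right)
  also have "\<dots> = (\<Sum>i\<in>I. c i *\<^sub>R hc (Suc n) (g i) q)"
    by (subst sum.swap) (simp add: scaleR_sum_right mult_ac)
  finally show ?case .
qed simp

text \<open>In the step, differentiating the coordinates gives one copy of the result and
  differentiating the factors behind them gives \<open>n + 1\<close> copies, by symmetry of second
  derivatives; the prefactor \<open>1 / (n + 2)\<close> cancels the total.\<close>

lemma dd_hc: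
  assumes "smooth f"
  shows "dd v (hc (Suc n) f) = hc n (dd v f)"
  using assms
proof (induction n arbitrary: f)
  case 0
  have "dd v (hc (Suc 0) f) p = (\<Sum>i\<in>Basis. (v \<bullet> i) *\<^sub>R dd i f 0)" for p
    by (simp add: dd_sum dd_scaleR smooth_scaleR smooth_inner_const dd_inner_const)
  then show ?case
    using dd_eq_sum_Basis[OF 0, of v 0] by (auto simp del: hc.simps(2))
next
  case (Suc n)
  note f = \<open>smooth f\<close>
  show ?case
  proof
    fix p
    have "dd v (hc (Suc (Suc n)) f) p = (1 / real (Suc (Suc n))) *\<^sub>R
        (\<Sum>i\<in>Basis. (p \<bullet> i) *\<^sub>R dd v (hc (Suc n) (dd i f)) p + (v \<bullet> i) *\<^sub>R hc (Suc n) (dd i f) p)"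
      unfolding hc.simps(2)[of "Suc n" f]
      by (simp del: hc.simps(2) of_nat_Suc
          add: dd_scaleR_const smooth_sum smooth_scaleR smooth_inner_const smooth_hc dd_sum dd_scaleR dd_inner_const)
    also have "(\<Sum>i\<in>Basis. (p \<bullet> i) *\<^sub>R dd v (hc (Suc n) (dd i f)) p + (v \<bullet> i) *\<^sub>R hc (Suc n) (dd i f) p)
       = (\<Sum>i\<in>Basis. (p \<bullet> i) *\<^sub>R hc n (dd i (dd v f)) p) + (\<Sum>i\<in>Basis. (v \<bullet> i) *\<^sub>R hc (Suc n) (dd i f) p)"
    proof -
      have "dd v (hc (Suc n) (dd i f)) = hc n (dd i (dd v f))" for i
        by (rule trans[OF Suc.IH[OF smooth_dd[OF f]]], rule arg_cong[OF dd_commute[OF f]])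
      then show ?thesis by (simp only: sum.distrib)
    qed
    also have "(\<Sum>i\<in>Basis. (p \<bullet> i) *\<^sub>R hc n (dd i (dd v f)) p) = real (Suc n) *\<^sub>R hc (Suc n) (dd v f) p"
      by (simp del: of_nat_Suc)
    also have "(\<Sum>i\<in>Basis. (v \<bullet> i) *\<^sub>R hc (Suc n) (dd i f) p) = hc (Suc n) (dd v f) p"
    proof -
      have "dd v f = (\<lambda>q. \<Sum>i\<in>Basis. (v \<bullet> i) *\<^sub>R dd i f q)"
        by (rule ext, rule dd_eq_sum_Basis[OF f])
      then show ?thesis
        using hc_sum_scaleR[of Basis "\<lambda>i. dd i f" "Suc n" "\<lambda>i. v \<bullet> i" p] smooth_dd[OF f] by metis
    qed
    also have "real (Suc n) *\<^sub>R hc (Suc n) (dd v f) p + hc (Suc n) (dd v f) p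
        = real (Suc (Suc n)) *\<^sub>R hc (Suc n) (dd v f) p"
      by (simp del: hc.simps add: algebra_simps scaleR_2)
    finally show "dd v (hc (Suc (Suc n)) f) p = hc (Suc n) (dd v f) p"
      by (simp del: hc.simps of_nat_Suc)
  qed
qed

lemma van_minus_hc:
  assumes "smooth f" "van n f"
  shows "van (Suc n) (\<lambda>p. f p - hc n f p)"
  using assms
proof (induction n arbitrary: f)
  case 0
  then show ?case by simp
next
  case (Suc n)
  have "hc (Suc n) f 0 = 0" by simp
  moreover have "van (Suc n) (dd i (\<lambda>p. f p - hc (Suc n) f p))" if "i \<in> Basis" for i
    unfolding dd_diff[OF Suc.prems(1) smooth_hc] dd_hc[OF Suc.prems(1)]
    using Suc that by (intro Suc.IH) (auto simp: smooth_dd)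
  ultimately show ?case
    using Suc.prems(2) by (subst van.simps) (simp del: hc.simps)
qed

section \<open>Flat maps\<close>

definition flat :: "('a::euclidean_space \<Rightarrow> 'b::real_normed_vector) \<Rightarrow> bool" where
  "flat f \<longleftrightarrow> smooth f \<and> (\<forall>n. van n f)"

lemma flat_dd: "flat f \<Longrightarrow> flat (dd v f)"
  unfolding flat_def using smooth_dd van_dd by blast

lemma flat_scaleR: "smooth (g :: _ \<Rightarrow> real) \<Longrightarrow> flat f \<Longrightarrow> flat (\<lambda>p. g p *\<^sub>R f p)"
  unfolding flat_def using smooth_scaleR van_bilinear[OF bounded_bilinear_scaleR] by blast

lemma flat_0: "flat f \<Longrightarrow> f 0 = 0"
  unfolding flat_def using van.simps(2)[of 0] by blast

text \<open>At the origin the quotient has the junk value \<open>0\<close>, which is its limit there.\<close>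

lemma has_derivative_flat_divide:
  assumes f: "flat f"
  shows "((\<lambda>p. (1 / (p \<bullet> p) ^ m) *\<^sub>R f p) has_derivative
    (\<lambda>v. (1 / (x \<bullet> x) ^ m) *\<^sub>R dd v f x + (1 / (x \<bullet> x) ^ Suc m) *\<^sub>R ((- (2 * real m) * (x \<bullet> v)) *\<^sub>R f x))) (at x)"
proof (cases "x = 0")
  case False
  have fd: "(f has_derivative (\<lambda>v. dd v f x)) (at x)"
    using f has_derivative_dd by (auto simp: flat_def)
  have "((\<lambda>p. 1 / (p \<bullet> p) ^ m) has_derivative
      (\<lambda>v. - (2 * real m * (x \<bullet> v)) / (x \<bullet> x) ^ Suc m)) (at x)"
  proof -
    have "((\<lambda>p. (p \<bullet> p) ^ m) has_derivative (\<lambda>v. real m * (2 * (x \<bullet> v)) * (x \<bullet> x) ^ (m - 1))) (at x)"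
      by (auto intro!: derivative_eq_intros simp: inner_commute)
    then have "((\<lambda>p. inverse ((p \<bullet> p) ^ m)) has_derivative
       (\<lambda>v. - (inverse ((x \<bullet> x) ^ m) * (real m * (2 * (x \<bullet> v)) * (x \<bullet> x) ^ (m - 1)) * inverse ((x \<bullet> x) ^ m)))) (at x)"
      using False by (intro Deriv.has_derivative_inverse) auto
    moreover have "- (inverse ((x \<bullet> x) ^ m) * (real m * (2 * (x \<bullet> v)) * (x \<bullet> x) ^ (m - 1)) * inverse ((x \<bullet> x) ^ m))
        = - (2 * real m * (x \<bullet> v)) / (x \<bullet> x) ^ Suc m" for v
      using False by (cases m) (auto simp: field_simps)
    ultimately show ?thesis by (simp only: inverse_eq_divide)
  qed
  from has_derivative_scaleR[OF this fd] show ?thesis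
    by (rule has_derivative_eq_rhs) (simp add: algebra_simps)
next
  case True
  \<comment> \<open>The exponent leaves two powers of \<open>norm p\<close> after division by
    \<open>(p \<bullet> p) ^ m\<close>: one for the difference quotient and one to make it tend to
    zero.\<close>
  obtain C where C: "\<And>p. norm p \<le> 1 \<Longrightarrow> norm (f p) \<le> C * norm p ^ (2 * m + 2)"
    using van_bound[of f "2 * m + 2"] f unfolding flat_def by blast
  let ?g = "\<lambda>p. (1 / (p \<bullet> p) ^ m) *\<^sub>R f p"
  have g: "norm (?g p) \<le> \<bar>C\<bar> * norm p * norm p" if "norm p \<le> 1" for p
  proof (cases "p = 0")
    case True
    then show ?thesis using flat_0[OF f] by simp
  next
    case False
    have "(p \<bullet> p) ^ m = norm p ^ (2 * m)"
      by (simp add: dot_square_norm power_mult)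
    then have "norm (?g p) = norm (f p) / norm p ^ (2 * m)"
      by simp
    also have "\<dots> \<le> (\<bar>C\<bar> * norm p ^ (2 * m + 2)) / norm p ^ (2 * m)"
      using C[OF that] False
      by (intro divide_right_mono order_trans[OF C[OF that]] mult_right_mono) auto
    also have "\<dots> = \<bar>C\<bar> * norm p * norm p"
      using False by (simp add: power_add power2_eq_square)
    finally show ?thesis .
  qed
  have "(?g has_derivative (\<lambda>v. 0)) (at 0)"
    unfolding has_derivative_at_alt
  proof (intro conjI allI impI)
    fix e :: real assume e: "e > 0"
    show "\<exists>d>0. \<forall>y. norm (y - 0) < d \<longrightarrow> norm (?g y - ?g 0 - 0) \<le> e * norm (y - 0)"
    proof (intro exI[of _ "min 1 (e / (\<bar>C\<bar> + 1))"] conjI allI impI)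
      fix y :: 'a assume y: "norm (y - 0) < min 1 (e / (\<bar>C\<bar> + 1))"
      then have "\<bar>C\<bar> * norm y \<le> (\<bar>C\<bar> + 1) * (e / (\<bar>C\<bar> + 1))"
        by (intro mult_mono) auto
      then have "\<bar>C\<bar> * norm y \<le> e" by simp
      moreover have "norm (?g y) \<le> \<bar>C\<bar> * norm y * norm y"
        using y by (intro g) simp
      ultimately have "norm (?g y) \<le> e * norm y"
        using mult_right_mono[of "\<bar>C\<bar> * norm y" e "norm y"] by simp
      then show "norm (?g y - ?g 0 - 0) \<le> e * norm (y - 0)"
        using flat_0[OF f] by simp
    qed (use e in simp)
  qed simp
  moreover have "dd v f 0 = 0" for v
    by (rule flat_0[OF flat_dd[OF f]])
  ultimately show ?thesis
    using True flat_0[OF f] by simp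
qed

text \<open>A derivative can raise the exponent of the denominator, so the class is closed under
  differentiation only with \<open>m\<close> varying; flatness absorbs every exponent.\<close>

lemma smooth_flat_divide:
  fixes f :: "'a::euclidean_space \<Rightarrow> 'b::real_normed_vector"
  assumes "flat f"
  shows "smooth (\<lambda>p. (1 / (p \<bullet> p) ^ m) *\<^sub>R f p)"
proof (rule smooth_coinduct_sum[where
      P="\<lambda>h. \<exists>m f. flat f \<and> h = (\<lambda>p. (1 / (p \<bullet> p) ^ m) *\<^sub>R f p)"])
  show "\<exists>m' f'. flat f' \<and> (\<lambda>p. (1 / (p \<bullet> p) ^ m) *\<^sub>R f p) = (\<lambda>p. (1 / (p \<bullet> p) ^ m') *\<^sub>R f' p)"
    using assms by blast
next
  fix h :: "'a \<Rightarrow> 'b" and x assume "\<exists>m f. flat f \<and> h = (\<lambda>p. (1 / (p \<bullet> p) ^ m) *\<^sub>R f p)"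
  then show "h differentiable at x"
    using has_derivative_flat_divide unfolding differentiable_def by blast
next
  fix h :: "'a \<Rightarrow> 'b" and v assume "\<exists>m f. flat f \<and> h = (\<lambda>p. (1 / (p \<bullet> p) ^ m) *\<^sub>R f p)"
  then obtain m f where f: "flat f" and h: "h = (\<lambda>p. (1 / (p \<bullet> p) ^ m) *\<^sub>R f p)" by blast
  let ?g = "\<lambda>p. (1 / (p \<bullet> p) ^ m) *\<^sub>R dd v f p"
  let ?k = "\<lambda>p. (1 / (p \<bullet> p) ^ Suc m) *\<^sub>R ((- (2 * real m) * (p \<bullet> v)) *\<^sub>R f p)"
  have "dd v h = (\<lambda>p. ?g p + ?k p)"
    unfolding h by (rule ext, rule dd_eq[OF has_derivative_flat_divide[OF f]])
  moreover have "flat (\<lambda>p. (- (2 * real m) * (p \<bullet> v)) *\<^sub>R f p)"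
    by (rule flat_scaleR[OF _ f]) (intro smooth_bilinear[OF bounded_bilinear_mult] smooth_const smooth_inner_const smooth_ident)
  ultimately show "\<exists>g k. (\<exists>m f. flat f \<and> g = (\<lambda>p. (1 / (p \<bullet> p) ^ m) *\<^sub>R f p)) \<and>
      (\<exists>m f. flat f \<and> k = (\<lambda>p. (1 / (p \<bullet> p) ^ m) *\<^sub>R f p)) \<and> dd v h = (\<lambda>p. g p + k p)"
    using flat_dd[OF f, of v] by (intro exI[of _ ?g] exI[of _ ?k]) blast
qed

section \<open>A trace identity\<close>

text \<open>Each coordinate is one coordinate of \<open>x\<close> up to sign. The table of them
  serves the 64 index cases of \<open>trace_axis\<close>.\<close>

definition axis_cnj :: "8 \<Rightarrow> octonion \<Rightarrow> octonion" where
  "axis_cnj c x = axis c 1 \<cdot> oct_cnj x"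

lemma axis_cnj_nth:
  shows "axis_cnj 0 x $ 0 = x $ 0"
    and "axis_cnj 0 x $ 1 = - x $ 1"
    and "axis_cnj 0 x $ 2 = - x $ 2"
    and "axis_cnj 0 x $ 3 = - x $ 3"
    and "axis_cnj 0 x $ 4 = - x $ 4"
    and "axis_cnj 0 x $ 5 = - x $ 5"
    and "axis_cnj 0 x $ 6 = - x $ 6"
    and "axis_cnj 0 x $ 7 = - x $ 7"
    and "axis_cnj 1 x $ 1 = x $ 0"
    and "axis_cnj 1 x $ 0 = x $ 1"
    and "axis_cnj 1 x $ 3 = - x $ 2"
    and "axis_cnj 1 x $ 2 = x $ 3"
    and "axis_cnj 1 x $ 5 = - x $ 4"
    and "axis_cnj 1 x $ 4 = x $ 5"
    and "axis_cnj 1 x $ 7 = x $ 6"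
    and "axis_cnj 1 x $ 6 = - x $ 7"
    and "axis_cnj 2 x $ 2 = x $ 0"
    and "axis_cnj 2 x $ 3 = x $ 1"
    and "axis_cnj 2 x $ 0 = x $ 2"
    and "axis_cnj 2 x $ 1 = - x $ 3"
    and "axis_cnj 2 x $ 6 = - x $ 4"
    and "axis_cnj 2 x $ 7 = - x $ 5"
    and "axis_cnj 2 x $ 4 = x $ 6"
    and "axis_cnj 2 x $ 5 = x $ 7"
    and "axis_cnj 3 x $ 3 = x $ 0"
    and "axis_cnj 3 x $ 2 = - x $ 1"
    and "axis_cnj 3 x $ 1 = x $ 2"
    and "axis_cnj 3 x $ 0 = x $ 3"
    and "axis_cnj 3 x $ 7 = - x $ 4"
    and "axis_cnj 3 x $ 6 = x $ 5"
    and "axis_cnj 3 x $ 5 = - x $ 6"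
    and "axis_cnj 3 x $ 4 = x $ 7"
    and "axis_cnj 4 x $ 4 = x $ 0"
    and "axis_cnj 4 x $ 5 = x $ 1"
    and "axis_cnj 4 x $ 6 = x $ 2"
    and "axis_cnj 4 x $ 7 = x $ 3"
    and "axis_cnj 4 x $ 0 = x $ 4"
    and "axis_cnj 4 x $ 1 = - x $ 5"
    and "axis_cnj 4 x $ 2 = - x $ 6"
    and "axis_cnj 4 x $ 3 = - x $ 7"
    and "axis_cnj 5 x $ 5 = x $ 0"
    and "axis_cnj 5 x $ 4 = - x $ 1"
    and "axis_cnj 5 x $ 7 = x $ 2"
    and "axis_cnj 5 x $ 6 = - x $ 3"
    and "axis_cnj 5 x $ 1 = x $ 4"
    and "axis_cnj 5 x $ 0 = x $ 5"
    and "axis_cnj 5 x $ 3 = x $ 6"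
    and "axis_cnj 5 x $ 2 = - x $ 7"
    and "axis_cnj 6 x $ 6 = x $ 0"
    and "axis_cnj 6 x $ 7 = - x $ 1"
    and "axis_cnj 6 x $ 4 = - x $ 2"
    and "axis_cnj 6 x $ 5 = x $ 3"
    and "axis_cnj 6 x $ 2 = x $ 4"
    and "axis_cnj 6 x $ 3 = - x $ 5"
    and "axis_cnj 6 x $ 0 = x $ 6"
    and "axis_cnj 6 x $ 1 = x $ 7"
    and "axis_cnj 7 x $ 7 = x $ 0"
    and "axis_cnj 7 x $ 6 = x $ 1"
    and "axis_cnj 7 x $ 5 = - x $ 2"
    and "axis_cnj 7 x $ 4 = - x $ 3"
    and "axis_cnj 7 x $ 3 = x $ 4"
    and "axis_cnj 7 x $ 2 = x $ 5"
    and "axis_cnj 7 x $ 1 = - x $ 6"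
    and "axis_cnj 7 x $ 0 = x $ 7"
  by (simp_all add: axis_cnj_def oct_mult_nth axis_def oct_cnj_nth)

lemma axis_mult_axis: "axis a 1 \<cdot> axis b 1 = oct_basis_mult a b"
  using exhaust_8[of a] exhaust_8[of b]
  by (elim disjE) (simp_all add: oct_mult_def sum_8 axis_def)

lemma oct_cnj_axis: "oct_cnj (axis a 1) = (if a = 0 then axis a 1 else - axis a 1)"
  by (auto simp: vec_eq_iff oct_cnj_nth axis_def)

text \<open>The trace of a product of four gamma matrices on a half-spin representation of \<open>Spin(8)\<close>.\<close>

lemma trace_axis:
  fixes x A :: octonion
  shows "(\<Sum>h\<in>UNIV. ((axis h 1 \<cdot> oct_cnj x) \<cdot> A) \<bullet> ((axis h 1 \<cdot> oct_cnj (axis i 1)) \<cdot> axis j 1))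
    = 8 * ((if i = j then x \<bullet> A else 0) + x $ i * A $ j - A $ i * x $ j)"
  unfolding axis_cnj_def[symmetric]
  using exhaust_8[of i] exhaust_8[of j]
  by (elim disjE; simp add: oct_cnj_axis axis_mult_axis sum_8 oct_basis_mult_table oct_basis_def
        inner_axis oct_mult.minus_left oct_mult.minus_right axis_cnj_def[of _ "axis _ 1"];
      simp add: oct_mult_nth axis_cnj_nth inner_oct algebra_simps)

lemma Basis_octonion: "(Basis :: octonion set) = range (\<lambda>i. axis i 1)"
  by (auto simp: Basis_vec_def)

text \<open>The condition \<open>x \<bullet> A = 0\<close> removes the symmetric part of the trace
  and leaves the coordinates of x \<wedge> A. The factor 8 is the dimension of the space traced
  over.\<close>

lemma trace_identity:
  fixes x A i j :: octonion
  assumes "x \<bullet> A = 0" "i \<in> Basis" "j \<in> Basis"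
  shows "(\<Sum>h\<in>Basis. ((h \<cdot> oct_cnj x) \<cdot> A) \<bullet> ((h \<cdot> oct_cnj i) \<cdot> j))
    = 8 * ((x \<bullet> i) * (A \<bullet> j) - (A \<bullet> i) * (x \<bullet> j))"
proof -
  obtain a b where ij: "i = axis a 1" "j = axis b 1"
    using assms(2,3) unfolding Basis_octonion by blast
  have "inj (\<lambda>i. axis i 1 :: octonion)"
    by (auto intro!: injI simp: axis_eq_axis)
  then have "(\<Sum>h\<in>Basis. ((h \<cdot> oct_cnj x) \<cdot> A) \<bullet> ((h \<cdot> oct_cnj i) \<cdot> j))
      = (\<Sum>h\<in>UNIV. ((axis h 1 \<cdot> oct_cnj x) \<cdot> A) \<bullet> ((axis h 1 \<cdot> oct_cnj i) \<cdot> j))"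
    unfolding Basis_octonion by (subst sum.reindex) auto
  then show ?thesis
    unfolding ij trace_axis by (simp add: assms(1) inner_axis)
qed

section \<open>Exactness for homogeneous vector fields\<close>

lemmas smooth_oct_mult = smooth_bilinear[OF bounded_bilinear_oct_mult]
  and dd_oct_mult = dd_bilinear[OF bounded_bilinear_oct_mult]
  and smooth_oct_cnj = smooth_linear_comp[OF bounded_linear_oct_cnj]
  and dd_oct_cnj = dd_linear_comp[OF bounded_linear_oct_cnj]

lemmas smooth_intros = smooth_add smooth_diff smooth_scaleR smooth_inner smooth_oct_mult
  smooth_oct_cnj smooth_fst smooth_snd smooth_Pair smooth_ident smooth_const smooth_dd smooth_sum

lemma smooth_rho_OH: "smooth a \<Longrightarrow> smooth (\<lambda>p. rho_OH p (a p))"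
  unfolding rho_OH_eq by (intro smooth_intros)

text \<open>The derivative of \<open>rho_OH p a\<close> with respect to \<open>p\<close> along
  \<open>w\<close>, for fixed \<open>a\<close>.\<close>

definition drho :: "octonion2 \<Rightarrow> octonion2 \<Rightarrow> octonion2 \<Rightarrow> octonion2" where
  "drho p w a =
     ((2 * (fst p \<bullet> fst w)) *\<^sub>R fst a
        + (fst w \<cdot> oct_cnj (snd p) + fst p \<cdot> oct_cnj (snd w)) \<cdot> snd a
        - (w \<bullet> a) *\<^sub>R fst p - (p \<bullet> a) *\<^sub>R fst w,
      (2 * (snd p \<bullet> snd w)) *\<^sub>R snd a
        + (snd w \<cdot> oct_cnj (fst p) + snd p \<cdot> oct_cnj (fst w)) \<cdot> fst a
        - (w \<bullet> a) *\<^sub>R snd p - (p \<bullet> a) *\<^sub>R snd w)"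

lemma dd_rho_OH:
  assumes "smooth a"
  shows "dd v (\<lambda>p. rho_OH p (a p)) = (\<lambda>p. rho_OH p (dd v a p) + drho p v (a p))"
  unfolding rho_OH_eq drho_def
  by (rule ext) (simp add: assms dd_Pair dd_add dd_diff dd_scaleR dd_inner dd_oct_mult dd_oct_cnj dd_fst dd_snd
      smooth_intros smooth_fst[OF smooth_ident] smooth_snd[OF smooth_ident]
      oct_mult.add_left oct_mult.add_right inner_commute algebra_simps)

text \<open>\<open>lower n\<close> generates the shears (x, y) \<mapsto> (x, y + m \<cdot> x) with m
  = \<open>oct_cnj n\<close>; the conjugate makes \<open>lift n\<close> its transpose.\<close>

definition lift :: "octonion \<Rightarrow> octonion2 \<Rightarrow> octonion2" where
  "lift n p = (n \<cdot> snd p, 0)"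

definition lower :: "octonion \<Rightarrow> octonion2 \<Rightarrow> octonion2" where
  "lower n p = (0, oct_cnj n \<cdot> fst p)"

lemma bounded_linear_lift: "bounded_linear (lift n)"
  unfolding lift_def
  by (intro bounded_linear_Pair bounded_linear_zero
      bounded_linear_compose[OF oct_mult.bounded_linear_right bounded_linear_snd])

lemma bounded_linear_lower: "bounded_linear (lower n)"
  unfolding lower_def
  by (intro bounded_linear_Pair bounded_linear_zero
      bounded_linear_compose[OF oct_mult.bounded_linear_right bounded_linear_fst])

lemma inner_lower: "lower n p \<bullet> q = p \<bullet> lift n q"
  by (simp add: lift_def lower_def inner_prod_def inner_mult_left)

text \<open>Equivariance of \<open>\<rho>\<close> under the nilpotent part of \<open>so(1,9)\<close>, infinitesimally.\<close>

lemma drho_lift: "drho p (lift n p) a = lift n (rho_OH p a) + rho_OH p (lower n a)"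
proof -
  obtain x y where p: "p = (x, y)" by (cases p)
  obtain u v where a: "a = (u, v)" by (cases a)
  have 1: "n \<cdot> ((y \<cdot> oct_cnj x) \<cdot> u) + (x \<cdot> oct_cnj y) \<cdot> (oct_cnj n \<cdot> u) = (2 * (x \<bullet> (n \<cdot> y))) *\<^sub>R u"
    using mult_cnj_mult_polar[of n "x \<cdot> oct_cnj y" u]
    by (simp add: oct_cnj_mult inner_mult_right inner_commute[of n] inner_mult_right[of n y x, symmetric]
        inner_commute[of _ x])
  have 2: "y \<cdot> (oct_cnj y \<cdot> oct_cnj n) = (y \<bullet> y) *\<^sub>R oct_cnj n"
    by (rule mult_cnj_mult)
  have 3: "(n \<cdot> y) \<bullet> u = y \<bullet> (oct_cnj n \<cdot> u)"
    by (rule inner_mult_left)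
  have 4: "n \<cdot> ((y \<cdot> oct_cnj x) \<cdot> u) = (2 * (x \<bullet> (n \<cdot> y))) *\<^sub>R u - (x \<cdot> oct_cnj y) \<cdot> (oct_cnj n \<cdot> u)"
    using 1 by (simp add: algebra_simps)
  show ?thesis
    unfolding p a drho_def rho_OH_eq lift_def lower_def
    by (simp add: inner_prod_def oct_cnj_mult 2 3 4 mult_mult_cnj oct_mult.zero_right oct_mult.zero_left
        oct_mult.scaleR_left oct_mult.scaleR_right oct_mult.add_right oct_mult.diff_right algebra_simps)
qed

section \<open>Degrees under the bundle map and under its symmetries\<close>

lemma rho_OH_scaled: "rho_OH (t *\<^sub>R p) a = t\<^sup>2 *\<^sub>R rho_OH p a"
  by (simp add: rho_OH_eq oct_cnj_scaleR oct_mult.scaleR_left oct_mult.scaleR_right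
      power2_eq_square algebra_simps)

text \<open>\<open>Hom2 n\<close>: homogeneous of degree \<open>n - 2\<close>, zero if that is negative.\<close>

fun Hom2 :: "nat \<Rightarrow> ('a::real_normed_vector \<Rightarrow> 'b::real_normed_vector) \<Rightarrow> bool" where
  "Hom2 (Suc (Suc n)) b \<longleftrightarrow> Hom n b"
| "Hom2 _ b \<longleftrightarrow> b = (\<lambda>p. 0)"

lemma Hom2_smooth: "Hom2 n b \<Longrightarrow> smooth b"
  by (cases "(n, b)" rule: Hom2.cases) (auto simp: Hom_smooth)

lemma Hom2_zero [simp]: "Hom2 n (\<lambda>p. 0)"
proof (cases n)
  case (Suc k)
  then show ?thesis by (cases k) auto
qed auto

lemma Hom2_add: "Hom2 n a \<Longrightarrow> Hom2 n b \<Longrightarrow> Hom2 n (\<lambda>p. a p + b p)"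
  by (cases "(n, b)" rule: Hom2.cases) (auto simp: Hom_add)

lemma Hom2_scaleR: "Hom2 n b \<Longrightarrow> Hom2 n (\<lambda>p. c *\<^sub>R b p)"
  by (cases "(n, b)" rule: Hom2.cases) (auto simp: Hom_scaleR)

lemma Hom2_fspan: "fspan G b \<Longrightarrow> (\<And>g. g \<in> G \<Longrightarrow> Hom2 n g) \<Longrightarrow> Hom2 n b"
  by (induction rule: fspan.induct) (auto intro!: Hom2_add Hom2_scaleR)

lemma Hom2_finitely_generated:
  "\<exists>G. finite G \<and> (\<forall>g\<in>G. Hom2 n g) \<and>
    (\<forall>f::'a::euclidean_space \<Rightarrow> 'b::euclidean_space. Hom2 n f \<longrightarrow> fspan G f)"
proof (cases "n < 2")
  case True
  then have "n = 0 \<or> n = Suc 0" by auto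
  then show ?thesis by (intro exI[of _ "{}"]) (auto intro: fspan_zero)
next
  case False
  then obtain k where "n = Suc (Suc k)"
    by (metis add_2_eq_Suc less_eqE not_less)
  then show ?thesis using Hom_finitely_generated[of k] by simp
qed

lemma Hom_rho_OH:
  assumes "Hom2 n b"
  shows "Hom n (\<lambda>p. rho_OH p (b p))"
proof -
  have sm: "smooth b" using assms by (rule Hom2_smooth)
  show ?thesis
  proof (cases "(n, b)" rule: Hom2.cases)
    case (1 k b')
    then have "Hom k b" using assms by simp
    then show ?thesis
      using 1 sm by (simp add: Hom_def smooth_rho_OH rho_OH_scaled rho_OH_scaleR power2_eq_square mult_ac)
  qed (use assms in \<open>auto simp: linear_0[OF linear_rho_OH]\<close>)
qed

lemma Hom_dd_linear:
  assumes "Hom n f" "bounded_linear L"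
  shows "Hom n (\<lambda>p. dd (L p) (f :: 'a::euclidean_space \<Rightarrow> 'b::real_normed_vector) p)"
proof (cases n)
  case 0
  then have "dd v f p = 0" for v p
    using Hom_zero_dd[of f v] assms(1) by simp
  then show ?thesis by simp
next
  case (Suc k)
  have H: "Hom k (dd v f)" for v using Hom_dd assms(1) Suc by blast
  have "dd (L (t *\<^sub>R p)) f (t *\<^sub>R p) = t ^ n *\<^sub>R dd (L p) f p" for t p
    using Hom_scaled[OF H, of "L p" t p]
    by (simp add: linear_simps(5)[OF assms(2)] linear_scale[OF linear_dd[OF Hom_smooth[OF assms(1)]]] Suc)
  then show ?thesis
    unfolding Hom_def
    using smooth_dd_var[OF Hom_smooth[OF assms(1)] smooth_bounded_linear[OF assms(2)]] by blast
qed

lemma Hom_linear_comp: "Hom n f \<Longrightarrow> bounded_linear L \<Longrightarrow> Hom n (\<lambda>p. L (f p))"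
  by (simp add: Hom_def smooth_linear_comp linear_simps(5))

lemma Hom_comp_linear: "Hom n f \<Longrightarrow> bounded_linear L \<Longrightarrow> Hom n (\<lambda>p. f (L p))"
  by (simp add: Hom_def smooth_comp_linear linear_simps(5))

text \<open>This operator is how the transposed symmetry acts on coefficient fields
  \<open>b\<close>. It keeps the degree, so orthogonality to the image applies to the transformed
  \<open>b\<close> as well.\<close>

lemma Hom2_lift:
  fixes b :: "octonion2 \<Rightarrow> octonion2"
  assumes "Hom2 n b"
  shows "Hom2 n (\<lambda>p. dd (lift m p) b p + lower m (b p))"
proof (cases "(n, b)" rule: Hom2.cases)
  case (1 k b')
  then show ?thesis
    using assms
    by (auto intro!: Hom_add Hom_dd_linear[OF _ bounded_linear_lift] Hom_linear_comp[OF _ bounded_linear_lower])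
qed (use assms in \<open>auto simp: linear_simps(3)[OF bounded_linear_lower]\<close>)

text \<open>Koszul exactness at 2-forms: the homotopy \<open>\<Sum>\<^sub>i \<iota>(e\<^sub>i) \<partial>\<^sub>i\<close> inverts \<open>x \<and> \<cdot>\<close> up to the Euler operator.\<close>

lemma Koszul_2_forms:
  fixes \<omega> :: "octonion \<Rightarrow> octonion \<Rightarrow> octonion \<Rightarrow> real"
  assumes H: "\<And>i j. Hom m (\<omega> i j)"
    and anti: "\<And>i j x. \<omega> i j x = - \<omega> j i x"
    and cyc: "\<And>i j k x. i \<in> Basis \<Longrightarrow> j \<in> Basis \<Longrightarrow> k \<in> Basis \<Longrightarrow>
      (x \<bullet> i) * \<omega> j k x + (x \<bullet> j) * \<omega> k i x + (x \<bullet> k) * \<omega> i j x = 0"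
  obtains u :: "octonion \<Rightarrow> octonion" where "Hom2 (Suc m) u"
    "\<And>j k x. j \<in> Basis \<Longrightarrow> k \<in> Basis \<Longrightarrow> \<omega> j k x = (x \<bullet> j) * (u x \<bullet> k) - (x \<bullet> k) * (u x \<bullet> j)"
proof -
  have sm: "smooth (\<omega> i j)" for i j using H Hom_smooth by blast
  define U where "U k x = (\<Sum>i\<in>Basis. dd i (\<omega> i k) x)" for k x
  \<comment> \<open>The constant is m + 8 - 2: differentiating \<open>cyc\<close> along each
    \<open>i\<close> and summing gives 8 from the diagonal terms, \<open>m\<close> from Euler's
    identity, and -1 from each of the coincidences \<open>i = j\<close> and
    \<open>i = k\<close>.\<close>
  define u where "u x = (\<Sum>k\<in>Basis. (U k x / (real m + 6)) *\<^sub>R k)" for x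
  have uk: "u x \<bullet> k = U k x / (real m + 6)" if "k \<in> Basis" for x k
    using that by (simp add: u_def inner_sum_left inner_Basis if_distrib cong: if_cong)
  have key: "(real m + 6) * \<omega> j k x = (x \<bullet> j) * U k x - (x \<bullet> k) * U j x"
    if jk: "j \<in> Basis" "k \<in> Basis" for j k x
  proof -
    have dda: "dd v (\<omega> k i) x = - dd v (\<omega> i k) x" for v i
    proof -
      have "\<omega> k i = (\<lambda>x. - \<omega> i k x)" using anti by blast
      then show ?thesis using dd_minus[OF sm, of v i k] by simp
    qed
    have G: "(i \<bullet> i) * \<omega> j k x + (x \<bullet> i) * dd i (\<omega> j k) x + (i \<bullet> j) * \<omega> k i x
        - (x \<bullet> j) * dd i (\<omega> i k) x + (i \<bullet> k) * \<omega> i j x + (x \<bullet> k) * dd i (\<omega> i j) x = 0"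
      if i: "i \<in> Basis" for i
    proof -
      have "(\<lambda>x. (x \<bullet> i) * \<omega> j k x + (x \<bullet> j) * \<omega> k i x + (x \<bullet> k) * \<omega> i j x) = (\<lambda>x. 0)"
        using cyc i jk by blast
      then have "dd i (\<lambda>x. (x \<bullet> i) * \<omega> j k x + (x \<bullet> j) * \<omega> k i x + (x \<bullet> k) * \<omega> i j x) x = 0"
        by simp
      moreover have "dd i (\<lambda>x. (x \<bullet> i) * \<omega> j k x + (x \<bullet> j) * \<omega> k i x + (x \<bullet> k) * \<omega> i j x) x
        = ((x \<bullet> i) * dd i (\<omega> j k) x + (i \<bullet> i) * \<omega> j k x) + ((x \<bullet> j) * dd i (\<omega> k i) x + (i \<bullet> j) * \<omega> k i x)
          + ((x \<bullet> k) * dd i (\<omega> i j) x + (i \<bullet> k) * \<omega> i j x)"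
        by (simp add: dd_add smooth_add sm smooth_bilinear[OF bounded_bilinear_mult]
            dd_bilinear[OF bounded_bilinear_mult] smooth_inner_const dd_inner_const)
      ultimately show ?thesis by (simp add: dda)
    qed
    have "0 = (\<Sum>i\<in>Basis. (i \<bullet> i) * \<omega> j k x + (x \<bullet> i) * dd i (\<omega> j k) x + (i \<bullet> j) * \<omega> k i x
        - (x \<bullet> j) * dd i (\<omega> i k) x + (i \<bullet> k) * \<omega> i j x + (x \<bullet> k) * dd i (\<omega> i j) x)"
      using G by (simp add: sum.neutral)
    also have "\<dots> = (\<Sum>i\<in>Basis. (i \<bullet> (i::octonion)) * \<omega> j k x) + (\<Sum>i\<in>Basis. (x \<bullet> i) * dd i (\<omega> j k) x)
        + (\<Sum>i\<in>Basis. (i \<bullet> j) * \<omega> k i x) - (x \<bullet> j) * U k x + (\<Sum>i\<in>Basis. (i \<bullet> k) * \<omega> i j x) + (x \<bullet> k) * U j x"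
      by (simp add: U_def sum.distrib sum_subtractf sum_distrib_left)
    also have "(\<Sum>i\<in>Basis. (i \<bullet> (i::octonion)) * \<omega> j k x) = 8 * \<omega> j k x"
      by (simp add: inner_Basis)
    also have "(\<Sum>i\<in>Basis. (x \<bullet> i) * dd i (\<omega> j k) x) = real m * \<omega> j k x"
      using Euler_homogeneous_Basis[OF H, of x j k] by simp
    also have "(\<Sum>i\<in>Basis. (i \<bullet> j) * \<omega> k i x) = \<omega> k j x"
      using jk by (simp add: inner_Basis if_distrib[of "\<lambda>c. c * _"] cong: if_cong)
    also have "(\<Sum>i\<in>Basis. (i \<bullet> k) * \<omega> i j x) = \<omega> k j x"
      using jk by (simp add: inner_Basis if_distrib[of "\<lambda>c. c * _"] cong: if_cong)
    finally show ?thesis using anti[of k j x] by (simp add: algebra_simps)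
  qed
  have "Hom2 (Suc m) u"
  proof (cases m)
    case 0
    then have "U k x = 0" for k x
      using Hom_zero_dd[of "\<omega> _ k"] H by (simp add: U_def)
    then show ?thesis using 0 by (simp add: u_def fun_eq_iff)
  next
    case (Suc m')
    have "Hom m' (U k)" for k
      unfolding U_def using H Hom_dd Suc by (intro Hom_sum) blast
    then have "Hom m' (\<lambda>x. \<Sum>k\<in>Basis. (1 / (real m + 6)) *\<^sub>R (U k x *\<^sub>R k))"
      by (intro Hom_sum Hom_scaleR Hom_linear_comp[OF _ bounded_linear_scaleR_left])
    then show ?thesis using Suc by (simp add: u_def[abs_def])
  qed
  moreover have "\<omega> j k x = (x \<bullet> j) * (u x \<bullet> k) - (x \<bullet> k) * (u x \<bullet> j)"
    if "j \<in> Basis" "k \<in> Basis" for j k x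
  proof -
    have "real m + 6 \<noteq> 0" by (metis add_nonneg_eq_0_iff of_nat_0_le_iff zero_le_numeral zero_neq_numeral)
    then have "\<omega> j k x = ((x \<bullet> j) * U k x - (x \<bullet> k) * U j x) / (real m + 6)"
      using key[OF that, of x] by (simp add: eq_divide_eq mult.commute)
    then show ?thesis by (simp add: uk that diff_divide_distrib)
  qed
  ultimately show ?thesis using that by blast
qed

section \<open>Tangent fields whose first component does not depend on the second variable\<close>

lemma bounded_linear_embed_fst: "bounded_linear (\<lambda>x. (x, 0))"
  by (intro bounded_linear_Pair bounded_linear_ident bounded_linear_zero)

lemma dd_zero_imp_indep_snd:
  fixes A :: "octonion2 \<Rightarrow> 'b::real_normed_vector"
  assumes "smooth A" "\<And>h. dd (0, h) A = (\<lambda>p. 0)"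
  shows "A (x, y) = A (x, 0)"
proof -
  have "((\<lambda>t. A ((x, 0) + t *\<^sub>R (0, y))) has_derivative (\<lambda>s. 0)) (at t)" for t :: real
    using dd_line[OF assms(1), of "(x, 0)" "(0, y)" t] assms(2) by simp
  then have "\<exists>c. \<forall>t\<in>UNIV. A ((x, 0) + t *\<^sub>R (0, y)) = c"
    by (intro has_derivative_zero_constant) auto
  then have "A ((x, 0) + 1 *\<^sub>R (0, y)) = A ((x, 0) + 0 *\<^sub>R (0, y))"
    by (metis UNIV_I)
  then show ?thesis by simp
qed

text \<open>A point with x = 0 is approached along a line on which x \<noteq> 0 elsewhere, so
  continuity decides it.\<close>

lemma smooth_eq_off_fst_0:
  fixes f g :: "octonion2 \<Rightarrow> 'b::real_normed_vector"
  assumes "smooth f" "smooth g" "\<And>p. fst p \<noteq> 0 \<Longrightarrow> f p = g p"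
  shows "f p = g p"
proof (cases "fst p = 0")
  case True
  have c: "isCont (\<lambda>t. h (p + t *\<^sub>R (oct_basis 0, 0))) 0" if "smooth h" for h :: "octonion2 \<Rightarrow> 'b"
    by (rule isCont_o2[where g=h]) (auto intro!: continuous_intros smooth_isCont that)
  have "f (p + 0 *\<^sub>R (oct_basis 0, 0)) = g (p + 0 *\<^sub>R (oct_basis 0, 0))"
    by (rule isCont_eq_at_0[OF c[OF assms(1)] c[OF assms(2)]], rule assms(3))
      (simp add: True oct_basis_def axis_eq_0_iff)
  then show ?thesis by (simp add: zero_prod_def[symmetric])
qed (use assms in auto)

text \<open>\<open>A\<close> determines the second component off x = 0, so a single map
  \<open>u\<close> of the first variable can serve both components. It is the Koszul preimage of x
  \<wedge> A divided by \<open>x \<bullet> x\<close>.\<close>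

lemma exact_indep_snd:
  assumes Z: "Hom n Z" "\<And>p. hopf_tangent p (Z p)"
    and indep: "\<And>h. dd (0, h) (\<lambda>p. fst (Z p)) = (\<lambda>p. 0)"
  shows "\<exists>b. Hom2 n b \<and> Z = (\<lambda>p. rho_OH p (b p))"
proof -
  have sZ: "smooth Z" using Z(1) Hom_smooth by blast
  define A where "A x = fst (Z (x, 0))" for x
  have fstZ: "fst (Z (x, y)) = A x" for x y
    using dd_zero_imp_indep_snd[OF smooth_fst[OF sZ] indep] by (simp add: A_def)
  have HA: "Hom n A"
    unfolding A_def[abs_def]
    by (rule Hom_linear_comp[OF Hom_comp_linear[OF Z(1) bounded_linear_embed_fst] bounded_linear_fst])
  have xA: "x \<bullet> A x = 0" for x
    using Z(2)[of "(x, 0)"] by (simp add: hopf_tangent_def A_def)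
  have sndZ: "(x \<bullet> x) *\<^sub>R snd (Z (x, y)) = (y \<cdot> oct_cnj x) \<cdot> A x" for x y
    using hopf_tangent_imp_mult(1)[of x y "A x" "snd (Z (x, y))"] Z(2)[of "(x, y)"] fstZ[of x y]
    by (metis prod.collapse)
  \<comment> \<open>it suffices to find \<open>u\<close> with the right first component\<close>
  have suff: "Z = (\<lambda>p. rho_OH p (u (fst p), 0))"
    if u: "smooth u" "\<And>x. A x = (x \<bullet> x) *\<^sub>R u x - (x \<bullet> u x) *\<^sub>R x" for u
  proof (rule ext, rule smooth_eq_off_fst_0[OF sZ])
    show "smooth (\<lambda>p. rho_OH p (u (fst p), 0))"
      by (intro smooth_rho_OH smooth_Pair smooth_comp_linear[OF u(1) bounded_linear_fst] smooth_const)
    fix p :: octonion2 assume nz: "fst p \<noteq> 0"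
    obtain x y where p: "p = (x, y)" by (cases p)
    have "(x \<bullet> x) *\<^sub>R snd (Z (x, y)) = (x \<bullet> x) *\<^sub>R ((y \<cdot> oct_cnj x) \<cdot> u x - (x \<bullet> u x) *\<^sub>R y)"
      unfolding sndZ u(2)
      by (simp add: oct_mult.diff_right oct_mult.scaleR_right mult_cnj_mult_right algebra_simps)
    then have "snd (Z (x, y)) = (y \<cdot> oct_cnj x) \<cdot> u x - (x \<bullet> u x) *\<^sub>R y"
      using nz p by simp
    moreover have "fst (Z (x, y)) = (x \<bullet> x) *\<^sub>R u x - (x \<bullet> u x) *\<^sub>R x"
      unfolding fstZ u(2) ..
    ultimately show "Z p = rho_OH p (u (fst p), 0)"
      by (simp add: prod_eq_iff p rho_OH_eq inner_prod_def oct_mult.zero_right)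
  qed
  show ?thesis
  proof (cases n)
    case 0
    \<comment> \<open>A constant value orthogonal to every \<open>x\<close> is orthogonal to
      itself.\<close>
    have "A x = 0" for x
      using xA[of "A x"] Hom_zero_const[of A x] Hom_zero_const[of A "A x"] HA 0 by simp
    then have "Z = (\<lambda>p. rho_OH p (0, 0))"
      using suff[of "\<lambda>x. 0"] by simp
    then show ?thesis
      using 0 by (intro exI[of _ "\<lambda>p. 0"]) (simp add: zero_prod_def)
  next
    case (Suc m)
    \<comment> \<open>The part of the second component that is linear in \<open>y\<close>, in the
      direction \<open>h\<close>. Being a derivative of \<open>Z\<close> it is smooth, and this is
      where divisibility by \<open>x \<bullet> x\<close> comes from.\<close>
    define \<beta> where "\<beta> h x = snd (dd (0, h) Z (x, 0))" for h x
    have H\<beta>: "Hom m (\<beta> h)" for h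
      unfolding \<beta>_def[abs_def]
      using Hom_dd[of m Z "(0, h)"] Z(1) Suc
      by (intro Hom_linear_comp[OF _ bounded_linear_snd] Hom_comp_linear[OF _ bounded_linear_embed_fst]) auto
    have \<beta>: "(x \<bullet> x) *\<^sub>R \<beta> h x = (h \<cdot> oct_cnj x) \<cdot> A x" for h x
    proof -
      note sm = smooth_fst[OF sZ] smooth_snd[OF sZ] smooth_fst[OF smooth_ident] smooth_snd[OF smooth_ident]
      have "(\<lambda>p. (fst p \<bullet> fst p) *\<^sub>R snd (Z p)) = (\<lambda>p. (snd p \<cdot> oct_cnj (fst p)) \<cdot> fst (Z p))"
        using sndZ fstZ by (auto simp: fun_eq_iff)
      then have "dd (0, h) (\<lambda>p. (fst p \<bullet> fst p) *\<^sub>R snd (Z p)) (x, 0)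
          = dd (0, h) (\<lambda>p. (snd p \<cdot> oct_cnj (fst p)) \<cdot> fst (Z p)) (x, 0)" by simp
      then show ?thesis
        by (simp add: \<beta>_def A_def dd_scaleR dd_inner dd_oct_mult dd_oct_cnj sm smooth_inner smooth_oct_mult
            smooth_oct_cnj dd_fst dd_snd sZ oct_mult.zero_left oct_mult.zero_right)
    qed
    \<comment> \<open>The coordinates of x \<wedge> A divided by \<open>x \<bullet> x\<close>. The
      factor 16 is the 8 of the trace times 2 from antisymmetrizing in \<open>i\<close> and
      \<open>j\<close>, which yields \<open>anti\<close> for all arguments, \<open>x = 0\<close>
      included.\<close>
    define \<omega> where "\<omega> i j x =
      (1 / 16) * (\<Sum>h\<in>Basis. \<beta> h x \<bullet> ((h \<cdot> oct_cnj i) \<cdot> j - (h \<cdot> oct_cnj j) \<cdot> i))" for i j x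
    have H\<omega>: "Hom m (\<omega> i j)" for i j
    proof -
      have "Hom m (\<lambda>x. (1 / 16) *\<^sub>R (\<Sum>h\<in>Basis. \<beta> h x \<bullet> ((h \<cdot> oct_cnj i) \<cdot> j - (h \<cdot> oct_cnj j) \<cdot> i)))"
        by (intro Hom_scaleR Hom_sum Hom_linear_comp[OF H\<beta> bounded_linear_inner_left])
      then show ?thesis by (simp add: \<omega>_def[abs_def])
    qed
    have anti: "\<omega> i j x = - \<omega> j i x" for i j x
      by (simp add: \<omega>_def sum_negf[symmetric] inner_diff_right)
    have \<omega>: "(x \<bullet> x) * \<omega> i j x = (x \<bullet> i) * (A x \<bullet> j) - (A x \<bullet> i) * (x \<bullet> j)"
      if "i \<in> Basis" "j \<in> Basis" for i j x
    proof -
      have "(x \<bullet> x) * \<omega> i j x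
        = (1 / 16) * (\<Sum>h\<in>Basis. ((x \<bullet> x) *\<^sub>R \<beta> h x) \<bullet> ((h \<cdot> oct_cnj i) \<cdot> j - (h \<cdot> oct_cnj j) \<cdot> i))"
        by (simp add: \<omega>_def sum_distrib_left mult_ac)
      also have "\<dots> = (1 / 16) * ((\<Sum>h\<in>Basis. ((h \<cdot> oct_cnj x) \<cdot> A x) \<bullet> ((h \<cdot> oct_cnj i) \<cdot> j))
          - (\<Sum>h\<in>Basis. ((h \<cdot> oct_cnj x) \<cdot> A x) \<bullet> ((h \<cdot> oct_cnj j) \<cdot> i)))"
        by (simp only: \<beta> inner_diff_right sum_subtractf)
      also have "\<dots> = (x \<bullet> i) * (A x \<bullet> j) - (A x \<bullet> i) * (x \<bullet> j)"
        unfolding trace_identity[OF xA that] trace_identity[OF xA that(2,1)] by (simp add: algebra_simps)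
      finally show ?thesis .
    qed
    \<comment> \<open>Up to the factor \<open>x \<bullet> x\<close> this is x \<wedge> x \<wedge> A
      = 0.\<close>
    have cyc: "(x \<bullet> i) * \<omega> j k x + (x \<bullet> j) * \<omega> k i x + (x \<bullet> k) * \<omega> i j x = 0"
      if "i \<in> Basis" "j \<in> Basis" "k \<in> Basis" for i j k x
    proof (cases "x = 0")
      case False
      have "(x \<bullet> x) * ((x \<bullet> i) * \<omega> j k x + (x \<bullet> j) * \<omega> k i x + (x \<bullet> k) * \<omega> i j x)
        = (x \<bullet> i) * ((x \<bullet> x) * \<omega> j k x) + (x \<bullet> j) * ((x \<bullet> x) * \<omega> k i x) + (x \<bullet> k) * ((x \<bullet> x) * \<omega> i j x)"
        by (simp add: algebra_simps)
      also have "\<dots> = 0"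
        unfolding \<omega>[OF that(2,3)] \<omega>[OF that(3,1)] \<omega>[OF that(1,2)] by (simp add: algebra_simps)
      finally show ?thesis using False by simp
    qed simp
    obtain u where u: "Hom2 (Suc m) u" "\<And>j k x. j \<in> Basis \<Longrightarrow> k \<in> Basis \<Longrightarrow>
        \<omega> j k x = (x \<bullet> j) * (u x \<bullet> k) - (x \<bullet> k) * (u x \<bullet> j)"
      using Koszul_2_forms[of m \<omega>, OF H\<omega> anti cyc] by metis
    have "A x = (x \<bullet> x) *\<^sub>R u x - (x \<bullet> u x) *\<^sub>R x" for x
    proof (cases "x = 0")
      case True
      then show ?thesis using Hom_scaled[OF HA, of 0 x] Suc by simp
    next
      case False
      show ?thesis
      proof (rule euclidean_eqI)
        fix k :: octonion assume k: "k \<in> Basis"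
        \<comment> \<open>Both expressions for \<open>\<omega>\<close> are contracted with
          \<open>x\<close>: the first gives \<open>A\<close> because
          \<open>x \<bullet> A = 0\<close>, the second the required expression in
          \<open>u\<close>.\<close>
        have "(x \<bullet> x) * (\<Sum>j\<in>Basis. (x \<bullet> j) * \<omega> j k x)
            = (\<Sum>j\<in>Basis. (x \<bullet> j) * ((x \<bullet> x) * \<omega> j k x))"
          by (simp add: sum_distrib_left mult_ac)
        also have "\<dots> = (\<Sum>j\<in>Basis. (x \<bullet> j) * ((x \<bullet> j) * (A x \<bullet> k) - (A x \<bullet> j) * (x \<bullet> k)))"
          by (intro sum.cong refl) (simp only: \<omega>[OF _ k])
        also have "\<dots> = (\<Sum>j\<in>Basis. (x \<bullet> j) * (x \<bullet> j)) * (A x \<bullet> k)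
            - (\<Sum>j\<in>Basis. (x \<bullet> j) * (A x \<bullet> j)) * (x \<bullet> k)"
          by (simp add: right_diff_distrib sum_distrib_left sum_distrib_right sum_subtractf mult_ac)
        also have "\<dots> = (x \<bullet> x) * (A x \<bullet> k)"
          using xA[of x] by (simp add: euclidean_inner[symmetric])
        finally have "A x \<bullet> k = (\<Sum>j\<in>Basis. (x \<bullet> j) * \<omega> j k x)"
          using False by simp
        also have "\<dots> = (\<Sum>j\<in>Basis. (x \<bullet> j) * ((x \<bullet> j) * (u x \<bullet> k) - (x \<bullet> k) * (u x \<bullet> j)))"
          by (intro sum.cong refl) (simp only: u(2)[OF _ k])
        also have "\<dots> = (\<Sum>j\<in>Basis. (x \<bullet> j) * (x \<bullet> j)) * (u x \<bullet> k)
            - (\<Sum>j\<in>Basis. (x \<bullet> j) * (u x \<bullet> j)) * (x \<bullet> k)"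
          by (simp add: right_diff_distrib sum_distrib_left sum_distrib_right sum_subtractf mult_ac)
        also have "\<dots> = ((x \<bullet> x) *\<^sub>R u x - (x \<bullet> u x) *\<^sub>R x) \<bullet> k"
          by (simp add: euclidean_inner[symmetric] inner_diff_left)
        finally show "A x \<bullet> k = ((x \<bullet> x) *\<^sub>R u x - (x \<bullet> u x) *\<^sub>R x) \<bullet> k" .
      qed
    qed
    then have "Z = (\<lambda>p. rho_OH p (u (fst p), 0))"
      by (rule suff[OF Hom2_smooth[OF u(1)]])
    moreover have "Hom2 n (\<lambda>p::octonion2. (u (fst p), 0::octonion))"
    proof (cases m)
      case 0
      then show ?thesis using u(1) Suc by (simp add: zero_prod_def)
    next
      case (Suc m')
      then have "Hom m' u" using u(1) by simp
      then have "Hom m' (\<lambda>p::octonion2. (u (fst p), 0::octonion))"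
        by (intro Hom_linear_comp[OF _ bounded_linear_embed_fst] Hom_comp_linear[OF _ bounded_linear_fst])
      then show ?thesis using Suc \<open>n = Suc m\<close> by simp
    qed
    ultimately show ?thesis
      by (intro exI[of _ "\<lambda>p. (u (fst p), 0)"]) simp
  qed
qed


subsection \<open>Lowering the degree in the second variable\<close>

text \<open>The Lie bracket of the linear field \<open>lower m\<close> with \<open>Z\<close>, that
  is, the infinitesimal action of a shear on vector fields.\<close>

definition lowering :: "octonion \<Rightarrow> (octonion2 \<Rightarrow> octonion2) \<Rightarrow> octonion2 \<Rightarrow> octonion2" where
  "lowering m Z = (\<lambda>p. dd (lower m p) Z p - lower m (Z p))"

lemma Hom_lowering: "Hom n Z \<Longrightarrow> Hom n (lowering m Z)"
  unfolding lowering_def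
  by (intro Hom_diff Hom_dd_linear[OF _ bounded_linear_lower] Hom_linear_comp[OF _ bounded_linear_lower])

text \<open>A shear adds a constant to the slope of a line and keeps x, so it permutes the leaves.
  Infinitesimally, differentiating the tangency equations along the shear leaves inhomogeneous
  terms, and the correction \<open>lower m (Z p)\<close> cancels them.\<close>

lemma hopf_tangent_lowering:
  assumes Z: "smooth Z" "\<And>p. hopf_tangent p (Z p)"
  shows "hopf_tangent p (lowering m Z p)"
proof -
  note sm = smooth_fst[OF Z(1)] smooth_snd[OF Z(1)] smooth_fst[OF smooth_ident] smooth_snd[OF smooth_ident]
  obtain x y where p: "p = (x, y)" by (cases p)
  define c where "c = oct_cnj m"
  define A where "A = fst (Z (x, y))"
  define B where "B = snd (Z (x, y))"
  define A' where "A' = fst (dd (0, c \<cdot> x) Z (x, y))"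
  define B' where "B' = snd (dd (0, c \<cdot> x) Z (x, y))"
  have h: "x \<bullet> A = 0" "y \<bullet> B = 0" "B \<cdot> oct_cnj x + y \<cdot> oct_cnj A = 0"
    using Z(2)[of p] by (auto simp: hopf_tangent_def A_def B_def p)
  have "(\<lambda>p. fst p \<bullet> fst (Z p)) = (\<lambda>p. 0)" "(\<lambda>p. snd p \<bullet> snd (Z p)) = (\<lambda>p. 0)"
    "(\<lambda>p. snd (Z p) \<cdot> oct_cnj (fst p) + snd p \<cdot> oct_cnj (fst (Z p))) = (\<lambda>p. 0)"
    using Z(2) by (auto simp: hopf_tangent_def)
  then have "dd (0, c \<cdot> x) (\<lambda>p. fst p \<bullet> fst (Z p)) (x, y) = 0"
    "dd (0, c \<cdot> x) (\<lambda>p. snd p \<bullet> snd (Z p)) (x, y) = 0"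
    "dd (0, c \<cdot> x) (\<lambda>p. snd (Z p) \<cdot> oct_cnj (fst p) + snd p \<cdot> oct_cnj (fst (Z p))) (x, y) = 0"
    by simp_all
  then have d: "x \<bullet> A' = 0" "y \<bullet> B' + (c \<cdot> x) \<bullet> B = 0"
    "B' \<cdot> oct_cnj x + y \<cdot> oct_cnj A' + (c \<cdot> x) \<cdot> oct_cnj A = 0"
    by (simp_all add: A_def B_def A'_def B'_def dd_inner dd_add dd_oct_mult dd_oct_cnj sm smooth_oct_mult
        smooth_oct_cnj dd_fst dd_snd Z(1) oct_mult.zero_right algebra_simps)
  have low: "lowering m Z p = (A', B' - c \<cdot> A)"
    by (simp add: lowering_def lower_def p A_def A'_def B'_def c_def prod_eq_iff)
  have "(c \<cdot> A) \<cdot> oct_cnj x + (c \<cdot> x) \<cdot> oct_cnj A = 0"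
    using mult_mult_cnj_polar[of c "oct_cnj x" "oct_cnj A"] h(1) by (simp add: add.commute)
  then have 3: "(B' - c \<cdot> A) \<cdot> oct_cnj x + y \<cdot> oct_cnj A' = 0"
    using d(3) by (simp add: oct_mult.diff_left algebra_simps add_eq_0_iff)
  have "(c \<cdot> x) \<bullet> B + y \<bullet> (c \<cdot> A) = c \<bullet> (B \<cdot> oct_cnj x + y \<cdot> oct_cnj A)"
    by (simp add: inner_add_right inner_mult_right inner_commute[of y])
  then have 2: "y \<bullet> (B' - c \<cdot> A) = 0"
    using d(2) by (simp add: h(3) inner_diff_right)
  show ?thesis
    unfolding low using d(1) 2 3 by (simp add: hopf_tangent_def p)
qed

text \<open>Adjunction turns the bracket with \<open>lower m\<close> into one with
  \<open>lift m\<close>, which by \<open>drho_lift\<close> maps the image of the bundle map to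
  itself. Hence \<open>lowering m\<close> preserves the orthogonal complement of the image.\<close>

lemma IP_lowering_rho_OH:
  assumes "smooth Z" "smooth b"
  shows "IP k (lowering m Z) (\<lambda>p. rho_OH p (b p))
    = IP k Z (\<lambda>p. rho_OH p (dd (lift m p) b p + lower m (b p)))"
proof -
  note sm = smooth_dd_var[OF _ smooth_bounded_linear[OF bounded_linear_lower]]
    smooth_dd_var[OF _ smooth_bounded_linear[OF bounded_linear_lift]]
    smooth_linear_comp[OF bounded_linear_lower] smooth_linear_comp[OF bounded_linear_lift]
  let ?W = "\<lambda>p. rho_OH p (b p)"
  have W: "smooth ?W" by (rule smooth_rho_OH[OF assms(2)])
  have "IP k (lowering m Z) ?W = IP k (\<lambda>p. dd (lower m p) Z p) ?W - IP k (\<lambda>p. lower m (Z p)) ?W"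
    unfolding lowering_def by (rule IP_diff_left) (intro sm assms)+
  also have "\<dots> = IP k Z (\<lambda>p. dd (lift m p) ?W p) - IP k Z (\<lambda>p. lift m (?W p))"
    by (simp only: IP_linear_field[OF bounded_linear_lower bounded_linear_lift inner_lower assms(1) W]
        IP_linear_comp[OF bounded_linear_lower bounded_linear_lift inner_lower assms(1) W])
  also have "\<dots> = IP k Z (\<lambda>p. dd (lift m p) ?W p - lift m (?W p))"
    unfolding IP_commute[of k Z] by (rule IP_diff_left[symmetric]) (intro sm W)+
  also have "(\<lambda>p. dd (lift m p) ?W p - lift m (?W p))
      = (\<lambda>p. rho_OH p (dd (lift m p) b p + lower m (b p)))"
    by (simp add: dd_rho_OH[OF assms(2)] drho_lift rho_OH_add)
  finally show ?thesis .
qed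

text \<open>An upper bound for the degree in the second variable. Bound 0 means independence of it,
  the case of \<open>exact_indep_snd\<close>.\<close>

primrec snd_degree :: "nat \<Rightarrow> (octonion2 \<Rightarrow> 'b::real_normed_vector) \<Rightarrow> bool" where
  "snd_degree 0 f \<longleftrightarrow> (\<forall>h. dd (0, h) f = (\<lambda>p. 0))"
| "snd_degree (Suc d) f \<longleftrightarrow> (\<forall>h. snd_degree d (dd (0, h) f))"

lemma snd_degree_zero [simp]: "snd_degree d (\<lambda>p. 0)"
  by (induction d) auto

lemma snd_degree_add:
  "smooth f \<Longrightarrow> smooth g \<Longrightarrow> snd_degree d f \<Longrightarrow> snd_degree d g \<Longrightarrow> snd_degree d (\<lambda>p. f p + g p)"
  by (induction d arbitrary: f g) (auto simp: dd_add smooth_dd)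

lemma snd_degree_sum:
  "(\<And>i. i \<in> I \<Longrightarrow> smooth (f i)) \<Longrightarrow> (\<And>i. i \<in> I \<Longrightarrow> snd_degree d (f i)) \<Longrightarrow>
    snd_degree d (\<lambda>p. \<Sum>i\<in>I. f i p)"
  by (induction I rule: infinite_finite_induct) (auto intro!: snd_degree_add smooth_sum)

lemma snd_degree_scaleR:
  assumes "smooth g" "\<And>h. dd (0, h) g = (\<lambda>p. 0 :: real)"
  shows "smooth f \<Longrightarrow> snd_degree d f \<Longrightarrow> snd_degree d (\<lambda>p. g p *\<^sub>R f p)"
  by (induction d arbitrary: f) (auto simp: dd_scaleR assms smooth_dd)

lemma snd_degree_Hom: "Hom n f \<Longrightarrow> snd_degree n f"
  by (induction n arbitrary: f) (auto simp: Hom_zero_dd intro: Hom_dd)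

text \<open>The field \<open>lower m\<close> points in the second variable with coefficients that
  depend only on the first, so the derivative costs one degree and the coefficients add
  none.\<close>

lemma snd_degree_dd_lower:
  fixes f :: "octonion2 \<Rightarrow> 'b::real_normed_vector"
  assumes f: "smooth f" "snd_degree (Suc d) f"
  shows "snd_degree d (\<lambda>p. dd (lower m p) f p)"
proof -
  have "dd (lower m p) f p = (\<Sum>i\<in>Basis. ((oct_cnj m \<cdot> fst p) \<bullet> i) *\<^sub>R dd (0, i) f p)" for p
  proof -
    interpret linear "\<lambda>v. dd v f p" by (rule linear_dd[OF f(1)])
    have "(\<Sum>i\<in>Basis. (v \<bullet> i) *\<^sub>R (0::octonion, i)) = (0, v)" for v :: octonion
      by (simp add: prod_eq_iff fst_sum snd_sum euclidean_representation)
    then have "lower m p = (\<Sum>i\<in>Basis. ((oct_cnj m \<cdot> fst p) \<bullet> i) *\<^sub>R (0, i))"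
      by (simp add: lower_def)
    then show ?thesis by (simp only: sum scale)
  qed
  moreover have "snd_degree d (\<lambda>p. ((oct_cnj m \<cdot> fst p) \<bullet> i) *\<^sub>R dd (0, i) f p)" for i
  proof (rule snd_degree_scaleR)
    have bl: "bounded_linear (\<lambda>p::octonion2. (oct_cnj m \<cdot> fst p) \<bullet> i)"
      by (intro bounded_linear_compose[OF bounded_linear_inner_left]
          bounded_linear_compose[OF oct_mult.bounded_linear_right bounded_linear_fst])
    then show "smooth (\<lambda>p::octonion2. (oct_cnj m \<cdot> fst p) \<bullet> i)"
      by (rule smooth_bounded_linear)
    show "dd (0, h) (\<lambda>p::octonion2. (oct_cnj m \<cdot> fst p) \<bullet> i) = (\<lambda>p. 0)" for h
      by (simp add: dd_bounded_linear[OF bl] oct_mult.zero_right)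
  qed (use f smooth_dd in auto)
  moreover have "smooth (\<lambda>p. ((oct_cnj m \<cdot> fst p) \<bullet> i) *\<^sub>R dd (0, i) f p)" for i
    by (intro smooth_intros f)
  ultimately show ?thesis by (simp add: snd_degree_sum)
qed

text \<open>In both cases \<open>Z\<close> turns out to lie in the image, to which it is orthogonal.
  In the step the induction hypothesis kills every \<open>lowering m Z\<close>, which makes the
  first component independent of the second variable.\<close>

lemma orthogonal_to_image_eq_0:
  assumes "Hom n Z" "\<And>p. hopf_tangent p (Z p)"
    "\<And>b. Hom2 n b \<Longrightarrow> IP n Z (\<lambda>p. rho_OH p (b p)) = 0"
    "snd_degree d (\<lambda>p. fst (Z p))"
  shows "Z = (\<lambda>p. 0)"
  using assms
proof (induction d arbitrary: Z)
  case 0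
  obtain b where b: "Hom2 n b" "Z = (\<lambda>p. rho_OH p (b p))"
    using exact_indep_snd[OF 0(1,2)] 0(4) by auto
  have "IP n Z Z = 0"
    using 0(3)[OF b(1)] b(2) by simp
  then show ?case using IP_eq_0 0(1) by blast
next
  case (Suc d)
  have sZ: "smooth Z" using Suc.prems(1) Hom_smooth by blast
  have low0: "lowering m Z = (\<lambda>p. 0)" for m
  proof (rule Suc.IH)
    show "Hom n (lowering m Z)" by (rule Hom_lowering[OF Suc.prems(1)])
    show "hopf_tangent p (lowering m Z p)" for p
      by (rule hopf_tangent_lowering[OF sZ Suc.prems(2)])
    show "IP n (lowering m Z) (\<lambda>p. rho_OH p (b p)) = 0" if "Hom2 n b" for b
      unfolding IP_lowering_rho_OH[OF sZ Hom2_smooth[OF that]]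
      by (rule Suc.prems(3)[OF Hom2_lift[OF that]])
    have "(\<lambda>p. fst (lowering m Z p)) = (\<lambda>p. dd (lower m p) (\<lambda>p. fst (Z p)) p)"
      by (simp add: lowering_def lower_def dd_fst[OF sZ])
    then show "snd_degree d (\<lambda>p. fst (lowering m Z p))"
      using snd_degree_dd_lower[OF smooth_fst[OF sZ] Suc.prems(4)] by simp
  qed
  have indep: "dd (0, h) (\<lambda>p. fst (Z p)) = (\<lambda>p. 0)" for h
  proof (rule ext, rule smooth_eq_off_fst_0)
    fix p :: octonion2 assume nz: "fst p \<noteq> 0"
    \<comment> \<open>\<open>oct_cnj m\<close> is the slope that carries \<open>fst p\<close> to
      \<open>h\<close>. As \<open>lower m\<close> has no first component,
      \<open>lowering m Z = 0\<close> then says that the first component has zero derivative along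
      \<open>(0, h)\<close>.\<close>
    define m where "m = oct_cnj ((1 / (fst p \<bullet> fst p)) *\<^sub>R (h \<cdot> oct_cnj (fst p)))"
    have "lower m p = (0, h)"
      using nz by (simp add: lower_def m_def oct_mult.scaleR_left mult_cnj_mult_right)
    then have "lowering m Z p = dd (0, h) Z p - lower m (Z p)"
      by (simp add: lowering_def)
    then have "fst (dd (0, h) Z p) = 0"
      using low0[of m] by (simp add: lower_def prod_eq_iff)
    then show "dd (0, h) (\<lambda>p. fst (Z p)) p = 0"
      by (simp add: dd_fst[OF sZ])
  qed (intro smooth_intros sZ)+
  obtain b where b: "Hom2 n b" "Z = (\<lambda>p. rho_OH p (b p))"
    using exact_indep_snd[OF Suc.prems(1,2) indep] by blast
  have "IP n Z Z = 0"
    using Suc.prems(3)[OF b(1)] b(2) by simp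
  then show ?case using IP_eq_0 Suc.prems(1) by blast
qed

text \<open>Projection onto the finitely generated image leaves a remainder that is still tangent,
  because the image is; being orthogonal to the image, it vanishes.\<close>

theorem homogeneous_exact:
  assumes Z: "Hom n Z" "\<And>p. hopf_tangent p (Z p)"
  shows "\<exists>b. Hom2 n b \<and> Z = (\<lambda>p. rho_OH p (b p))"
proof -
  obtain G where G: "finite G" "\<forall>g\<in>G. Hom2 n g"
    "\<forall>f::octonion2 \<Rightarrow> octonion2. Hom2 n f \<longrightarrow> fspan G f"
    using Hom2_finitely_generated by blast
  let ?r = "\<lambda>b p. rho_OH p (b p)"
  have HG: "Hom n g" if "g \<in> ?r ` G" for g
    using that G(2) Hom_rho_OH by blast
  obtain h where h: "fspan (?r ` G) h" "\<forall>g\<in>?r ` G. IP n (\<lambda>p. Z p - h p) g = 0"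
    using IP_projection[of "?r ` G" n Z] HG G(1) Z(1) by blast
  have lift: "fspan (?r ` G) (?r b)" if "fspan G b" for b
    using that
  proof (induction rule: fspan.induct)
    case fspan_zero
    then show ?case by (simp add: linear_0[OF linear_rho_OH] fspan.fspan_zero)
  next
    case (fspan_step g h c)
    have "fspan (?r ` G) (\<lambda>p. c *\<^sub>R ?r g p + ?r h p)"
      using fspan_step by (intro fspan.fspan_step) auto
    then show ?case by (simp add: rho_OH_add rho_OH_scaleR)
  qed
  have "\<exists>b. fspan G b \<and> h = ?r b"
    using h(1)
  proof (induction rule: fspan.induct)
    case fspan_zero
    then show ?case
      by (intro exI[of _ "\<lambda>p. 0"]) (simp add: linear_0[OF linear_rho_OH] fspan.fspan_zero)
  next
    case (fspan_step g h c)
    then obtain b b' where b: "b \<in> G" "g = ?r b" "fspan G b'" "h = ?r b'" by blast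
    then show ?case
      by (intro exI[of _ "\<lambda>p. c *\<^sub>R b p + b' p"])
        (simp add: rho_OH_add rho_OH_scaleR fspan.fspan_step)
  qed
  then obtain b where b: "fspan G b" "h = ?r b" by blast
  have Hb: "Hom2 n b" using Hom2_fspan[OF b(1)] G(2) by blast
  have HZ: "Hom n (\<lambda>p. Z p - h p)"
    unfolding b(2) by (rule Hom_diff[OF Z(1) Hom_rho_OH[OF Hb]])
  have "(\<lambda>p. Z p - h p) = (\<lambda>p. 0)"
  proof (rule orthogonal_to_image_eq_0[OF HZ])
    show "hopf_tangent p (Z p - h p)" for p
      unfolding b(2) by (rule hopf_tangent_diff[OF Z(2) hopf_tangent_rho_OH])
    show "IP n (\<lambda>p. Z p - h p) (?r b') = 0" if "Hom2 n b'" for b'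
      using IP_fspan[OF lift, of b' "\<lambda>p. Z p - h p" n] G(3) that HG h(2) Hom_smooth[OF HZ] by blast
    show "snd_degree n (\<lambda>p. fst (Z p - h p))"
      by (rule snd_degree_Hom[OF Hom_linear_comp[OF HZ bounded_linear_fst]])
  qed
  then have "Z = ?r b"
    unfolding b(2) by (metis (no_types, lifting) ext eq_iff_diff_eq_0)
  then show ?thesis using Hb by blast
qed

section \<open>Series of smooth maps\<close>

primrec dl :: "'a::real_normed_vector list \<Rightarrow> ('a \<Rightarrow> 'b::real_normed_vector) \<Rightarrow> 'a \<Rightarrow> 'b" where
  "dl [] f = f"
| "dl (v # vs) f = dl vs (dd v f)"

lemma dl_add: "smooth f \<Longrightarrow> smooth g \<Longrightarrow> dl vs (\<lambda>p. f p + g p) = (\<lambda>p. dl vs f p + dl vs g p)"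
  by (induction vs arbitrary: f g) (auto simp: dd_add smooth_dd)

lemma dl_scaleR: "smooth f \<Longrightarrow> dl vs (\<lambda>p. c *\<^sub>R f p) = (\<lambda>p. c *\<^sub>R dl vs f p)"
  by (induction vs arbitrary: f) (auto simp: dd_scaleR_const smooth_dd)

lemma dl_zero [simp]: "dl vs (\<lambda>p. 0) = (\<lambda>p. 0)"
  by (induction vs) auto

lemma dl_sum:
  "(\<And>i. i \<in> I \<Longrightarrow> smooth (f i)) \<Longrightarrow> dl vs (\<lambda>p. \<Sum>i\<in>I. f i p) = (\<lambda>p. \<Sum>i\<in>I. dl vs (f i) p)"
  by (induction I rule: infinite_finite_induct) (auto simp: dl_add smooth_sum)

lemma dl_comp_scaleR:
  assumes "smooth f"
  shows "dl vs (\<lambda>p. f (r *\<^sub>R p)) = (\<lambda>p. r ^ length vs *\<^sub>R dl vs f (r *\<^sub>R p))"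
  using assms
proof (induction vs arbitrary: f)
  case (Cons v vs)
  have "dd v (\<lambda>p. f (r *\<^sub>R p)) = (\<lambda>p. r *\<^sub>R dd v f (r *\<^sub>R p))"
    unfolding dd_comp_linear[OF Cons.prems bounded_linear_scaleR_right]
    by (simp add: linear_scale[OF linear_dd[OF Cons.prems]])
  then have "dl (v # vs) (\<lambda>p. f (r *\<^sub>R p)) = dl vs (\<lambda>p. r *\<^sub>R dd v f (r *\<^sub>R p))"
    by simp
  also have "\<dots> = (\<lambda>p. r *\<^sub>R dl vs (\<lambda>p. dd v f (r *\<^sub>R p)) p)"
    by (rule dl_scaleR[OF smooth_comp_linear[OF smooth_dd[OF Cons.prems] bounded_linear_scaleR_right]])
  also have "\<dots> = (\<lambda>p. r ^ length (v # vs) *\<^sub>R dl (v # vs) f (r *\<^sub>R p))"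
    unfolding Cons.IH[OF smooth_dd[OF Cons.prems]] by simp
  finally show ?case .
qed simp

text \<open>A Weierstrass majorant is required for each iterated partial derivative separately. The
  condition thus passes to derivatives, and smoothness of the sum follows by coinduction.\<close>

definition series_smooth :: "(nat \<Rightarrow> 'a::euclidean_space \<Rightarrow> 'b::euclidean_space) \<Rightarrow> bool" where
  "series_smooth t \<longleftrightarrow> (\<forall>k. smooth (t k)) \<and>
     (\<forall>vs. set vs \<subseteq> Basis \<longrightarrow> (\<exists>M. summable M \<and> (\<forall>k p. norm (dl vs (t k) p) \<le> M k)))"

lemma series_smooth_smooth: "series_smooth t \<Longrightarrow> smooth (t k)"
  by (simp add: series_smooth_def)

lemma series_smooth_bound:
  assumes "series_smooth t" "set vs \<subseteq> Basis"
  obtains M where "summable M" "\<And>k p. norm (dl vs (t k) p) \<le> M k"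
  using assms unfolding series_smooth_def by blast

lemma series_smooth_dd:
  assumes t: "series_smooth t"
  shows "series_smooth (\<lambda>k. dd v (t k))"
  unfolding series_smooth_def
proof (intro conjI allI impI)
  fix k show "smooth (dd v (t k))"
    by (rule smooth_dd[OF series_smooth_smooth[OF t]])
next
  fix vs :: "'a list" assume vs: "set vs \<subseteq> Basis"
  have "\<forall>i\<in>Basis. \<exists>M. summable M \<and> (\<forall>k p. norm (dl (i # vs) (t k) p) \<le> M k)"
    using t vs unfolding series_smooth_def by (metis insert_subset list.simps(15))
  then obtain M where M: "\<forall>i\<in>Basis. summable (M i) \<and> (\<forall>k p. norm (dl (i # vs) (t k) p) \<le> M i k)"
    by (rule bchoice[THEN exE])
  have "norm (dl vs (dd v (t k)) p) \<le> (\<Sum>i\<in>Basis. \<bar>v \<bullet> i\<bar> * M i k)" for k p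
  proof -
    note sm = series_smooth_smooth[OF t, of k]
    have "dd v (t k) = (\<lambda>p. \<Sum>i\<in>Basis. (v \<bullet> i) *\<^sub>R dd i (t k) p)"
      by (rule ext, rule dd_eq_sum_Basis[OF sm])
    then have "dl vs (dd v (t k)) p = (\<Sum>i\<in>Basis. (v \<bullet> i) *\<^sub>R dl (i # vs) (t k) p)"
      using dl_sum[of Basis "\<lambda>i p. (v \<bullet> i) *\<^sub>R dd i (t k) p" vs]
      by (simp add: smooth_scaleR_const smooth_dd sm dl_scaleR)
    also have "norm \<dots> \<le> (\<Sum>i\<in>Basis. \<bar>v \<bullet> i\<bar> * M i k)"
      by (rule sum_norm_le) (use M in \<open>auto intro!: mult_left_mono\<close>)
    finally show ?thesis .
  qed
  moreover have "summable (\<lambda>k. \<Sum>i\<in>Basis. \<bar>v \<bullet> i\<bar> * M i k)"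
    using M by (intro summable_sum summable_mult) auto
  ultimately show "\<exists>M. summable M \<and> (\<forall>k p. norm (dl vs (dd v (t k)) p) \<le> M k)"
    by blast
qed

lemma series_smooth_summable:
  assumes "series_smooth t"
  shows "summable (\<lambda>k. t k p)"
proof -
  obtain M where M: "summable M" "\<And>k p. norm (dl [] (t k) p) \<le> M k"
    using series_smooth_bound[OF assms, of "[]"] by auto
  show ?thesis
    by (rule summable_comparison_test'[OF M(1), of 0]) (use M(2) in simp)
qed

lemma has_derivative_series_smooth:
  assumes t: "series_smooth t"
  shows "((\<lambda>p. \<Sum>k. t k p) has_derivative (\<lambda>v. \<Sum>k. dd v (t k) x)) (at x)"
proof -
  have ul: "uniform_limit UNIV (\<lambda>n x. \<Sum>k<n. dd i (t k) x) (\<lambda>x. \<Sum>k. dd i (t k) x) sequentially"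
    if i: "i \<in> Basis" for i
  proof -
    obtain M where M: "summable M" "\<And>k p. norm (dl [i] (t k) p) \<le> M k"
      using series_smooth_bound[OF t, of "[i]"] i by auto
    then show ?thesis by (intro Weierstrass_m_test[of UNIV _ M]) auto
  qed
  have sm: "smooth (t k)" for k by (rule series_smooth_smooth[OF t])
  have sd: "summable (\<lambda>k. dd v (t k) x)" for v x
    by (rule series_smooth_summable[OF series_smooth_dd[OF t]])
  have split: "(\<Sum>k. dd v (t k) x) = (\<Sum>i\<in>Basis. (v \<bullet> i) *\<^sub>R (\<Sum>k. dd i (t k) x))" for v x
  proof -
    have "(\<Sum>k. dd v (t k) x) = (\<Sum>k. \<Sum>i\<in>Basis. (v \<bullet> i) *\<^sub>R dd i (t k) x)"
      by (rule arg_cong[where f=suminf], rule ext, rule dd_eq_sum_Basis[OF sm])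
    also have "\<dots> = (\<Sum>i\<in>Basis. \<Sum>k. (v \<bullet> i) *\<^sub>R dd i (t k) x)"
      by (rule suminf_sum) (intro summable_scaleR_right sd)
    also have "\<dots> = (\<Sum>i\<in>Basis. (v \<bullet> i) *\<^sub>R (\<Sum>k. dd i (t k) x))"
      by (intro sum.cong refl suminf_scaleR_right[symmetric] sd)
    finally show ?thesis .
  qed
  have "\<exists>g. \<forall>x\<in>UNIV. (\<lambda>n. t n x) sums (g x) \<and> (g has_derivative (\<lambda>v. \<Sum>k. dd v (t k) x)) (at x within UNIV)"
  proof (rule has_derivative_series[where f'="\<lambda>k x v. dd v (t k) x"])
    show "(t n has_derivative (\<lambda>v. dd v (t n) x)) (at x within UNIV)" for n x
      using has_derivative_dd[OF sm] by simp
    show "(\<lambda>n. t n 0) sums (\<Sum>n. t n 0)"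
      by (rule summable_sums[OF series_smooth_summable[OF t]])
  next
    fix e :: real assume e: "e > 0"
    \<comment> \<open>The error below is a sum over the basis directions, each contributing at most
      \<open>norm h * d\<close>.\<close>
    define d where "d = e / real DIM('a)"
    have d: "d > 0" using e by (simp add: d_def)
    have "\<forall>\<^sub>F n in sequentially. \<forall>i\<in>Basis. \<forall>x\<in>UNIV. dist (\<Sum>k<n. dd i (t k) x) (\<Sum>k. dd i (t k) x) < d"
      using uniform_limitD[OF ul d] by (intro eventually_ball_finite) auto
    then show "\<forall>\<^sub>F n in sequentially. \<forall>x\<in>UNIV. \<forall>h.
        norm ((\<Sum>i<n. dd h (t i) x) - (\<Sum>k. dd h (t k) x)) \<le> e * norm h"
    proof (rule eventually_mono, intro ballI allI)
      fix n x h
      assume n: "\<forall>i\<in>Basis. \<forall>x\<in>UNIV. dist (\<Sum>k<n. dd i (t k) x) (\<Sum>k. dd i (t k) x) < d"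
      have "(\<Sum>j<n. dd h (t j) x) = (\<Sum>j<n. \<Sum>i\<in>Basis. (h \<bullet> i) *\<^sub>R dd i (t j) x)"
        by (rule sum.cong[OF refl], rule dd_eq_sum_Basis[OF sm])
      also have "\<dots> = (\<Sum>i\<in>Basis. (h \<bullet> i) *\<^sub>R (\<Sum>j<n. dd i (t j) x))"
        by (subst sum.swap) (simp add: scaleR_sum_right)
      finally have "(\<Sum>j<n. dd h (t j) x) - (\<Sum>k. dd h (t k) x)
        = (\<Sum>i\<in>Basis. (h \<bullet> i) *\<^sub>R ((\<Sum>j<n. dd i (t j) x) - (\<Sum>k. dd i (t k) x)))"
        unfolding split[of h] by (simp add: scaleR_diff_right sum_subtractf)
      also have "norm \<dots> \<le> (\<Sum>i\<in>(Basis::'a set). norm h * d)"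
      proof (rule sum_norm_le)
        fix i :: 'a assume i: "i \<in> Basis"
        show "norm ((h \<bullet> i) *\<^sub>R ((\<Sum>j<n. dd i (t j) x) - (\<Sum>k. dd i (t k) x))) \<le> norm h * d"
          unfolding norm_scaleR real_norm_def
        proof (rule mult_mono)
          show "norm ((\<Sum>j<n. dd i (t j) x) - (\<Sum>k. dd i (t k) x)) \<le> d"
            using bspec[OF bspec[OF n i] UNIV_I, of x] unfolding dist_norm by (rule less_imp_le)
        qed (use Basis_le_norm[OF i, of h] in auto)
      qed
      also have "\<dots> = e * norm h" by (simp add: d_def)
      finally show "norm ((\<Sum>i<n. dd h (t i) x) - (\<Sum>k. dd h (t k) x)) \<le> e * norm h" .
    qed
  qed auto
  then obtain g where g: "\<And>x. (\<lambda>n. t n x) sums (g x)"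
    "\<And>x. (g has_derivative (\<lambda>v. \<Sum>k. dd v (t k) x)) (at x)" by auto
  have "g = (\<lambda>p. \<Sum>k. t k p)"
    by (rule ext, rule sums_unique[OF g(1)])
  then show ?thesis using g(2)[of x] by (simp only:)
qed

lemma dd_series_smooth: "series_smooth t \<Longrightarrow> dd v (\<lambda>p. \<Sum>k. t k p) = (\<lambda>p. \<Sum>k. dd v (t k) p)"
  by (rule ext, rule dd_eq[OF has_derivative_series_smooth])

lemma smooth_series_smooth:
  assumes "series_smooth t"
  shows "smooth (\<lambda>p. \<Sum>k. t k p)"
proof (rule smooth_coinduct[where P="\<lambda>f. \<exists>t. series_smooth t \<and> f = (\<lambda>p. \<Sum>k. t k p)"])
  show "\<exists>t'. series_smooth t' \<and> (\<lambda>p. \<Sum>k. t k p) = (\<lambda>p. \<Sum>k. t' k p)"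
    using assms by blast
next
  fix f :: "'a \<Rightarrow> 'b" and x assume "\<exists>t. series_smooth t \<and> f = (\<lambda>p. \<Sum>k. t k p)"
  then show "f differentiable at x"
    using has_derivative_series_smooth unfolding differentiable_def by blast
next
  fix f :: "'a \<Rightarrow> 'b" and v assume "\<exists>t. series_smooth t \<and> f = (\<lambda>p. \<Sum>k. t k p)"
  then obtain t where t: "series_smooth t" "f = (\<lambda>p. \<Sum>k. t k p)" by blast
  show "\<exists>t. series_smooth t \<and> dd v f = (\<lambda>p. \<Sum>k. t k p)"
    unfolding t(2) dd_series_smooth[OF t(1)] using series_smooth_dd[OF t(1), of v] by blast
qed

lemma van_series_smooth:
  "series_smooth t \<Longrightarrow> (\<And>k. van n (t k)) \<Longrightarrow> van n (\<lambda>p. \<Sum>k. t k p)"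
proof (induction n arbitrary: t)
  case (Suc n)
  have "van n (dd i (\<lambda>p. \<Sum>k. t k p))" for i
    unfolding dd_series_smooth[OF Suc.prems(1)]
    by (rule Suc.IH[OF series_smooth_dd[OF Suc.prems(1)] van_dd[OF series_smooth_smooth[OF Suc.prems(1)] Suc.prems(2)]])
  then show ?case using Suc.prems(2) by simp
qed simp

lemma series_smooth_shift:
  assumes "series_smooth t"
  shows "series_smooth (\<lambda>k. t (k + N))"
  unfolding series_smooth_def
proof (intro conjI allI impI)
  fix vs :: "'a list" assume "set vs \<subseteq> Basis"
  then obtain M where "summable M" "\<And>k p. norm (dl vs (t k) p) \<le> M k"
    using series_smooth_bound[OF assms] by blast
  then show "\<exists>M. summable M \<and> (\<forall>k p. norm (dl vs (t (k + N)) p) \<le> M k)"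
    by (intro exI[of _ "\<lambda>k. M (k + N)"]) (auto simp: summable_iff_shift)
qed (rule series_smooth_smooth[OF assms])

section \<open>Gaussian cut-offs\<close>

text \<open>The bound \<open>n ^ n\<close> comes from (1 + s / n)^n \<le> exp s with
  \<open>s = r\<^sup>2\<close>; the summand 1 covers \<open>r \<le> 1\<close> and
  \<open>n = 0\<close>.\<close>

lemma power_mult_exp_le:
  fixes r :: real
  assumes "r \<ge> 0"
  shows "r ^ n * exp (- (r\<^sup>2)) \<le> 1 + real n ^ n"
proof (cases "r \<le> 1 \<or> n = 0")
  case True
  then have "r ^ n \<le> 1"
    using assms by (auto simp: power_le_one)
  then have "r ^ n * exp (- (r\<^sup>2)) \<le> 1 * 1"
    by (rule mult_mono) auto
  then show ?thesis by (simp add: add_increasing2)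
next
  case False
  then have n: "n > 0" and r: "r > 1" by auto
  have "r ^ n \<le> (r\<^sup>2) ^ n"
    using r by (intro power_mono) (auto simp: power2_eq_square)
  also have "\<dots> = real n ^ n * (r\<^sup>2 / real n) ^ n"
    using n by (simp add: power_divide)
  also have "\<dots> \<le> real n ^ n * (1 + r\<^sup>2 / real n) ^ n"
    by (intro mult_left_mono power_mono) auto
  also have "\<dots> \<le> real n ^ n * exp (r\<^sup>2)"
  proof (rule mult_left_mono[OF exp_ge_one_plus_x_over_n_power_n])
    show "- real n \<le> r\<^sup>2" by (rule order_trans[of _ 0]) auto
  qed (use n in auto)
  finally have "r ^ n * exp (- (r\<^sup>2)) \<le> real n ^ n * exp (r\<^sup>2) * exp (- (r\<^sup>2))"
    by (rule mult_right_mono) simp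
  also have "\<dots> = real n ^ n"
    by (simp only: mult.assoc exp_add[symmetric]) simp
  finally show ?thesis by simp
qed

text \<open>A Gaussian replaces a bump function as cut-off: only global bounds on derivatives are
  needed, and sums of Gaussians times homogeneous polynomials are closed under
  differentiation.\<close>

definition gauss :: "('a::real_inner \<Rightarrow> 'b::real_vector) \<Rightarrow> 'a \<Rightarrow> 'b" where
  "gauss f p = exp (- (p \<bullet> p)) *\<^sub>R f p"

lemma smooth_exp_neg_inner: "smooth (\<lambda>p::'a::real_inner. exp (- (c * (p \<bullet> p))))"
  by (intro smooth_exp_comp smooth_minus smooth_bilinear[OF bounded_bilinear_mult] smooth_inner
      smooth_const smooth_ident)

lemma smooth_gauss: "smooth f \<Longrightarrow> smooth (gauss f)"
  unfolding gauss_def using smooth_scaleR[OF smooth_exp_neg_inner[of 1]] by simp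

lemma dd_gauss:
  assumes "smooth f"
  shows "dd v (gauss f) = (\<lambda>p. gauss (dd v f) p + gauss (\<lambda>p. (- 2 * (p \<bullet> v)) *\<^sub>R f p) p)"
proof -
  have q: "smooth (\<lambda>p::'a. - (p \<bullet> p))"
    by (intro smooth_minus smooth_inner smooth_ident)
  have dq: "dd v (\<lambda>p::'a. - (p \<bullet> p)) = (\<lambda>p. - 2 * (p \<bullet> v))"
    by (simp add: dd_minus smooth_inner dd_inner inner_commute)
  show ?thesis
    unfolding gauss_def dd_scaleR[OF smooth_exp_comp[OF q] assms] dd_exp_comp[OF q] dq
    by (simp add: scaleR_diff_right)
qed

lemma gauss_bounded:
  fixes f :: "'a::euclidean_space \<Rightarrow> 'b::euclidean_space"
  assumes "Hom n f"
  shows "\<exists>C. \<forall>p. norm (gauss f p) \<le> C"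
proof -
  obtain C where C: "\<And>p. norm p \<le> 1 \<Longrightarrow> norm (f p) \<le> C"
    using van_bound[OF Hom_smooth[OF assms], of 0] by auto
  have C0: "C \<ge> 0" using C[of 0] norm_ge_zero[of "f 0"] by (simp del: norm_ge_zero)
  have "norm (gauss f p) \<le> C * (1 + real n ^ n)" for p
  proof -
    \<comment> \<open>Rescaling to the unit sphere. At \<open>p = 0\<close> the quotient is 0 and
      the identity still is an instance of homogeneity.\<close>
    have "f p = norm p ^ n *\<^sub>R f ((1 / norm p) *\<^sub>R p)"
      using Hom_scaled[OF assms, of "norm p" "(1 / norm p) *\<^sub>R p"] by (cases "p = 0") auto
    from arg_cong[OF this, of norm] have "norm (f p) = norm p ^ n * norm (f ((1 / norm p) *\<^sub>R p))"
      by (simp only: norm_scaleR norm_power real_norm_def abs_norm_cancel power_abs)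
    also have "\<dots> \<le> norm p ^ n * C"
      by (intro mult_left_mono C) auto
    finally have fp: "norm (f p) \<le> norm p ^ n * C" .
    have "norm (gauss f p) = norm (f p) * exp (- ((norm p)\<^sup>2))"
      by (simp add: gauss_def dot_square_norm)
    also have "\<dots> \<le> norm p ^ n * C * exp (- ((norm p)\<^sup>2))"
      by (rule mult_right_mono[OF fp]) simp
    also have "\<dots> = C * (norm p ^ n * exp (- ((norm p)\<^sup>2)))" by simp
    also have "\<dots> \<le> C * (1 + real n ^ n)"
      by (rule mult_left_mono[OF power_mult_exp_le C0]) simp
    finally show ?thesis .
  qed
  then show ?thesis by blast
qed

lemma dl_gauss_bounded:
  fixes f :: "'a::euclidean_space \<Rightarrow> 'b::euclidean_space"
  assumes "Hom n f"
  shows "\<exists>C. \<forall>p. norm (dl vs (gauss f) p) \<le> C"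
  using assms
proof (induction vs arbitrary: n f)
  case Nil
  then show ?case using gauss_bounded by simp
next
  case (Cons v vs)
  have sm: "smooth f" using Cons.prems Hom_smooth by blast
  have sm2: "smooth (\<lambda>p. (- 2 * (p \<bullet> v)) *\<^sub>R f p)"
    by (intro smooth_scaleR smooth_bilinear[OF bounded_bilinear_mult] smooth_inner smooth_const smooth_ident sm)
  have "\<exists>m. Hom m (dd v f)"
  proof (cases n)
    case 0
    then show ?thesis using Hom_zero_dd[of f v] Cons.prems by (intro exI[of _ 0]) simp
  next
    case (Suc m)
    then show ?thesis using Hom_dd Cons.prems by blast
  qed
  then obtain C1 where C1: "\<And>p. norm (dl vs (gauss (dd v f)) p) \<le> C1"
    using Cons.IH by blast
  have "Hom (Suc n) (\<lambda>p. (- 2 * (p \<bullet> v)) *\<^sub>R f p)"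
    using sm2 Cons.prems by (simp add: Hom_def)
  then obtain C2 where C2: "\<And>p. norm (dl vs (gauss (\<lambda>p. (- 2 * (p \<bullet> v)) *\<^sub>R f p)) p) \<le> C2"
    using Cons.IH by blast
  have "dl (v # vs) (gauss f) = (\<lambda>p. dl vs (gauss (dd v f)) p
      + dl vs (gauss (\<lambda>p. (- 2 * (p \<bullet> v)) *\<^sub>R f p)) p)"
    unfolding dl.simps dd_gauss[OF sm]
    by (rule dl_add[OF smooth_gauss[OF smooth_dd[OF sm]] smooth_gauss[OF sm2]])
  then have "norm (dl (v # vs) (gauss f) p) \<le> C1 + C2" for p
    by (simp only: norm_triangle_mono[OF C1 C2])
  then show ?case by blast
qed

text \<open>The Leibniz rule lowers one of the two orders by one. An order that is already 0 cannot
  drop, and then the other factor alone supplies all the vanishing.\<close>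

lemma van_bilinear_add:
  assumes B: "bounded_bilinear B"
  shows "smooth f \<Longrightarrow> smooth g \<Longrightarrow> van m f \<Longrightarrow> van n g \<Longrightarrow> m + n = N \<Longrightarrow>
    van N (\<lambda>p. B (f p) (g p))"
proof (induction N arbitrary: m n f g)
  case (Suc N)
  note IH = Suc.IH and f = Suc.prems(1) and g = Suc.prems(2)
    and vf = Suc.prems(3) and vg = Suc.prems(4) and mn = Suc.prems(5)
  have "van N (dd i (\<lambda>p. B (f p) (g p)))" for i
    unfolding dd_bilinear[OF B f g]
  proof (intro van_add smooth_bilinear[OF B] smooth_dd f g)
    show "van N (\<lambda>p. B (f p) (dd i g p))"
    proof (cases n)
      case 0
      then have "van (Suc N) f" using vf mn by (simp del: van.simps)
      then have "van N f" by (rule van_Suc_D)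
      then show ?thesis by (rule IH[OF f smooth_dd[OF g] _ van.simps(1)[THEN iffD2, OF TrueI]]) simp
    next
      case (Suc n')
      then show ?thesis
        using vg mn by (intro IH[OF f smooth_dd[OF g] vf van_dd[OF g]]) (simp_all only: add_Suc_right nat.inject)
    qed
    show "van N (\<lambda>p. B (dd i f p) (g p))"
    proof (cases m)
      case 0
      then have "van (Suc N) g" using vg mn by (simp del: van.simps)
      then have "van N g" by (rule van_Suc_D)
      then show ?thesis by (rule IH[OF smooth_dd[OF f] g van.simps(1)[THEN iffD2, OF TrueI]]) simp
    next
      case (Suc m')
      then show ?thesis
        using vf mn by (intro IH[OF smooth_dd[OF f] g van_dd[OF f] vg]) (simp_all only: add_Suc nat.inject)
    qed
  qed
  moreover have "f 0 = 0 \<or> g 0 = 0"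
    using vf vg mn by (cases m; cases n) auto
  then have "B (f 0) (g 0) = 0"
    using bounded_bilinear.zero_left[OF B] bounded_bilinear.zero_right[OF B] by auto
  ultimately show ?case by simp
qed simp

lemma Hom_van: "Hom n f \<Longrightarrow> van n f"
proof (induction n arbitrary: f)
  case (Suc n)
  then show ?case using Hom_scaled[OF Suc.prems, of 0 0] Hom_dd by auto
qed simp

lemma Hom_van_eq_0:
  assumes "Hom n f" "van (Suc n) f"
  shows "f p = 0"
proof -
  obtain C where "\<And>p. norm p \<le> 1 \<Longrightarrow> norm (f p) \<le> C * norm p ^ Suc n"
    using van_bound[OF Hom_smooth[OF assms(1)] assms(2)] by blast
  then show ?thesis by (rule Hom_eq_0[OF assms(1)])
qed

text \<open>By homogeneity \<open>gauss b (r p) / r ^ k = exp (- r\<^sup>2 \<bar>p\<bar>\<^sup>2) b p\<close>, so for large \<open>r\<close> all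
  derivatives of order below \<open>k\<close> are uniformly small while the leading term at \<open>0\<close> is kept.\<close>

lemma small_realization:
  fixes b :: "'a::euclidean_space \<Rightarrow> 'b::euclidean_space"
  assumes b: "Hom k b"
  shows "\<exists>t. smooth t \<and> van k t \<and> van (Suc k) (\<lambda>p. b p - t p) \<and>
    (\<forall>vs. \<exists>C. \<forall>p. norm (dl vs t p) \<le> C) \<and>
    (\<forall>vs. set vs \<subseteq> Basis \<and> length vs < k \<longrightarrow> (\<forall>p. norm (dl vs t p) \<le> (1 / 2) ^ k))"
proof -
  have sb: "smooth b" using b Hom_smooth by blast
  have "\<forall>vs. \<exists>C. \<forall>p. norm (dl vs (gauss b) p) \<le> C"
    using dl_gauss_bounded[OF b] by blast
  then obtain C where C: "\<And>vs p. norm (dl vs (gauss b) p) \<le> C vs" by metis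
  have C0: "C vs \<ge> 0" for vs using C[of vs 0] norm_ge_zero order_trans by blast
  define L where "L = {vs::'a list. set vs \<subseteq> Basis \<and> length vs \<le> k}"
  have L: "finite L" unfolding L_def by (rule finite_lists_length_le) simp
  \<comment> \<open>Below order \<open>k\<close> the rescaling gains a factor of at least
    \<open>1 / r\<close>. This \<open>r\<close> makes that factor beat the constants of all lists in
    \<open>L\<close> at once, with \<open>(1 / 2) ^ k\<close> left over.\<close>
  define r where "r = 2 ^ k * (1 + sum C L)"
  have sC: "sum C L \<ge> 0" by (intro sum_nonneg C0)
  have r1: "r \<ge> 1"
    unfolding r_def using mult_mono[of 1 "2 ^ k" 1 "1 + sum C L"] sC by simp
  define t where "t = (\<lambda>p. (1 / r ^ k) *\<^sub>R gauss b (r *\<^sub>R p))"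
  have t: "t = (\<lambda>p. exp (- (r\<^sup>2 * (p \<bullet> p))) *\<^sub>R b p)"
    using r1 by (simp add: t_def gauss_def Hom_scaled[OF b] power2_eq_square mult.assoc fun_eq_iff)
  have sg: "smooth (\<lambda>p. gauss b (r *\<^sub>R p))"
    by (rule smooth_comp_linear[OF smooth_gauss[OF sb] bounded_linear_scaleR_right])
  have dlt: "dl vs t p = (r ^ length vs / r ^ k) *\<^sub>R dl vs (gauss b) (r *\<^sub>R p)" for vs p
    unfolding t_def dl_scaleR[OF sg] dl_comp_scaleR[OF smooth_gauss[OF sb]] by simp
  have "smooth t" unfolding t_def by (rule smooth_scaleR_const[OF sg])
  moreover have se: "smooth (\<lambda>p::'a. exp (- (r\<^sup>2 * (p \<bullet> p))))" by (rule smooth_exp_neg_inner)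
  then have "van k t" unfolding t by (rule van_bilinear[OF bounded_bilinear_scaleR _ sb Hom_van[OF b]])
  moreover have "van (Suc k) (\<lambda>p. b p - t p)"
  proof -
    have s1: "smooth (\<lambda>p::'a. 1 - exp (- (r\<^sup>2 * (p \<bullet> p))))" by (intro smooth_diff smooth_const se)
    \<comment> \<open>The factor 1 - exp vanishes at the origin, which gives the one extra
      order.\<close>
    have "van (Suc k) (\<lambda>p. (1 - exp (- (r\<^sup>2 * (p \<bullet> p)))) *\<^sub>R b p)"
      by (rule van_bilinear_add[OF bounded_bilinear_scaleR s1 sb _ Hom_van[OF b], of 1]) auto
    then show ?thesis by (simp add: t scaleR_diff_left)
  qed
  moreover have "\<exists>C. \<forall>p. norm (dl vs t p) \<le> C" for vs
  proof (intro exI allI)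
    fix p show "norm (dl vs t p) \<le> (r ^ length vs / r ^ k) * C vs"
      unfolding dlt using r1 C by (simp add: mult_left_mono divide_right_mono)
  qed
  moreover have "norm (dl vs t p) \<le> (1 / 2) ^ k" if vs: "set vs \<subseteq> Basis" "length vs < k" for vs p
  proof -
    have "r ^ length vs * r \<le> r ^ k"
      using r1 vs(2) power_increasing[of "Suc (length vs)" k r] by (simp add: mult.commute)
    then have le: "r ^ length vs / r ^ k \<le> 1 / r"
      using r1 by (simp add: field_simps)
    have "norm (dl vs t p) \<le> (1 / r) * C vs"
      unfolding dlt norm_scaleR using r1 le by (intro mult_mono C) auto
    also have "\<dots> \<le> (1 / r) * (1 + sum C L)"
      using r1 L C0 vs member_le_sum[of vs L C]
      by (intro mult_left_mono) (auto simp: L_def intro: order_trans)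
    also have "\<dots> = (1 / 2) ^ k"
      using sC by (simp add: r_def power_divide field_simps add_nonneg_eq_0_iff)
    finally show ?thesis .
  qed
  ultimately show ?thesis by blast
qed

section \<open>Every tangent vector field is in the image\<close>

text \<open>The tangency conditions as the kernel of one bilinear map, so that leading terms can be
  compared by the product rule for vanishing orders.\<close>

definition hopf_map :: "octonion2 \<Rightarrow> octonion2 \<Rightarrow> real \<times> real \<times> octonion" where
  "hopf_map p w = (fst p \<bullet> fst w, snd p \<bullet> snd w,
     snd w \<cdot> oct_cnj (fst p) + snd p \<cdot> oct_cnj (fst w))"

lemma hopf_tangent_iff: "hopf_tangent p w \<longleftrightarrow> hopf_map p w = 0"
  by (simp add: hopf_tangent_def hopf_map_def zero_prod_def)

lemma bounded_bilinear_hopf_map: "bounded_bilinear hopf_map"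
proof -
  have "bilinear hopf_map"
    unfolding bilinear_def
    by (auto intro!: linearI simp: hopf_map_def inner_add_left inner_add_right oct_cnj_add oct_cnj_scaleR
        oct_mult.add_left oct_mult.add_right oct_mult.scaleR_left oct_mult.scaleR_right algebra_simps)
  then show ?thesis using bilinear_conv_bounded_bilinear by blast
qed

text \<open>The map \<open>?F\<close> is homogeneous of degree \<open>n + 1\<close>, but since
  \<open>Y\<close> is tangent it equals minus the value on the remainder
  \<open>Y p - hc n Y p\<close>, which vanishes to order \<open>n + 2\<close>. So it is
  zero.\<close>

lemma hopf_tangent_hc:
  assumes Y: "smooth Y" "\<And>p. hopf_tangent p (Y p)" "van n Y"
  shows "hopf_tangent p (hc n Y p)"
proof -
  interpret hm: bounded_bilinear hopf_map by (rule bounded_bilinear_hopf_map)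
  let ?F = "\<lambda>p. hopf_map p (hc n Y p)"
  have "Hom (Suc n) ?F"
    unfolding Hom_def
    using smooth_bilinear[OF bounded_bilinear_hopf_map smooth_ident smooth_hc]
    by (simp add: hm.scaleR_left hm.scaleR_right Hom_scaled[OF hc_Hom])
  moreover have "van (Suc (Suc n)) ?F"
  proof -
    have "van (Suc (Suc n)) (\<lambda>p. hopf_map p (Y p - hc n Y p))"
      by (rule van_bilinear_add[OF bounded_bilinear_hopf_map smooth_ident
            smooth_diff[OF Y(1) smooth_hc] _ van_minus_hc[OF Y(1,3)], of 1]) auto
    then have "van (Suc (Suc n)) (\<lambda>p. (- 1) *\<^sub>R hopf_map p (Y p - hc n Y p))"
      by (rule van_linear_comp[OF bounded_linear_scaleR_right, rotated])
        (intro smooth_bilinear[OF bounded_bilinear_hopf_map] smooth_diff smooth_ident smooth_hc Y(1))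
    moreover have "(\<lambda>p. (- 1) *\<^sub>R hopf_map p (Y p - hc n Y p)) = ?F"
      using Y(2) by (simp add: hm.diff_right hopf_tangent_iff)
    ultimately show ?thesis by (simp only:)
  qed
  ultimately have "?F p = 0" by (rule Hom_van_eq_0)
  then show ?thesis by (simp only: hopf_tangent_iff)
qed

text \<open>The two extra orders come from the quadratic dependence of the bundle map on
  \<open>p\<close>.\<close>

lemma van_rho_OH:
  assumes a: "smooth a" "van n a"
  shows "van (Suc (Suc n)) (\<lambda>p. rho_OH p (a p))"
proof -
  note sm = smooth_fst[OF smooth_ident] smooth_snd[OF smooth_ident] smooth_fst[OF a(1)] smooth_snd[OF a(1)]
    smooth_oct_cnj smooth_inner smooth_oct_mult smooth_scaleR smooth_ident a(1)
  have v1: "van 1 (\<lambda>p::octonion2. fst p)" "van 1 (\<lambda>p::octonion2. snd p)" "van 1 (\<lambda>p::octonion2. p)"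
    "van 1 (\<lambda>p::octonion2. oct_cnj (fst p))" "van 1 (\<lambda>p::octonion2. oct_cnj (snd p))"
    by simp_all
  have va: "van n (\<lambda>p. fst (a p))" "van n (\<lambda>p. snd (a p))"
    by (rule van_linear_comp[OF _ a], intro bounded_linear_fst bounded_linear_snd)+
  have v2: "van 2 (\<lambda>p::octonion2. fst p \<bullet> fst p)" "van 2 (\<lambda>p::octonion2. snd p \<bullet> snd p)"
    "van 2 (\<lambda>p::octonion2. fst p \<cdot> oct_cnj (snd p))" "van 2 (\<lambda>p::octonion2. snd p \<cdot> oct_cnj (fst p))"
    by (rule van_bilinear_add[OF bounded_bilinear_inner _ _ v1(1) v1(1)]
        van_bilinear_add[OF bounded_bilinear_inner _ _ v1(2) v1(2)]
        van_bilinear_add[OF bounded_bilinear_oct_mult _ _ v1(1) v1(5)]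
        van_bilinear_add[OF bounded_bilinear_oct_mult _ _ v1(2) v1(4)]; (intro sm | simp))+
  have v3: "van (Suc n) (\<lambda>p. p \<bullet> a p)"
    by (rule van_bilinear_add[OF bounded_bilinear_inner _ _ v1(3) a(2)]) (intro sm | simp)+
  have t1: "van (Suc (Suc n)) (\<lambda>p. (fst p \<bullet> fst p) *\<^sub>R fst (a p))"
    by (rule van_bilinear_add[OF bounded_bilinear_scaleR _ _ v2(1) va(1)]) (intro sm | simp)+
  have t2: "van (Suc (Suc n)) (\<lambda>p. (snd p \<bullet> snd p) *\<^sub>R snd (a p))"
    by (rule van_bilinear_add[OF bounded_bilinear_scaleR _ _ v2(2) va(2)]) (intro sm | simp)+
  have t3: "van (Suc (Suc n)) (\<lambda>p. (fst p \<cdot> oct_cnj (snd p)) \<cdot> snd (a p))"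
    by (rule van_bilinear_add[OF bounded_bilinear_oct_mult _ _ v2(3) va(2)]) (intro sm | simp)+
  have t4: "van (Suc (Suc n)) (\<lambda>p. (snd p \<cdot> oct_cnj (fst p)) \<cdot> fst (a p))"
    by (rule van_bilinear_add[OF bounded_bilinear_oct_mult _ _ v2(4) va(1)]) (intro sm | simp)+
  have t5: "van (Suc (Suc n)) (\<lambda>p. (p \<bullet> a p) *\<^sub>R fst p)"
    by (rule van_bilinear_add[OF bounded_bilinear_scaleR _ _ v3 v1(1)]) (intro sm | simp)+
  have t6: "van (Suc (Suc n)) (\<lambda>p. (p \<bullet> a p) *\<^sub>R snd p)"
    by (rule van_bilinear_add[OF bounded_bilinear_scaleR _ _ v3 v1(2)]) (intro sm | simp)+
  have c: "van m (\<lambda>p. (f p, g p))" if "van m f" "van m g" "smooth f" "smooth g"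
    for m and f g :: "octonion2 \<Rightarrow> octonion"
    using that by (induction m arbitrary: f g) (auto simp: dd_Pair smooth_dd zero_prod_def)
  show ?thesis
    unfolding rho_OH_eq
    by (intro c van_diff van_add t1 t2 t3 t4 t5 t6 smooth_add smooth_diff sm)
qed

text \<open>The leading part, of degree \<open>k + 2\<close>, is the image of some \<open>b\<close>
  of degree \<open>k\<close>. Replacing \<open>b\<close> by its cut-off version \<open>t\<close>
  changes the image only in order \<open>k + 3\<close>.\<close>

lemma correction_step:
  assumes Y: "smooth Y" "\<And>p. hopf_tangent p (Y p)" "van (k + 2) Y"
  shows "\<exists>t. smooth t \<and> van k t \<and> (\<forall>vs. \<exists>C. \<forall>p. norm (dl vs t p) \<le> C) \<and>
    (\<forall>vs. set vs \<subseteq> Basis \<and> length vs < k \<longrightarrow> (\<forall>p. norm (dl vs t p) \<le> (1 / 2) ^ k)) \<and>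
    van (Suc k + 2) (\<lambda>p. Y p - rho_OH p (t p))"
proof -
  obtain b where "Hom2 (k + 2) b" and hY: "hc (k + 2) Y = (\<lambda>p. rho_OH p (b p))"
    using homogeneous_exact[OF hc_Hom hopf_tangent_hc[OF Y]] by blast
  then have b: "Hom k b" by simp
  have sb: "smooth b" using b Hom_smooth by blast
  obtain t where t: "smooth t" "van k t" "van (Suc k) (\<lambda>p. b p - t p)"
    "\<forall>vs. \<exists>C. \<forall>p. norm (dl vs t p) \<le> C"
    "\<forall>vs. set vs \<subseteq> Basis \<and> length vs < k \<longrightarrow> (\<forall>p. norm (dl vs t p) \<le> (1 / 2) ^ k)"
    using small_realization[OF b] by blast
  have "van (Suc k + 2) (\<lambda>p. (Y p - hc (k + 2) Y p) + rho_OH p (b p - t p))"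
    using van_minus_hc[OF Y(1,3)] van_rho_OH[OF smooth_diff[OF sb t(1)] t(3)]
    by (intro van_add smooth_diff Y(1) smooth_hc smooth_rho_OH sb t(1)) (simp_all del: van.simps hc.simps)
  moreover have "(\<lambda>p. (Y p - hc (k + 2) Y p) + rho_OH p (b p - t p)) = (\<lambda>p. Y p - rho_OH p (t p))"
    by (simp only: hY linear_diff[OF linear_rho_OH]) simp
  ultimately have "van (Suc k + 2) (\<lambda>p. Y p - rho_OH p (t p))" by (simp only:)
  then show ?thesis using t by blast
qed

text \<open>In degrees 0 and 1 \<open>Hom2\<close> contains only zero, so the first two homogeneous
  parts vanish. This starts the iteration of \<open>correction_step\<close>.\<close>

lemma van_2_hopf_tangent:
  assumes X: "smooth X" "\<And>p. hopf_tangent p (X p)"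
  shows "van 2 X"
proof -
  have step: "van (Suc n) X" if vn: "van n X" and n2: "n < 2" for n
  proof -
    obtain b where b: "Hom2 n b" "hc n X = (\<lambda>p. rho_OH p (b p))"
      using homogeneous_exact[OF hc_Hom hopf_tangent_hc[OF X vn]] by blast
    have "n = 0 \<or> n = Suc 0" using n2 by auto
    then have "b = (\<lambda>p. 0)" using b(1) by auto
    then have "hc n X = (\<lambda>p. 0)" by (simp add: b(2) linear_0[OF linear_rho_OH])
    then show ?thesis using van_minus_hc[OF X(1) vn] by (simp del: van.simps)
  qed
  have "van (Suc 0) X" by (rule step) auto
  then have "van (Suc (Suc 0)) X" by (rule step) auto
  then show ?thesis by (simp add: numeral_2_eq_2)
qed

theorem hopf_tangent_imp_rho_OH:
  assumes X: "smooth X" "\<And>p. hopf_tangent p (X p)"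
  shows "\<exists>a. smooth a \<and> X = (\<lambda>p. rho_OH p (a p))"
proof -
  define good where "good k Y \<longleftrightarrow> smooth Y \<and> (\<forall>p. hopf_tangent p (Y p)) \<and> van (k + 2) Y"
    for k :: nat and Y :: "octonion2 \<Rightarrow> octonion2"
  define small where "small k t \<longleftrightarrow> smooth t \<and> van k t \<and> (\<forall>vs. \<exists>C. \<forall>p. norm (dl vs t p) \<le> C) \<and>
    (\<forall>vs. set vs \<subseteq> Basis \<and> length vs < k \<longrightarrow> (\<forall>p. norm (dl vs t p) \<le> (1 / 2) ^ k))"
    for k :: nat and t :: "octonion2 \<Rightarrow> octonion2"
  have step: "\<exists>t. small k t \<and> good (Suc k) (\<lambda>p. Y p - rho_OH p (t p))" if gk: "good k Y" for k Y
  proof -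
    have Y: "smooth Y" "\<And>p. hopf_tangent p (Y p)" "van (k + 2) Y"
      using gk unfolding good_def by blast+
    obtain t where st: "small k t" and v: "van (Suc k + 2) (\<lambda>p. Y p - rho_OH p (t p))"
      using correction_step[OF Y] unfolding small_def by blast
    have "smooth t" using st unfolding small_def by blast
    then have "good (Suc k) (\<lambda>p. Y p - rho_OH p (t p))"
      unfolding good_def
      by (intro conjI allI smooth_diff[OF Y(1) smooth_rho_OH] hopf_tangent_diff[OF Y(2) hopf_tangent_rho_OH] v)
    then show ?thesis using st by blast
  qed
  \<comment> \<open>The chosen correction depends only on the index and the current remainder, so
    recursion on the remainder defines the whole sequence.\<close>
  define T where "T k Y = (SOME t. small k t \<and> good (Suc k) (\<lambda>p. Y p - rho_OH p (t p)))" for k Y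
  have T: "small k (T k Y)" "good (Suc k) (\<lambda>p. Y p - rho_OH p (T k Y p))" if "good k Y" for k Y
    using someI_ex[OF step[OF that]] unfolding T_def by blast+
  define Ys where "Ys = rec_nat X (\<lambda>k Y p. Y p - rho_OH p (T k Y p))"
  define t where "t k = T k (Ys k)" for k
  have Ys_0: "Ys 0 = X" and Ys_Suc: "Ys (Suc k) = (\<lambda>p. Ys k p - rho_OH p (t k p))" for k
    by (simp_all add: Ys_def t_def)
  have gY: "good k (Ys k)" for k
  proof (induction k)
    case 0
    show ?case
      unfolding good_def Ys_0 using van_2_hopf_tangent[OF X] by (simp add: X numeral_2_eq_2 del: van.simps)
  next
    case (Suc k)
    show ?case unfolding Ys_Suc t_def by (rule T(2)[OF Suc])
  qed
  have t: "small k (t k)" for k unfolding t_def by (rule T(1)[OF gY])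
  have Ys: "Ys N = (\<lambda>p. X p - rho_OH p (\<Sum>k<N. t k p))" for N
  proof (induction N)
    case 0
    then show ?case by (simp add: Ys_0 linear_0[OF linear_rho_OH])
  next
    case (Suc N)
    show ?case unfolding Ys_Suc Suc by (simp add: rho_OH_add diff_diff_eq)
  qed
  have ser: "series_smooth t"
    unfolding series_smooth_def
  proof (intro conjI allI impI)
    show "smooth (t k)" for k using t unfolding small_def by blast
    fix vs :: "octonion2 list" assume vs: "set vs \<subseteq> Basis"
    have "\<forall>k. \<exists>C. \<forall>p. norm (dl vs (t k) p) \<le> C"
      using t unfolding small_def by blast
    then obtain C where C: "\<And>k p. norm (dl vs (t k) p) \<le> C k" by metis
    \<comment> \<open>The correction \<open>t k\<close> is small only in derivatives of order below
      \<open>k\<close>; the finitely many indices up to \<open>length vs\<close> keep their own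
      bounds.\<close>
    let ?M = "\<lambda>k. (if k \<in> {..length vs} then \<bar>C k\<bar> else 0) + (1 / 2) ^ k"
    have "norm (dl vs (t k) p) \<le> ?M k" for k p
    proof (cases "k \<le> length vs")
      case True
      have "norm (dl vs (t k) p) \<le> \<bar>C k\<bar>" using C[of k p] by linarith
      then show ?thesis using True by (simp add: add_increasing2)
    next
      case False
      then have "norm (dl vs (t k) p) \<le> (1 / 2) ^ k"
        using t[of k] vs unfolding small_def by (meson not_le)
      then show ?thesis using False by simp
    qed
    moreover have "summable ?M"
      by (intro summable_add summable_If_finite_set summable_geometric) auto
    ultimately show "\<exists>M. summable M \<and> (\<forall>k p. norm (dl vs (t k) p) \<le> M k)" by blast
  qed
  define a where "a = (\<lambda>p. \<Sum>k. t k p)"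
  define Y where "Y = (\<lambda>p. X p - rho_OH p (a p))"
  have sa: "smooth a" unfolding a_def by (rule smooth_series_smooth[OF ser])
  have sY: "smooth Y" unfolding Y_def by (rule smooth_diff[OF X(1) smooth_rho_OH[OF sa]])
  have tY: "hopf_tangent p (Y p)" for p
    unfolding Y_def by (rule hopf_tangent_diff[OF X(2) hopf_tangent_rho_OH])
  have "van N Y" for N
  proof -
    \<comment> \<open>Beyond the first \<open>N\<close> corrections, which turn \<open>X\<close>
      into \<open>Ys N\<close>, only terms that vanish to order \<open>N\<close> are left.\<close>
    let ?r = "\<lambda>p. \<Sum>k. t (k + N) p"
    have "a p = ?r p + (\<Sum>k<N. t k p)" for p
      unfolding a_def by (rule suminf_split_initial_segment[OF series_smooth_summable[OF ser]])
    then have eq: "Y = (\<lambda>p. Ys N p - rho_OH p (?r p))"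
      unfolding Y_def Ys by (simp add: rho_OH_add algebra_simps)
    have "van N (t (k + N))" for k
      using t[of "k + N"] van_mono[of "k + N" "t (k + N)" N] unfolding small_def by simp
    then have "van N ?r"
      by (rule van_series_smooth[OF series_smooth_shift[OF ser]])
    moreover have sr: "smooth ?r" by (rule smooth_series_smooth[OF series_smooth_shift[OF ser]])
    ultimately have "van N (\<lambda>p. rho_OH p (?r p))"
      using van_rho_OH van_Suc_D by blast
    moreover have "van (N + 2) (Ys N)" "smooth (Ys N)" using gY[of N] unfolding good_def by blast+
    ultimately show ?thesis
      unfolding eq using van_mono[of "N + 2" "Ys N" N] by (intro van_diff smooth_rho_OH sr) auto
  qed
  then have fl: "flat Y" using sY by (simp add: flat_def)
  \<comment> \<open>On tangent vectors \<open>rho_OH p\<close> is multiplication by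
    \<open>p \<bullet> p\<close>, so this quotient is a preimage of \<open>Y\<close>; at the origin
    both sides are 0.\<close>
  define c where "c = (\<lambda>p. (1 / (p \<bullet> p) ^ 1) *\<^sub>R Y p)"
  have "smooth c" unfolding c_def by (rule smooth_flat_divide[OF fl])
  moreover have "rho_OH p (c p) = Y p" for p
    unfolding c_def rho_OH_scaleR rho_OH_hopf_tangent[OF tY]
    using flat_0[OF fl] by (cases "p = 0") auto
  then have "X = (\<lambda>p. rho_OH p (a p + c p))"
    by (simp add: rho_OH_add Y_def)
  ultimately show ?thesis
    using smooth_add[OF sa] by blast
qed

theorem proposition4p18:
  shows "F_OH = Cc_span {X :: octonion2 \<Rightarrow> octonion2. smooth_on UNIV X \<and> tangent_to_leaves L_OH X}"
proof -
  \<comment> \<open>The two generating sets already coincide, so their spans do.\<close>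
  have "{\<lambda>p. rho_OH p (a p) | a. smooth a} = {X. smooth X \<and> tangent_to_leaves L_OH X}"
  proof (intro equalityI subsetI)
    fix X assume "X \<in> {\<lambda>p. rho_OH p (a p) | a. smooth a}"
    then obtain a where a: "smooth a" and X: "X = (\<lambda>p. rho_OH p (a p))" by blast
    have "rho_OH 0 (a 0) = 0"
      using rho_OH_scaled[of 0 0 "a 0"] by simp
    then have "tangent_to_leaves L_OH X"
      unfolding X by (intro hopf_tangent_imp_tangent_to_leaves hopf_tangent_rho_OH)
    then show "X \<in> {X. smooth X \<and> tangent_to_leaves L_OH X}"
      using smooth_rho_OH[OF a] X by blast
  next
    fix X assume "X \<in> {X. smooth X \<and> tangent_to_leaves L_OH X}"
    then show "X \<in> {\<lambda>p. rho_OH p (a p) | a. smooth a}"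
      using hopf_tangent_imp_rho_OH[of X] tangent_to_leaves_imp_hopf_tangent[of X] by blast
  qed
  then show ?thesis unfolding F_OH_def by simp
qed

end
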